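(* For $\lambda>0$ and $\theta\in[0,1)$ let $H$ be the Fibonacci Hamiltonian on $\ell^2(\mathbb{Z})$, $[Hu](n)=u(n+1)+u(n-1)+V(n)u(n)$ with $$V(n)=\lambda\,\chi_{[1-\phi^{-1},1)}(n\phi^{-1}+\theta \bmod 1),\qquad \phi=\frac{\sqrt5+1}{2}.$$ Then, for every $\theta\in[0,1)$, $$\lim_{\lambda\to\infty}\langle\alpha_u^+\rangle\cdot\log\lambda=2\log\phi\qquad\text{and}\qquad\lim_{\lambda\to\infty}\langle\alpha_u^-\rangle\cdot\log\lambda=2\log\phi,$$ where $\langle\alpha_u^\pm\rangle$ are the time-averaged exponents associated with $H$ (depending on $\lambda$ and $\theta$).
   Context: $\{\delta_n\}_{n\in\mathbb{Z}}$ is the standard basis of $\ell^2(\mathbb{Z})$ and $\chi_A$ is the indicator function of $A$. Time averages: for a function $f$ of $t>0$ and $T>0$, $\langle f\rangle(T)=\frac2T\int_0^\infty e^{-2t/T}f(t)\,dt$. Outside probabilities: for real $N$, $P(N,t)=\sum_{n\ge N}|\langle e^{-itH}\delta_0,\delta_n\rangle|^2+\sum_{n\le -N}|\langle e^{-itH}\delta_0,\delta_n\rangle|^2$ (sums over integers $n$), and $\langle P(N,\cdot)\rangle(T)$ is its time average in $t$. For $\alpha\ge0$ let $$\langle S^-(\alpha)\rangle=-\liminf_{T\to\infty}\frac{\log\langle P(T^\alpha-1,\cdot)\rangle(T)}{\log T},\qquad \langle S^+(\alpha)\rangle=-\limsup_{T\to\infty}\frac{\log\langle P(T^\alpha-1,\cdot)\rangle(T)}{\log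 T},$$ which take values in $[0,\infty]$, and let $\langle\alpha_u^\pm\rangle=\sup\{\alpha\ge0:\langle S^\pm(\alpha)\rangle<\infty\}$. *)

theory Defs
  imports "HOL-Analysis.Analysis"
begin

definition square_summable :: "(int \<Rightarrow> complex) \<Rightarrow> bool" where
  "square_summable f \<longleftrightarrow> (\<lambda>n. (cmod (f n))\<^sup>2) summable_on UNIV"

lemma square_summable_zero: "square_summable (\<lambda>_. 0)"
  by (simp add: square_summable_def)

lemma square_summable_comparison:
  assumes "(g::int \<Rightarrow> real) summable_on UNIV" "\<And>n. (cmod (f n))\<^sup>2 \<le> g n"
  shows "square_summable f"
  unfolding square_summable_def
  by (rule summable_on_comparison_test[OF assms(1)]) (use assms(2) in auto)

lemma square_summable_add:
  assumes "square_summable f" "square_summable g"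
  shows "square_summable (\<lambda>n. f n + g n)"
proof (rule square_summable_comparison)
  show "(\<lambda>n. 2 * ((cmod (f n))\<^sup>2 + (cmod (g n))\<^sup>2)) summable_on UNIV"
    using assms unfolding square_summable_def
    by (intro summable_on_cmult_right summable_on_add)
  fix n
  have "(cmod (f n + g n))\<^sup>2 \<le> (cmod (f n) + cmod (g n))\<^sup>2"
    by (intro power_mono norm_triangle_ineq) auto
  also have "\<dots> \<le> 2 * ((cmod (f n))\<^sup>2 + (cmod (g n))\<^sup>2)"
    using zero_le_power2[of "cmod (f n) - cmod (g n)"]
    by (simp add: power2_sum power2_diff)
  finally show "(cmod (f n + g n))\<^sup>2 \<le> 2 * ((cmod (f n))\<^sup>2 + (cmod (g n))\<^sup>2)" .
qed

lemma square_summable_mult: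
  assumes "square_summable f" "\<And>n. cmod (v n) \<le> C"
  shows "square_summable (\<lambda>n. v n * f n)"
proof (rule square_summable_comparison)
  show "(\<lambda>n. C\<^sup>2 * (cmod (f n))\<^sup>2) summable_on UNIV"
    using assms(1) unfolding square_summable_def by (rule summable_on_cmult_right)
  show "(cmod (v n * f n))\<^sup>2 \<le> C\<^sup>2 * (cmod (f n))\<^sup>2" for n
    using assms(2)[of n]
    by (auto simp: norm_mult power_mult_distrib intro!: mult_right_mono power_mono)
qed

lemma square_summable_shift:
  assumes "square_summable f"
  shows "square_summable (\<lambda>n. f (n + k))"
proof -
  have "bij_betw (\<lambda>n::int. n + k) UNIV UNIV"
    by (rule bij_betw_byWitness[where f' = "\<lambda>n. n - k"]) auto
  from summable_on_reindex_bij_betw[OF this, of "\<lambda>n. (cmod (f n))\<^sup>2"]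
  show ?thesis using assms by (simp add: square_summable_def)
qed

lemma square_summable_scaleR:
  "square_summable f \<Longrightarrow> square_summable (\<lambda>n. r *\<^sub>R f n)"
  using square_summable_mult[of f "\<lambda>_. complex_of_real r" "\<bar>r\<bar>"]
  by (simp add: scaleR_conv_of_real)

lemma square_summable_diff:
  assumes "square_summable f" "square_summable g"
  shows "square_summable (\<lambda>n. f n - g n)"
  using square_summable_add[OF assms(1) square_summable_scaleR[OF assms(2), of "-1"]]
  by simp

lemma square_summable_abs_prod:
  assumes "square_summable f" "square_summable g"
  shows "(\<lambda>n. cmod (f n) * cmod (g n)) summable_on UNIV"
proof (rule summable_on_comparison_test)
  show "(\<lambda>n. (cmod (f n))\<^sup>2 + (cmod (g n))\<^sup>2) summable_on UNIV"
    using assms unfolding square_summable_def by (rule summable_on_add)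
  show "cmod (f n) * cmod (g n) \<le> (cmod (f n))\<^sup>2 + (cmod (g n))\<^sup>2" for n
    using sum_squares_bound[of "cmod (f n)" "cmod (g n)"]
      mult_nonneg_nonneg[OF norm_ge_zero[of "f n"] norm_ge_zero[of "g n"]] by linarith
qed auto

typedef ell2 = "{f. square_summable f}"
  morphisms ell2_apply Abs_ell2
  using square_summable_zero by blast

setup_lifting type_definition_ell2

instantiation ell2 :: real_inner
begin

lift_definition zero_ell2 :: ell2 is "\<lambda>_. 0" by (rule square_summable_zero)

lift_definition plus_ell2 :: "ell2 \<Rightarrow> ell2 \<Rightarrow> ell2" is "\<lambda>f g n. f n + g n"
  by (rule square_summable_add)

lift_definition minus_ell2 :: "ell2 \<Rightarrow> ell2 \<Rightarrow> ell2" is "\<lambda>f g n. f n - g n"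
  by (rule square_summable_diff)

lift_definition uminus_ell2 :: "ell2 \<Rightarrow> ell2" is "\<lambda>f n. - f n"
  by (simp add: square_summable_def)

lift_definition scaleR_ell2 :: "real \<Rightarrow> ell2 \<Rightarrow> ell2" is "\<lambda>r f n. r *\<^sub>R f n"
  by (rule square_summable_scaleR)

text \<open>The real inner product is the real part of the complex one (\<open>cinner\<close> below),
  so it induces the usual norm.\<close>

definition inner_ell2 :: "ell2 \<Rightarrow> ell2 \<Rightarrow> real" where
  "inner_ell2 f g = (\<Sum>\<^sub>\<infinity>n. Re (ell2_apply f n * cnj (ell2_apply g n)))"

definition norm_ell2 :: "ell2 \<Rightarrow> real" where
  "norm_ell2 f = sqrt (inner f f)"

definition sgn_ell2 :: "ell2 \<Rightarrow> ell2" where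
  "sgn_ell2 f = inverse (norm f) *\<^sub>R f"

definition dist_ell2 :: "ell2 \<Rightarrow> ell2 \<Rightarrow> real" where
  "dist_ell2 f g = norm (f - g)"

definition uniformity_ell2 :: "(ell2 \<times> ell2) filter" where
  "uniformity_ell2 = (INF e\<in>{0<..}. principal {(x, y). dist x y < e})"

definition open_ell2 :: "ell2 set \<Rightarrow> bool" where
  "open_ell2 U \<longleftrightarrow> (\<forall>x\<in>U. eventually (\<lambda>(x', y). x' = x \<longrightarrow> y \<in> U) uniformity)"

lemma inner_ell2_summable:
  "(\<lambda>n. Re (ell2_apply f n * cnj (ell2_apply g n))) summable_on UNIV"
proof -
  have "(\<lambda>n. cmod (ell2_apply f n) * cmod (ell2_apply g n)) summable_on UNIV"
    using ell2_apply[of f] ell2_apply[of g] by (intro square_summable_abs_prod) auto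
  then have "(\<lambda>n. norm (ell2_apply f n * cnj (ell2_apply g n))) summable_on UNIV"
    by (simp add: norm_mult)
  then show ?thesis
    by (rule summable_on_Re[OF abs_summable_summable])
qed

lemma inner_ell2_self: "inner f f = (\<Sum>\<^sub>\<infinity>n. (cmod (ell2_apply f n))\<^sup>2)" for f :: ell2
  unfolding inner_ell2_def cmod_power2
  by (intro infsum_cong) (simp add: power2_eq_square)

instance
proof
  fix x y z :: ell2 and a b :: real
  show "x + y + z = x + (y + z)" by transfer (simp add: add.assoc)
  show "x + y = y + x" by transfer (simp add: add.commute)
  show "0 + x = x" by transfer simp
  show "- x + x = 0" by transfer simp
  show "x - y = x + - y" by transfer simp
  show "a *\<^sub>R (x + y) = a *\<^sub>R x + a *\<^sub>R y" by transfer (simp add: scaleR_right_distrib)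
  show "(a + b) *\<^sub>R x = a *\<^sub>R x + b *\<^sub>R x" by transfer (simp add: scaleR_left_distrib)
  show "a *\<^sub>R b *\<^sub>R x = (a * b) *\<^sub>R x" by transfer simp
  show "1 *\<^sub>R x = x" by transfer simp
  show "sgn x = inverse (norm x) *\<^sub>R x" by (rule sgn_ell2_def)
  show "dist x y = norm (x - y)" by (rule dist_ell2_def)
  show "(uniformity :: (ell2 \<times> ell2) filter) = (INF e\<in>{0<..}. principal {(x, y). dist x y < e})"
    by (rule uniformity_ell2_def)
  show "open U \<longleftrightarrow> (\<forall>x\<in>U. eventually (\<lambda>(x', y). x' = x \<longrightarrow> y \<in> U) uniformity)" for U :: "ell2 set"
    by (rule open_ell2_def)
  show "inner x y = inner y x"
    unfolding inner_ell2_def by (simp add: mult.commute)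
  show "inner (x + y) z = inner x z + inner y z"
    unfolding inner_ell2_def infsum_add[OF inner_ell2_summable inner_ell2_summable, symmetric]
    by (intro infsum_cong) (simp add: plus_ell2.rep_eq algebra_simps)
  show "inner (a *\<^sub>R x) y = a * inner x y"
    unfolding inner_ell2_def infsum_cmult_right'[symmetric]
    by (intro infsum_cong) (simp add: scaleR_ell2.rep_eq algebra_simps)
  show "0 \<le> inner x x"
    unfolding inner_ell2_self by (intro infsum_nonneg) auto
  show "inner x x = 0 \<longleftrightarrow> x = 0"
  proof
    assume "inner x x = 0"
    then have "(cmod (ell2_apply x n))\<^sup>2 = 0" for n
      using ell2_apply[of x] unfolding inner_ell2_self square_summable_def
      by (intro nonneg_infsum_le_0D[where A = UNIV]) auto
    then show "x = 0"
      by (intro ell2_apply_inject[THEN iffD1]) (auto simp: zero_ell2.rep_eq fun_eq_iff)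
  qed (simp add: inner_ell2_def zero_ell2.rep_eq)
  show "norm x = sqrt (inner x x)" by (rule norm_ell2_def)
qed

end

lemma norm_ell2_power2: "(norm f)\<^sup>2 = (\<Sum>\<^sub>\<infinity>n. (cmod (ell2_apply f n))\<^sup>2)" for f :: ell2
  by (simp add: power2_norm_eq_inner inner_ell2_self)

lemma ell2_summable: "(\<lambda>n. (cmod (ell2_apply f n))\<^sup>2) summable_on UNIV"
  using ell2_apply[of f] by (simp add: square_summable_def)

lemma ell2_finite_sum_le:
  "finite F \<Longrightarrow> (\<Sum>n\<in>F. (cmod (ell2_apply f n))\<^sup>2) \<le> (norm f)\<^sup>2"
  unfolding norm_ell2_power2 by (rule finite_sum_le_infsum[OF ell2_summable]) auto

lemma ell2_apply_norm_le: "cmod (ell2_apply f n) \<le> norm f"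
  by (rule power2_le_imp_le) (use ell2_finite_sum_le[of "{n}" f] in auto)

lemma ell2_norm_leI:
  assumes "\<And>F. finite F \<Longrightarrow> (\<Sum>n\<in>F. (cmod (ell2_apply f n))\<^sup>2) \<le> e\<^sup>2" "0 \<le> e"
  shows "norm f \<le> e"
proof (rule power2_le_imp_le)
  show "(norm f)\<^sup>2 \<le> e\<^sup>2"
    unfolding norm_ell2_power2 by (rule infsum_le_finite_sums[OF ell2_summable]) (use assms in auto)
qed (use assms in auto)

instance ell2 :: banach
proof
  fix X :: "nat \<Rightarrow> ell2"
  assume X: "Cauchy X"
  have "Cauchy (\<lambda>k. ell2_apply (X k) n)" for n
  proof (rule metric_CauchyI)
    fix e :: real assume "0 < e"
    then obtain M where M: "\<And>k m. k \<ge> M \<Longrightarrow> m \<ge> M \<Longrightarrow> dist (X k) (X m) < e"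
      using X by (meson metric_CauchyD)
    have "dist (ell2_apply (X k) n) (ell2_apply (X m) n) \<le> dist (X k) (X m)" for k m
      using ell2_apply_norm_le[of "X k - X m" n] by (simp add: dist_norm minus_ell2.rep_eq)
    then show "\<exists>M. \<forall>k\<ge>M. \<forall>m\<ge>M. dist (ell2_apply (X k) n) (ell2_apply (X m) n) < e"
      using M by (meson order_le_less_trans)
  qed
  then have "\<exists>l. (\<lambda>k. ell2_apply (X k) n) \<longlonglongrightarrow> l" for n
    using Cauchy_convergent convergent_def by blast
  then obtain L where L: "\<And>n. (\<lambda>k. ell2_apply (X k) n) \<longlonglongrightarrow> L n"
    by metis
  have bound: "\<exists>M. \<forall>k\<ge>M. \<forall>F. finite F \<longrightarrow> (\<Sum>n\<in>F. (cmod (ell2_apply (X k) n - L n))\<^sup>2) \<le> e\<^sup>2"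
    if "0 < e" for e :: real
  proof -
    obtain M where M: "\<And>k m. k \<ge> M \<Longrightarrow> m \<ge> M \<Longrightarrow> dist (X k) (X m) < e"
      using X \<open>0 < e\<close> by (meson metric_CauchyD)
    have "(\<Sum>n\<in>F. (cmod (ell2_apply (X k) n - L n))\<^sup>2) \<le> e\<^sup>2" if "finite F" "k \<ge> M" for k F
    proof (rule tendsto_upperbound)
      show "(\<lambda>m. \<Sum>n\<in>F. (cmod (ell2_apply (X k) n - ell2_apply (X m) n))\<^sup>2)
              \<longlonglongrightarrow> (\<Sum>n\<in>F. (cmod (ell2_apply (X k) n - L n))\<^sup>2)"
        by (intro tendsto_intros L)
      have "(\<Sum>n\<in>F. (cmod (ell2_apply (X k) n - ell2_apply (X m) n))\<^sup>2) \<le> e\<^sup>2" if "m \<ge> M" for m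
      proof -
        have "(\<Sum>n\<in>F. (cmod (ell2_apply (X k) n - ell2_apply (X m) n))\<^sup>2) \<le> (norm (X k - X m))\<^sup>2"
          using ell2_finite_sum_le[OF \<open>finite F\<close>, of "X k - X m"] by (simp add: minus_ell2.rep_eq)
        also have "\<dots> \<le> e\<^sup>2"
          using M[OF \<open>k \<ge> M\<close> \<open>m \<ge> M\<close>] by (intro power_mono) (auto simp: dist_norm)
        finally show ?thesis .
      qed
      then show "\<forall>\<^sub>F m in sequentially. (\<Sum>n\<in>F. (cmod (ell2_apply (X k) n - ell2_apply (X m) n))\<^sup>2) \<le> e\<^sup>2"
        by (auto simp: eventually_sequentially)
    qed auto
    then show ?thesis by blast
  qed
  obtain M where M: "\<forall>F. finite F \<longrightarrow> (\<Sum>n\<in>F. (cmod (ell2_apply (X M) n - L n))\<^sup>2) \<le> 1\<^sup>2"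
    using bound[of 1] by auto
  have "square_summable (\<lambda>n. ell2_apply (X M) n - L n)"
    unfolding square_summable_def
    by (rule nonneg_bdd_above_summable_on) (use M in \<open>auto intro!: bdd_aboveI[where M = 1]\<close>)
  from square_summable_diff[OF ell2_apply[of "X M", unfolded mem_Collect_eq] this]
  have "square_summable L" by simp
  then have Labs: "ell2_apply (Abs_ell2 L) = L" by (simp add: Abs_ell2_inverse)
  have "X \<longlonglongrightarrow> Abs_ell2 L"
  proof (rule LIMSEQ_I)
    fix r :: real assume "0 < r"
    then obtain M where M: "\<forall>k\<ge>M. \<forall>F. finite F \<longrightarrow>
        (\<Sum>n\<in>F. (cmod (ell2_apply (X k) n - L n))\<^sup>2) \<le> (r/2)\<^sup>2"
      using bound[of "r/2"] by auto
    have "norm (X k - Abs_ell2 L) \<le> r/2" if "k \<ge> M" for k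
      by (rule ell2_norm_leI) (use M that \<open>0 < r\<close> in \<open>auto simp: minus_ell2.rep_eq Labs\<close>)
    then show "\<exists>M. \<forall>k\<ge>M. norm (X k - Abs_ell2 L) < r"
      using \<open>0 < r\<close> by (intro exI[of _ M]) fastforce
  qed
  then show "convergent X" by (auto simp: convergent_def)
qed

lift_definition cscale :: "complex \<Rightarrow> ell2 \<Rightarrow> ell2" is "\<lambda>c f n. c * f n"
  by (rule square_summable_mult) auto

definition cinner :: "ell2 \<Rightarrow> ell2 \<Rightarrow> complex" where
  "cinner f g = (\<Sum>\<^sub>\<infinity>n. ell2_apply f n * cnj (ell2_apply g n))"

lift_definition delta :: "int \<Rightarrow> ell2" is "\<lambda>k n. if n = k then 1 else 0"
proof -
  fix k :: int
  have "(\<lambda>n. (cmod (if n = k then 1 else 0))\<^sup>2) summable_on {k}" by simp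
  then show "square_summable (\<lambda>n. if n = k then 1 else 0)"
    unfolding square_summable_def
    by (rule summable_on_cong_neutral[THEN iffD1, rotated -1]) auto
qed

lemma cinner_delta: "cinner f (delta k) = ell2_apply f k"
proof -
  have "cinner f (delta k) = (\<Sum>\<^sub>\<infinity>n\<in>{k}. ell2_apply f n * cnj (ell2_apply (delta k) n))"
    unfolding cinner_def by (rule infsum_cong_neutral) (auto simp: delta.rep_eq)
  then show ?thesis by (simp add: delta.rep_eq)
qed

lemma norm_cscale: "norm (cscale c f) = cmod c * norm f"
proof -
  have "(norm (cscale c f))\<^sup>2 = (cmod c * norm f)\<^sup>2"
    unfolding power_mult_distrib norm_ell2_power2 infsum_cmult_right'[symmetric]
    by (simp add: cscale.rep_eq norm_mult power_mult_distrib)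
  then show ?thesis by (simp add: power2_eq_iff_nonneg)
qed

text \<open>\<open>evolution H t\<close> is \<open>exp (- i t H)\<close> for a bounded operator \<open>H\<close>, given by the exponential
  series.\<close>

definition evolution :: "(ell2 \<Rightarrow> ell2) \<Rightarrow> real \<Rightarrow> ell2 \<Rightarrow> ell2" where
  "evolution H t \<psi> = (\<Sum>k. cscale ((- \<i> * complex_of_real t) ^ k / fact k) ((H ^^ k) \<psi>))"

lemma summable_evolution:
  fixes H :: "ell2 \<Rightarrow> ell2"
  assumes "bounded_linear H"
  shows "summable (\<lambda>k. cscale ((- \<i> * complex_of_real t) ^ k / fact k) ((H ^^ k) \<psi>))"
proof -
  obtain K where K: "\<And>f. norm (H f) \<le> norm f * K" "K \<ge> 0"
    using bounded_linear.nonneg_bounded[OF assms] by blast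
  have pow: "norm ((H ^^ k) \<psi>) \<le> K ^ k * norm \<psi>" for k
  proof (induction k)
    case (Suc k)
    have "norm ((H ^^ Suc k) \<psi>) \<le> norm ((H ^^ k) \<psi>) * K" using K(1)[of "(H ^^ k) \<psi>"] by simp
    also have "\<dots> \<le> (K ^ k * norm \<psi>) * K" using Suc K(2) by (intro mult_right_mono)
    finally show ?case by (simp add: algebra_simps)
  qed simp
  show ?thesis
  proof (rule summable_comparison_test', rule summable_mult2)
    show "summable (\<lambda>k. (\<bar>t\<bar> * K) ^ k /\<^sub>R fact k)" by (rule summable_exp_generic)
    fix k
    have "norm (cscale ((- \<i> * complex_of_real t) ^ k / fact k) ((H ^^ k) \<psi>))
        \<le> (\<bar>t\<bar> ^ k / fact k) * (K ^ k * norm \<psi>)"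
      unfolding norm_cscale
      by (intro mult_mono pow) (auto simp: norm_divide norm_power norm_mult)
    then show "norm (cscale ((- \<i> * complex_of_real t) ^ k / fact k) ((H ^^ k) \<psi>))
        \<le> (\<bar>t\<bar> * K) ^ k /\<^sub>R fact k * norm \<psi>"
      by (simp add: power_mult_distrib field_simps)
  qed
qed

definition time_average :: "(real \<Rightarrow> real) \<Rightarrow> real \<Rightarrow> real" where
  "time_average f T = 2 / T * (LBINT t:{0<..}. exp (- 2 * t / T) * f t)"

definition outside_prob :: "(ell2 \<Rightarrow> ell2) \<Rightarrow> real \<Rightarrow> real \<Rightarrow> real" where
  "outside_prob H N t =
     (\<Sum>\<^sub>\<infinity>n\<in>{n::int. real_of_int n \<ge> N}. (cmod (cinner (evolution H t (delta 0)) (delta n)))\<^sup>2) +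
     (\<Sum>\<^sub>\<infinity>n\<in>{n::int. real_of_int n \<le> - N}. (cmod (cinner (evolution H t (delta 0)) (delta n)))\<^sup>2)"

text \<open>Logarithm with \<open>log 0 = -\<infinity>\<close> (HOL's \<open>ln\<close> is \<open>0\<close> at \<open>0\<close>).\<close>

definition ext_ln :: "real \<Rightarrow> ereal" where
  "ext_ln x = (if x > 0 then ereal (ln x) else -\<infinity>)"

definition log_ratio :: "(ell2 \<Rightarrow> ell2) \<Rightarrow> real \<Rightarrow> real \<Rightarrow> ereal" where
  "log_ratio H \<alpha> T =
     ext_ln (time_average (outside_prob H (T powr \<alpha> - 1)) T) / ereal (ln T)"

definition S_minus :: "(ell2 \<Rightarrow> ell2) \<Rightarrow> real \<Rightarrow> ereal" where
  "S_minus H \<alpha> = - Liminf at_top (log_ratio H \<alpha>)"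

definition S_plus :: "(ell2 \<Rightarrow> ell2) \<Rightarrow> real \<Rightarrow> ereal" where
  "S_plus H \<alpha> = - Limsup at_top (log_ratio H \<alpha>)"

definition alpha_u_minus :: "(ell2 \<Rightarrow> ell2) \<Rightarrow> ereal" where
  "alpha_u_minus H = Sup {ereal \<alpha> |\<alpha>. \<alpha> \<ge> 0 \<and> S_minus H \<alpha> < \<infinity>}"

definition alpha_u_plus :: "(ell2 \<Rightarrow> ell2) \<Rightarrow> ereal" where
  "alpha_u_plus H = Sup {ereal \<alpha> |\<alpha>. \<alpha> \<ge> 0 \<and> S_plus H \<alpha> < \<infinity>}"

definition golden :: real where
  "golden = (sqrt 5 + 1) / 2"

definition fib_potential :: "real \<Rightarrow> real \<Rightarrow> int \<Rightarrow> real" where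
  "fib_potential lam \<theta> n =
     lam * indicator {1 - inverse golden ..< 1} (frac (real_of_int n * inverse golden + \<theta>))"

lemma abs_fib_potential_le: "\<bar>fib_potential lam \<theta> n\<bar> \<le> \<bar>lam\<bar>"
  by (simp add: fib_potential_def indicator_def)

lift_definition fib_hamiltonian :: "real \<Rightarrow> real \<Rightarrow> ell2 \<Rightarrow> ell2" is
  "\<lambda>lam \<theta> u n. u (n + 1) + u (n - 1) + complex_of_real (fib_potential lam \<theta> n) * u n"
proof -
  fix lam \<theta> and u :: "int \<Rightarrow> complex" assume u: "square_summable u"
  have "square_summable (\<lambda>n. u (n + 1))" "square_summable (\<lambda>n. u (n - 1))"
    using square_summable_shift[OF u, of 1] square_summable_shift[OF u, of "-1"] by simp_all
  moreover have "square_summable (\<lambda>n. complex_of_real (fib_potential lam \<theta> n) * u n)"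
    using u by (rule square_summable_mult[where C = "\<bar>lam\<bar>"]) (simp add: abs_fib_potential_le)
  ultimately show "square_summable
      (\<lambda>n. u (n + 1) + u (n - 1) + complex_of_real (fib_potential lam \<theta> n) * u n)"
    by (intro square_summable_add)
qed

lemma norm_ell2_shift:
  assumes "\<And>n. ell2_apply g n = ell2_apply f (n + k)"
  shows "norm g = norm f"
proof -
  have "bij_betw (\<lambda>n::int. n + k) UNIV UNIV"
    by (rule bij_betw_byWitness[where f' = "\<lambda>n. n - k"]) auto
  from infsum_reindex_bij_betw[OF this, of "\<lambda>n. (cmod (ell2_apply f n))\<^sup>2"]
  have "(norm g)\<^sup>2 = (norm f)\<^sup>2" by (simp add: norm_ell2_power2 assms)
  then show ?thesis by (simp add: power2_eq_iff_nonneg)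
qed

lemma bounded_linear_fib_hamiltonian: "bounded_linear (fib_hamiltonian lam \<theta>)"
proof (rule bounded_linear_intro[where K = "2 + \<bar>lam\<bar>"])
  fix x y :: ell2 and r :: real
  show "fib_hamiltonian lam \<theta> (x + y) = fib_hamiltonian lam \<theta> x + fib_hamiltonian lam \<theta> y"
    by transfer (simp add: algebra_simps)
  show "fib_hamiltonian lam \<theta> (r *\<^sub>R x) = r *\<^sub>R fib_hamiltonian lam \<theta> x"
    by transfer (simp add: algebra_simps scaleR_conv_of_real)
  let ?a = "Abs_ell2 (\<lambda>n. ell2_apply x (n + 1))"
  let ?b = "Abs_ell2 (\<lambda>n. ell2_apply x (n - 1))"
  let ?c = "Abs_ell2 (\<lambda>n. complex_of_real (fib_potential lam \<theta> n) * ell2_apply x n)"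
  have x: "square_summable (ell2_apply x)" using ell2_apply[of x] by simp
  have a: "ell2_apply ?a n = ell2_apply x (n + 1)" for n
    using square_summable_shift[OF x, of 1] by (simp add: Abs_ell2_inverse)
  have b: "ell2_apply ?b n = ell2_apply x (n + (- 1))" for n
    using square_summable_shift[OF x, of "-1"] by (simp add: Abs_ell2_inverse)
  have c: "ell2_apply ?c n = complex_of_real (fib_potential lam \<theta> n) * ell2_apply x n" for n
    using square_summable_mult[OF x, of "\<lambda>n. complex_of_real (fib_potential lam \<theta> n)" "\<bar>lam\<bar>"]
    by (simp add: Abs_ell2_inverse abs_fib_potential_le)
  have "fib_hamiltonian lam \<theta> x = ?a + ?b + ?c"
    by (intro ell2_apply_inject[THEN iffD1])
      (simp add: fun_eq_iff fib_hamiltonian.rep_eq plus_ell2.rep_eq a b c)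
  also have "norm \<dots> \<le> norm ?a + norm ?b + norm ?c"
    by (intro norm_triangle_le add_right_mono norm_triangle_ineq)
  also have "norm ?a = norm x" by (rule norm_ell2_shift[OF a])
  also have "norm ?b = norm x" by (rule norm_ell2_shift[OF b])
  also have "norm ?c \<le> \<bar>lam\<bar> * norm x"
  proof (rule ell2_norm_leI)
    fix F :: "int set" assume "finite F"
    have "(\<Sum>n\<in>F. (cmod (ell2_apply ?c n))\<^sup>2) \<le> (\<Sum>n\<in>F. lam\<^sup>2 * (cmod (ell2_apply x n))\<^sup>2)"
      using abs_fib_potential_le[of lam \<theta>]
      by (intro sum_mono) (auto simp: c norm_mult power_mult_distrib abs_le_square_iff intro!: mult_right_mono)
    also have "\<dots> \<le> lam\<^sup>2 * (norm x)\<^sup>2"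
      unfolding sum_distrib_left[symmetric]
      by (intro mult_left_mono ell2_finite_sum_le \<open>finite F\<close>) auto
    finally show "(\<Sum>n\<in>F. (cmod (ell2_apply ?c n))\<^sup>2) \<le> (\<bar>lam\<bar> * norm x)\<^sup>2"
      by (simp add: power_mult_distrib)
  qed auto
  finally show "norm (fib_hamiltonian lam \<theta> x) \<le> norm x * (2 + \<bar>lam\<bar>)"
    by (simp add: algebra_simps)
qed

end

(*
  The time-averaged quantities are governed by u = (H - z)^(-1) delta_0 at Im z of order 1/T, and u is
  propagated by transfer matrices whose traces over Fibonacci words follow the trace map, with invariant
  4 + lam^2. For large lam, traces of modulus at most 3 ("small") and the others ("big", of size about
  lam) alternate as long as the orbit is bounded: never two big or three small ones in a row.

  Upper bound. If the k-th trace is small at z, its derivative in z is at least (lam/2)^(k/2 - 1), since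
  each passage to the next small trace gains a factor of order lam. The trace is a polynomial of degree
  fib k with real roots, so its derivative is at most (fib k / Im z) times its modulus. Hence
  the orbit has escaped at level k once Im z exceeds about (lam / const)^(-k/2), and then the traces grow
  doubly exponentially. A Wronskian argument turns a large trace over a block into
  decay of u beyond the block. A Plancherel inequality carries this over to the time averages.

  Lower bound. Nested intervals give a real E with every second trace up to level 2j small; this persists
  for |z - E| up to (const * lam)^(-j). There the transfer matrices are bounded by a power of T, so u
  decays at most polynomially, and the Cauchy-Schwarz inequality suffices for the time average.

  Both bounds locate the exponent at 2 ln golden / ln lam up to a factor tending to 1. Since every
  coding of the rotation desubstitutes, the argument is the same for every theta.
*)
theory Submission
  imports Defs "HOL-Probability.Probability" "HOL-Number_Theory.Fib"
    "HOL-Computational_Algebra.Fundamental_Theorem_Algebra" "HOL-Real_Asymp.Real_Asymp"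
begin

text \<open>Two levels cost a factor of order lam in time: level \<open>k\<close> corresponds to
  times near lam^(k/2) and to distances near \<open>fib k\<close>, that is golden^k, and this is
  where 2 ln golden / ln lam comes from. As only the limit in lam matters, constants multiplying lam
  inside a logarithm are harmless; thresholds such as 3, 13, 17 and 80 are chosen for convenience.

  The upper bound has to hold at all real energies at once, because the Plancherel inequality
  integrates over the whole line. Escape is therefore proved without restriction on Re z, from real
  roots and a degree count. The degree costs a factor golden^k, hence the summand
  \<open>- ln golden\<close> in the denominator of that bound. For the lower bound one energy is
  enough: a single value of the Laplace transform is dominated by a time average.

  The weight exp (-2t/T) is the square of exp (-t/T), so Plancherel is applied at Im z = 1/T,
  whereas Cauchy-Schwarz, pairing the full weight with the amplitude, is applied at Im z =
  2/T.\<close>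

section \<open>The trace map\<close>

text \<open>\<open>ftrace v z (Suc j)\<close> is the trace of the transfer matrix over the \<open>j\<close>-th Fibonacci word at
  energy \<open>z\<close>; the initial value \<open>2\<close> extends the recursion by one step.\<close>

fun ftrace :: "'a::comm_ring_1 \<Rightarrow> 'a \<Rightarrow> nat \<Rightarrow> 'a" where
  "ftrace v z 0 = 2"
| "ftrace v z (Suc 0) = z"
| "ftrace v z (Suc (Suc 0)) = z - v"
| "ftrace v z (Suc (Suc (Suc n))) = ftrace v z (Suc (Suc n)) * ftrace v z (Suc n) - ftrace v z n"

text \<open>The Fricke-Vogt invariant. As a quadratic in its first variable \<open>a\<close> the
  left side is symmetric about \<open>b * c / 2\<close>, so replacing \<open>a\<close> by
  \<open>b * c - a\<close>, which is one step of the recursion, leaves it unchanged.\<close>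

lemma ftrace_invariant:
  "(ftrace v z n)\<^sup>2 + (ftrace v z (Suc n))\<^sup>2 + (ftrace v z (Suc (Suc n)))\<^sup>2
     - ftrace v z n * ftrace v z (Suc n) * ftrace v z (Suc (Suc n)) = 4 + v\<^sup>2"
proof (induction n)
  case 0
  show ?case by (simp add: power2_eq_square algebra_simps)
next
  case (Suc n)
  then show ?case by (simp add: power2_eq_square algebra_simps)
qed

lemma ftrace_of_real:
  "ftrace (of_real v) (of_real z) n = (of_real (ftrace v z n) :: 'a::{real_algebra_1,comm_ring_1})"
  by (induction v z n rule: ftrace.induct) auto

text \<open>When the product of the big pair is at least three times the preceding modulus, the
  subtraction in the recursion removes at most a third of the product. So \<open>2/3\<close> of the
  modulus is supermultiplicative along the orbit; it starts at 2 because the threshold is 3, and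
  Fibonacci exponents result. The third conjunct carries the comparison through the
  induction.\<close>

lemma ftrace_escape_step:
  fixes z v :: "'a::{real_normed_field}"
  assumes small: "norm (ftrace v z j) \<le> 3"
    and big: "norm (ftrace v z (Suc j)) > 3" "norm (ftrace v z (Suc (Suc j))) > 3"
  shows "norm (ftrace v z (Suc j + m)) \<ge> 3 \<and>
    2/3 * norm (ftrace v z (Suc j + m)) \<ge> 2 ^ fib (Suc m) \<and>
    norm (ftrace v z (Suc j + m)) * norm (ftrace v z (Suc (Suc j) + m)) \<ge> 3 * norm (ftrace v z (j + m)) \<and>
    norm (ftrace v z (Suc (Suc j) + m)) \<ge> 3 \<and>
    2/3 * norm (ftrace v z (Suc (Suc j) + m)) \<ge> 2 ^ fib (Suc (Suc m))"
proof (induction m)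
  case 0
  have "3 * 3 \<le> norm (ftrace v z (Suc j)) * norm (ftrace v z (Suc (Suc j)))"
    using big by (intro mult_mono) auto
  then show ?case using small big by auto
next
  case (Suc m)
  define a where "a = norm (ftrace v z (j + m))"
  define b where "b = norm (ftrace v z (Suc j + m))"
  define c where "c = norm (ftrace v z (Suc (Suc j) + m))"
  define d where "d = norm (ftrace v z (Suc (Suc (Suc j)) + m))"
  have IH: "b \<ge> 3" "2/3 * b \<ge> 2 ^ fib (Suc m)" "b * c \<ge> 3 * a" "c \<ge> 3" "2/3 * c \<ge> 2 ^ fib (Suc (Suc m))"
    using Suc by (auto simp: a_def b_def c_def)
  have "c * b - a \<le> d"
    unfolding a_def b_def c_def d_def by (simp add: norm_mult[symmetric] norm_triangle_ineq2)
  then have d: "d \<ge> 2/3 * (b * c)" using IH(3) by (simp add: mult.commute)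
  have "3 * 3 \<le> b * c" using IH by (intro mult_mono) auto
  then have "3 \<le> d" using d by linarith
  have "2 ^ fib (Suc m) * 2 ^ fib (Suc (Suc m)) \<le> (2/3 * b) * (2/3 * c)"
    using IH by (intro mult_mono) auto
  also have "\<dots> \<le> 2/3 * d" using d by simp
  finally have e: "2 ^ fib (Suc (Suc (Suc m))) \<le> 2/3 * d"
    by (simp add: power_add mult.commute)
  have "3 * b \<le> c * d"
  proof -
    have "3 * 3 \<le> c * c" using IH by (intro mult_mono) auto
    then have "b * 9 \<le> b * (c * c)" using IH by (intro mult_left_mono) auto
    moreover have "c * (2/3 * (b * c)) \<le> c * d" using d IH by (intro mult_left_mono) auto
    moreover have "c * (2/3 * (b * c)) = 2/3 * (b * (c * c))" by simp
    ultimately show ?thesis using IH by linarith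
  qed
  then show ?case using IH \<open>3 \<le> d\<close> e
    unfolding a_def b_def c_def d_def by (auto simp: algebra_simps)
qed

text \<open>The escape step wants a small trace just before the big pair. The first big pair of the
  orbit has one: it does not start at level 0, where the trace is 2, and a big predecessor would
  form an earlier pair.\<close>

lemma ftrace_escape:
  fixes z v :: "'a::{real_normed_field}"
  assumes "norm (ftrace v z j) > 3" "norm (ftrace v z (Suc j)) > 3"
  shows "norm (ftrace v z (j + m)) \<ge> 2 ^ fib m" "norm (ftrace v z (j + m)) > 3"
proof -
  define P where "P i \<longleftrightarrow> norm (ftrace v z i) > 3 \<and> norm (ftrace v z (Suc i)) > 3" for i
  define i where "i = (LEAST i. P i)"
  have Pj: "P j" using assms by (auto simp: P_def)
  then have Pi: "P i" and ij: "i \<le> j" unfolding i_def by (auto intro: LeastI Least_le)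
  have "i \<noteq> 0" using Pi by (cases i) (auto simp: P_def)
  then obtain l where l: "i = Suc l" by (cases i) auto
  have "\<not> P l" using not_less_Least[of l P] l i_def by auto
  then have s: "norm (ftrace v z l) \<le> 3" using Pi l by (auto simp: P_def)
  have b: "norm (ftrace v z (Suc l)) > 3" "norm (ftrace v z (Suc (Suc l))) > 3"
    using Pi l by (auto simp: P_def)
  note st = ftrace_escape_step[OF s b, of "j + m - i"]
  have idx: "Suc l + (j + m - i) = j + m" using l ij by auto
  have "fib m \<le> fib (Suc (j + m - i))" using ij by (intro fib_mono) auto
  then have "(2::real) ^ fib m \<le> 2 ^ fib (Suc (j + m - i))" by (intro power_increasing) auto
  also have "\<dots> \<le> 2/3 * norm (ftrace v z (j + m))" using st unfolding idx by blast
  finally show "norm (ftrace v z (j + m)) \<ge> 2 ^ fib m" using norm_ge_zero[of "ftrace v z (j + m)"] by linarith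
  \<comment> \<open>An exponent of 1 gives only \<open>\<ge> 3\<close>. The first two levels are big
    by the choice of \<open>i\<close>; later ones have exponent at least 2.\<close>
  show "norm (ftrace v z (j + m)) > 3"
  proof (cases "j + m = i")
    case True then show ?thesis using Pi by (simp add: P_def)
  next
    case False
    then obtain q where q: "j + m - i = Suc q" using ij by (cases "j + m - i") auto
    have "fib (Suc (j + m - i)) \<ge> 1" by (simp add: Suc_leI fib_neq_0_nat)
    show ?thesis
    proof (cases q)
      case 0
      then have "j + m = Suc i" using q ij by auto
      then show ?thesis using Pi by (simp add: P_def)
    next
      case (Suc r)
      have "fib (Suc (Suc (Suc 0))) \<le> fib (Suc (j + m - i))" using q Suc by (intro fib_mono) auto
      then have "(2::real) ^ 2 \<le> 2 ^ fib (Suc (j + m - i))" 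
        by (intro power_increasing) (auto simp: numeral_2_eq_2)
      also have "\<dots> \<le> 2/3 * norm (ftrace v z (j + m))" using st unfolding idx by blast
      finally show ?thesis by simp
    qed
  qed
qed

lemma ftrace_no_two_big:
  fixes z v :: "'a::{real_normed_field}"
  assumes "norm (ftrace v z k) \<le> 3" "norm (ftrace v z j) > 3" "j < k"
  shows "norm (ftrace v z (Suc j)) \<le> 3"
  using ftrace_escape(2)[of v z j "k - j"] assms by fastforce

text \<open>Three moduli of at most 3 would, by the invariant, bound the square of
  \<open>norm v\<close> by 9 + 9 + 9 + 27 + 4 = 58.\<close>

lemma ftrace_no_three_small:
  fixes z v :: "'a::{real_normed_field}"
  assumes "norm (ftrace v z j) \<le> 3" "norm (ftrace v z (Suc j)) \<le> 3" "norm v \<ge> 12"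
  shows "norm (ftrace v z (Suc (Suc j))) > 3"
proof (rule ccontr)
  assume "\<not> ?thesis"
  then have c: "norm (ftrace v z (Suc (Suc j))) \<le> 3" by simp
  define a b c where abc: "a = ftrace v z j" "b = ftrace v z (Suc j)" "c = ftrace v z (Suc (Suc j))"
  have n: "norm a \<le> 3" "norm b \<le> 3" "norm c \<le> 3" using assms c abc by auto
  have "v\<^sup>2 = a\<^sup>2 + b\<^sup>2 + c\<^sup>2 - a * b * c - 4"
    using ftrace_invariant[of v z j] abc by (simp add: algebra_simps)
  then have "norm (v\<^sup>2) \<le> norm (a\<^sup>2) + norm (b\<^sup>2) + norm (c\<^sup>2) + norm (a * b * c) + norm (4::'a)"
    by (smt (verit) norm_triangle_ineq norm_triangle_ineq4)
  also have "\<dots> \<le> 3\<^sup>2 + 3\<^sup>2 + 3\<^sup>2 + 3 * 3 * 3 + 4"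
    unfolding norm_mult norm_power
    using n by (intro add_mono power_mono mult_mono) auto
  finally have "norm v ^ 2 \<le> 58" by (simp add: norm_power)
  moreover have "norm v ^ 2 \<ge> 12 ^ 2" using assms by (intro power_mono) auto
  ultimately show False by simp
qed

text \<open>With both neighbours small, the invariant says \<open>b\<^sup>2 = v\<^sup>2\<close> up
  to an error of at most 9 |b| + 22. The error is linear in |b|, so |b| stays within a constant of
  |v|.\<close>

lemma ftrace_big_between_small:
  fixes z v :: "'a::{real_normed_field}"
  assumes "norm (ftrace v z j) \<le> 3" "norm (ftrace v z (Suc (Suc j))) \<le> 3" "norm v \<ge> 22"
  shows "norm (ftrace v z (Suc j)) \<le> norm v + 12"
    and "norm (ftrace v z (Suc j)) > 3 \<Longrightarrow> norm (ftrace v z (Suc j)) \<ge> norm v - 12"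
proof -
  define a b c where abc: "a = ftrace v z j" "b = ftrace v z (Suc j)" "c = ftrace v z (Suc (Suc j))"
  have n: "norm a \<le> 3" "norm c \<le> 3" using assms abc by auto
  have inv: "b\<^sup>2 - v\<^sup>2 = a * b * c + 4 - a\<^sup>2 - c\<^sup>2"
    using ftrace_invariant[of v z j] abc by (simp add: algebra_simps)
  have r: "norm (a * b * c + 4 - a\<^sup>2 - c\<^sup>2) \<le> 9 * norm b + 22"
  proof -
    have "norm (a * b * c + 4 - a\<^sup>2 - c\<^sup>2) \<le> norm (a * b * c) + norm (4::'a) + norm (a\<^sup>2) + norm (c\<^sup>2)"
      by (smt (verit) norm_triangle_ineq norm_triangle_ineq4)
    also have "\<dots> \<le> 3 * norm b * 3 + 4 + 3\<^sup>2 + 3\<^sup>2"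
      unfolding norm_mult norm_power using n by (intro add_mono power_mono mult_mono) auto
    finally show ?thesis by simp
  qed
  have "norm b ^ 2 - norm v ^ 2 \<le> norm (b\<^sup>2 - v\<^sup>2)"
    using norm_triangle_ineq2[of "b\<^sup>2" "v\<^sup>2"] by (simp add: norm_power)
  then have u: "norm b ^ 2 - norm v ^ 2 \<le> 9 * norm b + 22" using r inv by simp
  have "norm v ^ 2 - norm b ^ 2 \<le> norm (b\<^sup>2 - v\<^sup>2)"
    using norm_triangle_ineq2[of "v\<^sup>2" "b\<^sup>2"] by (simp add: norm_power norm_minus_commute)
  then have l: "norm v ^ 2 - norm b ^ 2 \<le> 9 * norm b + 22" using r inv by simp
  have "norm b \<le> norm v + 12"
  proof (rule ccontr)
    assume "\<not> ?thesis"
    then have *: "norm b > norm v + 12" by simp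
    have "(norm b - norm v) * (norm b + norm v) \<ge> 12 * (norm b + norm v)"
      using * by (intro mult_right_mono) auto
    then show False using u * assms(3) by (simp add: power2_eq_square algebra_simps)
  qed
  moreover have "norm b \<ge> norm v - 12"
  proof (rule ccontr)
    assume "\<not> ?thesis"
    then have *: "norm b < norm v - 12" by simp
    have "(norm v - norm b) * (norm b + norm v) \<ge> 12 * (norm b + norm v)"
      using * by (intro mult_right_mono) auto
    then show False using l * assms(3) norm_ge_zero[of b] by (simp add: power2_eq_square algebra_simps)
  qed
  ultimately show "norm (ftrace v z (Suc j)) \<le> norm v + 12"
     "norm (ftrace v z (Suc j)) > 3 \<Longrightarrow> norm (ftrace v z (Suc j)) \<ge> norm v - 12"
    using abc by auto
qed

section \<open>Derivatives of the traces\<close>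

text \<open>The recursion is polymorphic in the ring; run on polynomials in the energy it supplies
  both the derivative and the degree of a trace.\<close>

definition trace_poly :: "complex \<Rightarrow> nat \<Rightarrow> complex poly" where
  "trace_poly v n = ftrace [:v:] [:0, 1:] n"

lemma poly_trace_poly: "poly (trace_poly v n) z = ftrace v z n"
  unfolding trace_poly_def
  by (induction "[:v:]" "[:0, 1::complex:]" n rule: ftrace.induct) auto

definition dtrace :: "complex \<Rightarrow> complex \<Rightarrow> nat \<Rightarrow> complex" where
  "dtrace v z n = poly (pderiv (trace_poly v n)) z"

lemma dtrace_simps:
  "dtrace v z 0 = 0" "dtrace v z (Suc 0) = 1" "dtrace v z (Suc (Suc 0)) = 1"
  "dtrace v z (Suc (Suc (Suc n))) = dtrace v z (Suc (Suc n)) * ftrace v z (Suc n)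
     + ftrace v z (Suc (Suc n)) * dtrace v z (Suc n) - dtrace v z n"
proof -
  have 2: "pderiv (2 :: complex poly) = 0"
    by (simp add: pderiv_numeral)
  show "dtrace v z 0 = 0" by (simp add: dtrace_def trace_poly_def 2)
  show "dtrace v z (Suc 0) = 1" "dtrace v z (Suc (Suc 0)) = 1"
    by (simp_all add: dtrace_def trace_poly_def pderiv_pCons)
  show "dtrace v z (Suc (Suc (Suc n))) = dtrace v z (Suc (Suc n)) * ftrace v z (Suc n)
     + ftrace v z (Suc (Suc n)) * dtrace v z (Suc n) - dtrace v z n"
    unfolding dtrace_def poly_trace_poly[symmetric] 
    by (simp add: trace_poly_def pderiv_diff pderiv_mult algebra_simps)
qed

lemma degree_trace_poly: "degree (trace_poly v n) \<le> fib n"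
proof -
  have "degree (trace_poly v n) \<le> fib n \<and> degree (trace_poly v (Suc n)) \<le> fib (Suc n) \<and>
    degree (trace_poly v (Suc (Suc n))) \<le> fib (Suc (Suc n))"
  proof (induction n)
    case 0
    show ?case by (simp add: trace_poly_def)
  next
    case (Suc n)
    have "degree (trace_poly v (Suc (Suc (Suc n)))) \<le> max (degree (trace_poly v (Suc (Suc n)) * trace_poly v (Suc n)))
        (degree (trace_poly v n))"
      unfolding trace_poly_def by (simp add: degree_diff_le_max)
    also have "\<dots> \<le> max (fib (Suc (Suc n)) + fib (Suc n)) (fib n)"
      using Suc degree_mult_le[of "trace_poly v (Suc (Suc n))" "trace_poly v (Suc n)"] by simp
    finally show ?case using Suc by auto
  qed
  then show ?thesis by blast
qed

lemma ftrace_small_before_big: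
  fixes z v :: "'a::{real_normed_field}"
  assumes "norm (ftrace v z (Suc j)) > 3" "norm (ftrace v z k) \<le> 3" "Suc j \<le> k"
  shows "norm (ftrace v z j) \<le> 3"
proof (rule ccontr)
  assume "\<not> ?thesis"
  then show False using ftrace_no_two_big[OF assms(2), of j] assms by auto
qed

text \<open>Induction to the previous small level, which is \<open>k - 1\<close> or
  \<open>k - 2\<close>; that at most two levels are passed explains the exponent. The first two
  conjuncts make the induction run: at a small level the derivative dominates its two predecessors,
  so in the differentiated recursion only terms containing a big trace are of leading order.\<close>

lemma dtrace_lower_bound:
  fixes z :: complex and lam :: real
  assumes lam: "lam \<ge> 80" and k: "2 \<le> k" and small: "cmod (ftrace (of_real lam) z k) \<le> 3"
  shows "cmod (dtrace (of_real lam) z (k - 1)) \<le> cmod (dtrace (of_real lam) z k) \<and>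
    cmod (dtrace (of_real lam) z (k - 2)) \<le> cmod (dtrace (of_real lam) z k) \<and>
    cmod (dtrace (of_real lam) z k) \<ge> (lam / 2) ^ (k div 2 - 1)"
  using k small
proof (induction k rule: less_induct)
  case (less k)
  define t where "t = ftrace (complex_of_real lam) z"
  define d where "d = dtrace (complex_of_real lam) z"
  have nl: "norm (complex_of_real lam) = lam" using lam by simp
  note IH = less.IH[folded t_def d_def]
  have small: "cmod (t k) \<le> 3" using less.prems by (simp add: t_def)
  have noBB: "cmod (t j) \<le> 3" if "cmod (t (Suc j)) > 3" "Suc j \<le> k" for j
    using ftrace_small_before_big[of "of_real lam" z j k] that small by (auto simp: t_def)
  have noSSS: "cmod (t (Suc (Suc j))) > 3" if "cmod (t j) \<le> 3" "cmod (t (Suc j)) \<le> 3" for j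
    using ftrace_no_three_small[of "of_real lam" z j] that nl lam by (auto simp: t_def)
  have size: "cmod (t (Suc j)) \<le> lam + 12" "cmod (t (Suc j)) > 3 \<longrightarrow> cmod (t (Suc j)) \<ge> lam - 12"
    if "cmod (t j) \<le> 3" "cmod (t (Suc (Suc j))) \<le> 3" for j
    using ftrace_big_between_small[of "of_real lam" z j] that nl lam by (auto simp: t_def)
  have trec: "t (Suc (Suc (Suc j))) = t (Suc (Suc j)) * t (Suc j) - t j" for j
    by (simp add: t_def)
  have drec: "d (Suc (Suc (Suc j))) = d (Suc (Suc j)) * t (Suc j) + t (Suc (Suc j)) * d (Suc j) - d j" for j
    by (simp add: t_def d_def dtrace_simps)
  have d012: "d 0 = 0" "d (Suc 0) = 1" "d (Suc (Suc 0)) = 1"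
    by (simp_all add: d_def dtrace_simps)
  consider "k = 2" | "k = 3" | i where "k = Suc (Suc (Suc (Suc i)))"
    using \<open>2 \<le> k\<close> by (metis One_nat_def add_2_eq_Suc le_Suc_ex numeral_2_eq_2 numeral_3_eq_3 old.nat.exhaust)
  then have "cmod (d (k - 1)) \<le> cmod (d k) \<and> cmod (d (k - 2)) \<le> cmod (d k) \<and>
    cmod (d k) \<ge> (lam / 2) ^ (k div 2 - 1)"
  proof cases
    case 1
    then show ?thesis using d012 by (simp add: numeral_2_eq_2)
  next
    case 2
    have t12: "t (Suc 0) = z" "t (Suc (Suc 0)) = z - lam" by (simp_all add: t_def)
    have d3: "d 3 = z + (z - lam)" using drec[of 0] by (simp add: d012 t12 numeral_3_eq_3)
    \<comment> \<open>Since level 3 is small, levels 1 and 2 are not both big; in either case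
      \<open>2 * z - lam\<close> has modulus at least \<open>lam - 6\<close>.\<close>
    have "cmod z \<le> 3 \<or> cmod (z - lam) \<le> 3"
      using noBB[of "Suc 0"] 2 t12 by (cases "cmod (z - lam) \<le> 3") auto
    then have "cmod (z + (z - lam)) \<ge> lam - 6"
    proof
      assume "cmod z \<le> 3"
      have "lam = cmod (complex_of_real lam)" using nl by simp
      also have "\<dots> = cmod ((z + z) - (z + (z - lam)))" by simp
      also have "\<dots> \<le> cmod z + cmod z + cmod (z + (z - lam))"
        by (smt (verit) norm_triangle_ineq norm_triangle_ineq4)
      finally show ?thesis using \<open>cmod z \<le> 3\<close> by simp
    next
      assume a: "cmod (z - lam) \<le> 3"
      have "lam = cmod (complex_of_real lam)" using nl by simp
      also have "\<dots> = cmod ((z + (z - lam)) - ((z - lam) + (z - lam)))" by simp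
      also have "\<dots> \<le> cmod (z - lam) + cmod (z - lam) + cmod (z + (z - lam))"
        by (smt (verit) norm_triangle_ineq norm_triangle_ineq4)
      finally show ?thesis using a by simp
    qed
    moreover have "(3::nat) div 2 - 1 = 0" by simp
    ultimately show ?thesis using 2 d012 d3 lam by (simp add: numeral_2_eq_2 numeral_3_eq_3)
  next
    case 3
    let ?x = "t k" and ?b = "t (Suc (Suc (Suc i)))" and ?y = "t (Suc (Suc i))"
      and ?w = "t (Suc i)" and ?v = "t i"
      and ?b' = "d (Suc (Suc (Suc i)))" and ?y' = "d (Suc (Suc i))" and ?w' = "d (Suc i)" and ?v' = "d i"
    show ?thesis
    proof (cases "cmod ?b \<le> 3")
      case bS: False
      then have yS: "cmod ?y \<le> 3" using noBB[of "Suc (Suc i)"] 3 by auto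
      have bsize: "cmod ?b \<ge> lam - 12" "cmod ?b \<le> lam + 12"
        using size[of "Suc (Suc i)"] yS small bS 3 by auto
      have IHy: "cmod (?w') \<le> cmod (?y')" "cmod (?v') \<le> cmod (?y')"
          "cmod (?y') \<ge> (lam / 2) ^ (Suc (Suc i) div 2 - 1)"
        using IH[of "Suc (Suc i)"] yS 3 by (auto simp: t_def)
      let ?D = "cmod (?y')"
      have D0: "?D \<ge> 0" by simp
      \<comment> \<open>If the trace \<open>?w\<close> at level \<open>k - 3\<close> is small, the
        derivative \<open>?b'\<close> at level \<open>k - 1\<close> is of order \<open>?D\<close>
        only and \<open>?b * ?y'\<close> dominates. If \<open>?w\<close> is big, \<open>?b'\<close>
        may itself be of order \<open>lam * ?D\<close>.\<close>
      have main: "cmod (?b') \<le> (lam + 16) * ?D \<and> cmod (d k) \<ge> (lam - 34) * ?D \<and> 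
         cmod (?b') \<le> cmod (d k)"
      proof (cases "cmod ?w \<le> 3")
        case wS: True
        have "cmod (?b') \<le> cmod (?y') * cmod ?w + cmod ?y * cmod (?w') + cmod (?v')"
          unfolding drec by (smt (verit) norm_mult norm_triangle_ineq norm_triangle_ineq4)
        also have "\<dots> \<le> ?D * 3 + 3 * ?D + ?D"
          using wS yS IHy by (intro add_mono mult_mono) auto
        finally have b': "cmod (?b') \<le> 7 * ?D" by simp
        have dk: "d k = ?b * ?y' + (?b' * ?y - ?w')"
          using drec[of "Suc i"] 3 by (simp add: algebra_simps)
        have "cmod (?b' * ?y - ?w') \<le> 7 * ?D * 3 + ?D"
          by (rule order.trans[OF norm_triangle_ineq4], unfold norm_mult, intro add_mono mult_mono)
            (use b' yS IHy in auto)
        then have "cmod (d k) \<ge> cmod ?b * ?D - 22 * ?D"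
          unfolding dk using norm_diff_ineq[of "?b * ?y'" "(?b' * ?y - ?w')"]
          by (simp add: norm_mult)
        moreover have "cmod ?b * ?D \<ge> (lam - 12) * ?D" using bsize by (intro mult_right_mono) auto
        ultimately have "cmod (d k) \<ge> (lam - 34) * ?D" by (simp add: algebra_simps)
        moreover have "(lam - 34) * ?D \<ge> 7 * ?D" "7 * ?D \<le> (lam + 16) * ?D" using lam by (intro mult_right_mono; simp)+
        ultimately show ?thesis using b' by auto
      next
        case wB: False
        then have vS: "cmod ?v \<le> 3" using noBB[of i] 3 by auto
        have wsize: "cmod ?w \<le> lam + 12" using size[of i] vS yS by auto
        have "cmod (?b') \<le> cmod (?y') * cmod ?w + cmod ?y * cmod (?w') + cmod (?v')"
          unfolding drec by (smt (verit) norm_mult norm_triangle_ineq norm_triangle_ineq4)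
        also have "\<dots> \<le> ?D * (lam + 12) + 3 * ?D + ?D"
          using wsize yS IHy by (intro add_mono mult_mono) auto
        finally have b': "cmod (?b') \<le> (lam + 16) * ?D" by (simp add: algebra_simps)
        have bb: "?b = ?y * ?w - ?v" by (rule trec)
        \<comment> \<open>Two terms of order \<open>lam * ?D\<close> threaten to cancel. Replacing
          \<open>?y * ?w\<close> by \<open>?b + ?v\<close> shows that both contain
          \<open>?b * ?y'\<close> with the same sign, so they add up.\<close>
        have dk: "d k = 2 * ?b * ?y' + 
            (?v * ?y' + ?y * (?y * ?w') - ?y * ?v' - ?w')"
        proof -
          have yw: "?y * ?w = ?b + ?v" using bb by simp
          have "d k = (?y * ?w) * ?y' + ?b * ?y'
             + ?y * (?y * ?w') - ?y * ?v' - ?w'"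
            unfolding 3 drec[of "Suc i"] drec[of i] by (simp add: algebra_simps)
          then show ?thesis unfolding yw by (simp add: algebra_simps)
        qed
        have "cmod (?v * ?y' + ?y * (?y * ?w') - ?y * ?v' - ?w')
           \<le> cmod ?v * ?D + cmod ?y * (cmod ?y * cmod (?w')) + cmod ?y * cmod (?v') + cmod (?w')"
          unfolding norm_mult[symmetric] by (smt (verit) norm_triangle_ineq norm_triangle_ineq4)
        also have "\<dots> \<le> 3 * ?D + 3 * (3 * ?D) + 3 * ?D + ?D"
          using vS yS IHy by (intro add_mono mult_mono) auto
        finally have "cmod (d k) \<ge> cmod (2 * ?b * ?y') - 16 * ?D"
          unfolding dk using norm_diff_ineq[of "2 * ?b * ?y'" "(?v * ?y' + ?y * (?y * ?w') - ?y * ?v' - ?w')"]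
          by simp
        moreover have "cmod (2 * ?b * ?y') \<ge> 2 * (lam - 12) * ?D" 
          unfolding norm_mult using bsize by (intro mult_right_mono mult_left_mono) auto
        ultimately have *: "cmod (d k) \<ge> (2 * lam - 40) * ?D" by (simp add: algebra_simps)
        moreover have "(2 * lam - 40) * ?D \<ge> (lam - 34) * ?D" "(2 * lam - 40) * ?D \<ge> (lam + 16) * ?D"
          using lam by (intro mult_right_mono; simp)+
        ultimately show ?thesis using b' by auto
      qed
      have "(lam / 2) ^ (k div 2 - 1) = lam / 2 * (lam / 2) ^ (Suc (Suc i) div 2 - 1)"
        using 3 by (cases i) auto
      also have "\<dots> \<le> (lam - 34) * ?D"
        using lam IHy by (intro mult_mono) auto
      also have "\<dots> \<le> cmod (d k)" using main by simp
      finally have fin: "(lam / 2) ^ (k div 2 - 1) \<le> cmod (d k)" .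
      have "1 * ?D \<le> (lam - 34) * ?D" using lam by (intro mult_right_mono) auto
      then have "?D \<le> cmod (d k)" using main by simp
      then show ?thesis using main fin 3 by simp
    next
      \<comment> \<open>Levels \<open>k - 1\<close> and \<open>k\<close> are both small, so level
        \<open>k - 2\<close> is big. It provides the gain, while the induction goes back by one
        level only.\<close>
      case bS: True
      then have yB: "cmod ?y > 3" using noSSS[of "Suc (Suc i)"] small 3 by fastforce
      then have wS: "cmod ?w \<le> 3" using noBB[of "Suc i"] 3 by auto
      have ysize: "cmod ?y \<ge> lam - 12" using size[of "Suc i"] wS bS yB by auto
      have IHy: "cmod (?y') \<le> cmod (?b')" "cmod (?w') \<le> cmod (?b')"
          "cmod (?b') \<ge> (lam / 2) ^ (Suc (Suc (Suc i)) div 2 - 1)"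
        using IH[of "Suc (Suc (Suc i))"] bS 3 by (auto simp: t_def)
      let ?D = "cmod (?b')"
      have dk: "d k = ?y * ?b' + (?b * ?y' - ?w')"
        using drec[of "Suc i"] 3 by (simp add: algebra_simps)
      have "cmod (?b * ?y' - ?w') \<le> 3 * ?D + ?D"
        by (rule order.trans[OF norm_triangle_ineq4], unfold norm_mult, intro add_mono mult_mono)
            (use bS IHy in auto)
      then have "cmod (d k) \<ge> cmod ?y * ?D - 4 * ?D"
        unfolding dk using norm_diff_ineq[of "?y * ?b'" "(?b * ?y' - ?w')"]
        by (simp add: norm_mult)
      moreover have "cmod ?y * ?D \<ge> (lam - 12) * ?D" using ysize by (intro mult_right_mono) auto
      ultimately have main: "cmod (d k) \<ge> (lam - 16) * ?D" by (simp add: algebra_simps)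
      have "(lam / 2) ^ (k div 2 - 1) \<le> lam / 2 * (lam / 2) ^ (Suc (Suc (Suc i)) div 2 - 1)"
        unfolding power_Suc[symmetric] using 3 lam by (intro power_increasing) auto
      also have "\<dots> \<le> (lam - 16) * ?D"
        using lam IHy by (intro mult_mono) auto
      finally have fin: "(lam / 2) ^ (k div 2 - 1) \<le> cmod (d k)" using main by simp
      have "1 * ?D \<le> (lam - 16) * ?D" using lam by (intro mult_right_mono) auto
      then have "?D \<le> cmod (d k)" using main by simp
      then show ?thesis using main fin 3 IHy by auto
    qed
  qed
  then show ?case by (simp add: d_def)
qed

text \<open>The logarithmic derivative is the sum of 1 / (z - r) over the roots, and |z - r| is at
  least \<open>Im z\<close> for real r. The induction splits off one root at a time.\<close>

lemma pderiv_bound_real_roots: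
  fixes p :: "complex poly"
  assumes "\<And>r. poly p r = 0 \<Longrightarrow> Im r = 0" "Im z > 0"
  shows "cmod (poly (pderiv p) z) \<le> degree p / Im z * cmod (poly p z)"
  using assms(1)
proof (induction "degree p" arbitrary: p)
  case 0
  then show ?case using degree_eq_zeroE[of p] by (metis div_0 mult_zero_left norm_zero of_nat_0 order_refl pderiv_0 pderiv_pCons poly_0 add_0 mult_zero_right pCons_0_0 smult_0_right)
next
  case (Suc n)
  then have "\<not> constant (poly p)" by (simp add: constant_degree)
  then obtain r where r: "poly p r = 0" using fundamental_theorem_of_algebra by blast
  then obtain q where q: "p = [:- r, 1:] * q" using poly_eq_0_iff_dvd by (metis dvdE)
  have "q \<noteq> 0" using q Suc(2) by auto
  then have dq: "n = degree q" using q Suc(2) degree_mult_eq[of "[:- r, 1:]" q] by simp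
  have rq: "Im s = 0" if "poly q s = 0" for s using Suc(3)[of s] that q by simp
  have IH: "cmod (poly (pderiv q) z) \<le> n / Im z * cmod (poly q z)"
    using Suc(1)[OF dq] rq dq by simp
  have "Im r = 0" using Suc(3) r by blast
  then have ge: "Im z \<le> cmod (z - r)" using abs_Im_le_cmod[of "z - r"] by simp
  have "poly (pderiv p) z = poly q z + (z - r) * poly (pderiv q) z"
    unfolding q pderiv_mult by (simp add: pderiv_pCons algebra_simps)
  then have "cmod (poly (pderiv p) z) \<le> cmod (poly q z) + cmod (z - r) * cmod (poly (pderiv q) z)"
    by (simp add: norm_triangle_ineq norm_mult[symmetric])
  also have "\<dots> \<le> cmod (z - r) / Im z * cmod (poly q z) + cmod (z - r) * (n / Im z * cmod (poly q z))"
  proof (intro add_mono mult_left_mono IH)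
    have "1 \<le> cmod (z - r) / Im z" using ge assms(2) by simp
    from mult_right_mono[OF this norm_ge_zero[of "poly q z"]]
    show "cmod (poly q z) \<le> cmod (z - r) / Im z * cmod (poly q z)" by simp
  qed auto
  also have "\<dots> = Suc n / Im z * (cmod (z - r) * cmod (poly q z))"
    by (simp add: algebra_simps add_divide_distrib)
  also have "cmod (z - r) * cmod (poly q z) = cmod (poly p z)"
    unfolding q by (simp add: norm_mult[symmetric] algebra_simps)
  finally show ?case using Suc(2) by simp
qed

section \<open>Two by two matrices\<close>

datatype 'a mat2 = Mat2 (m11: 'a) (m12: 'a) (m21: 'a) (m22: 'a)

instantiation mat2 :: (comm_ring_1) ring_1
begin

definition zero_mat2 :: "'a mat2" where "0 = Mat2 0 0 0 0"
definition one_mat2 :: "'a mat2" where "1 = Mat2 1 0 0 1"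
definition plus_mat2 :: "'a mat2 \<Rightarrow> 'a mat2 \<Rightarrow> 'a mat2" where
  "M + N = Mat2 (m11 M + m11 N) (m12 M + m12 N) (m21 M + m21 N) (m22 M + m22 N)"
definition minus_mat2 :: "'a mat2 \<Rightarrow> 'a mat2 \<Rightarrow> 'a mat2" where
  "M - N = Mat2 (m11 M - m11 N) (m12 M - m12 N) (m21 M - m21 N) (m22 M - m22 N)"
definition uminus_mat2 :: "'a mat2 \<Rightarrow> 'a mat2" where
  "- M = Mat2 (- m11 M) (- m12 M) (- m21 M) (- m22 M)"
definition times_mat2 :: "'a mat2 \<Rightarrow> 'a mat2 \<Rightarrow> 'a mat2" where
  "M * N = Mat2 (m11 M * m11 N + m12 M * m21 N) (m11 M * m12 N + m12 M * m22 N)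
                (m21 M * m11 N + m22 M * m21 N) (m21 M * m12 N + m22 M * m22 N)"

instance
  by standard (auto simp: zero_mat2_def one_mat2_def plus_mat2_def minus_mat2_def uminus_mat2_def
      times_mat2_def algebra_simps intro: mat2.expand)

end

lemmas mat2_defs = zero_mat2_def one_mat2_def plus_mat2_def minus_mat2_def uminus_mat2_def
  times_mat2_def

definition mscale :: "'a::comm_ring_1 \<Rightarrow> 'a mat2 \<Rightarrow> 'a mat2" where
  "mscale c M = Mat2 (c * m11 M) (c * m12 M) (c * m21 M) (c * m22 M)"

definition mtr :: "'a::comm_ring_1 mat2 \<Rightarrow> 'a" where "mtr M = m11 M + m22 M"

definition mdet :: "'a::comm_ring_1 mat2 \<Rightarrow> 'a" where "mdet M = m11 M * m22 M - m12 M * m21 M"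

lemma mdet_mult: "mdet (M * N) = mdet M * mdet N"
  by (simp add: mdet_def times_mat2_def algebra_simps)

lemma mdet_one: "mdet 1 = 1"
  by (simp add: mdet_def one_mat2_def)

lemma mat2_eqI: "m11 M = m11 N \<Longrightarrow> m12 M = m12 N \<Longrightarrow> m21 M = m21 N \<Longrightarrow> m22 M = m22 N \<Longrightarrow> M = N"
  by (rule mat2.expand) auto

lemma mat2_square: "M * M = mscale (mtr M) M - mscale (mdet M) 1"
  by (rule mat2_eqI) (simp_all add: mat2_defs mscale_def mtr_def mdet_def algebra_simps)

text \<open>Cayley-Hamilton for \<open>M + N\<close>, minus the same identity for \<open>M\<close>
  and for \<open>N\<close>. It trades a product for the reversed one.\<close>

lemma mat2_mult_commute:
  "M * N = mscale (mtr M) N + mscale (mtr N) M + mscale (mtr (M * N) - mtr M * mtr N) 1 - N * M"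
  by (rule mat2_eqI) (simp_all add: mat2_defs mscale_def mtr_def algebra_simps)

text \<open>The origin of the trace map: if \<open>N\<close> and \<open>M\<close> are consecutive
  Fibonacci matrices, the one three levels above \<open>N\<close> is
  \<open>M * (N * M)\<close>.\<close>

lemma mtr_sandwich:
  assumes "mdet M = 1"
  shows "mtr (M * (N * M)) = mtr (N * M) * mtr M - mtr N"
proof -
  have "mtr (M * (N * M)) = mtr (N * M) * mtr M - mdet M * mtr N"
    by (simp add: mat2_defs mtr_def mdet_def algebra_simps)
  then show ?thesis using assms by simp
qed

definition mapply :: "'a::comm_ring_1 mat2 \<Rightarrow> 'a \<times> 'a \<Rightarrow> 'a \<times> 'a" where
  "mapply M x = (m11 M * fst x + m12 M * snd x, m21 M * fst x + m22 M * snd x)"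

lemma mapply_mult: "mapply (M * N) x = mapply M (mapply N x)"
  by (simp add: mapply_def times_mat2_def algebra_simps)

lemma mapply_one: "mapply 1 x = x"
  by (simp add: mapply_def one_mat2_def)

definition mnorm :: "complex mat2 \<Rightarrow> real" where
  "mnorm M = cmod (m11 M) + cmod (m12 M) + cmod (m21 M) + cmod (m22 M)"

lemma mnorm_nonneg: "0 \<le> mnorm M"
  by (simp add: mnorm_def)

lemma mnorm_add: "mnorm (M + N) \<le> mnorm M + mnorm N"
  by (simp add: mnorm_def plus_mat2_def)
    (smt (verit) norm_triangle_ineq)

lemma mnorm_mult: "mnorm (M * N) \<le> mnorm M * mnorm N"
proof -
  have "cmod (a * b + c * d) \<le> cmod a * cmod b + cmod c * cmod d" for a b c d :: complex
    by (metis norm_mult norm_triangle_ineq)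
  note * = this
  have "mnorm (M * N) \<le> (cmod (m11 M) * cmod (m11 N) + cmod (m12 M) * cmod (m21 N))
     + (cmod (m11 M) * cmod (m12 N) + cmod (m12 M) * cmod (m22 N))
     + (cmod (m21 M) * cmod (m11 N) + cmod (m22 M) * cmod (m21 N))
     + (cmod (m21 M) * cmod (m12 N) + cmod (m22 M) * cmod (m22 N))"
    unfolding mnorm_def times_mat2_def mat2.sel by (intro add_mono *)
  also have "\<dots> \<le> mnorm M * mnorm N"
    unfolding mnorm_def by (simp add: algebra_simps add_nonneg_nonneg)
  finally show ?thesis .
qed

lemma mnorm_mscale: "mnorm (mscale c M) = cmod c * mnorm M"
  by (simp add: mnorm_def mscale_def norm_mult algebra_simps)

lemma mnorm_one: "mnorm 1 = 2"
  by (simp add: mnorm_def one_mat2_def)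

section \<open>Coded words and their renormalisation\<close>

lemma golden_gt_1: "golden > 1"
proof -
  have "sqrt 5 > 1" by simp
  then show ?thesis by (simp add: golden_def)
qed

lemma golden_square: "golden\<^sup>2 = golden + 1"
  by (simp add: golden_def power2_eq_square field_simps)

definition slope :: real where "slope = inverse golden"

lemma slope_square: "slope\<^sup>2 = 1 - slope"
  using golden_square golden_gt_1 by (simp add: slope_def power2_eq_square field_simps)

lemma slope_bounds: "slope > 0" "slope < 1" "slope > 1/2"
proof -
  show 0: "slope > 0" "slope < 1" using golden_gt_1 by (auto simp: slope_def inverse_less_1_iff)
  show "slope > 1/2"
  proof (rule ccontr)
    assume "\<not> ?thesis"
    then have "slope * slope \<le> 1/2 * (1/2)" using 0 by (intro mult_mono) auto
    then show False using slope_square \<open>\<not> _\<close> by (simp add: power2_eq_square)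
  qed
qed

text \<open>Allowing both end points of \<open>[0,1]\<close> makes the class closed under reflection and
  renormalisation; it contains the codings by \<open>[1 - slope, 1)\<close> as well as by \<open>(1 - slope, 1]\<close>.\<close>

definition coded :: "(nat \<Rightarrow> bool) \<Rightarrow> bool" where
  "coded w \<longleftrightarrow> (\<exists>x::nat \<Rightarrow> real. \<forall>n. 0 \<le> x n \<and> x n \<le> 1 \<and> x (Suc n) = x n + slope - of_bool (w n))"

text \<open>Two letters \<open>False\<close> in a row would move the phase by twice
  \<open>slope\<close>, more than the length of the unit interval.\<close>

lemma coded_False_True:
  assumes "coded w" "\<not> w n"
  shows "w (Suc n)"
proof (rule ccontr)
  assume "\<not> ?thesis"
  obtain x where x: "\<And>n. 0 \<le> x n \<and> x n \<le> 1 \<and> x (Suc n) = x n + slope - of_bool (w n)"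
    using assms(1) coded_def by blast
  show False using x[of n] x[of "Suc n"] x[of "Suc (Suc n)"] assms(2) \<open>\<not> w (Suc n)\<close> slope_bounds by simp
qed

text \<open>Up to an incomplete first block, a coded word is the image of its renormalisation under
  \<open>True \<mapsto> True False\<close>, \<open>False \<mapsto> True\<close>; blocks start at the letters \<open>True\<close>.\<close>

fun block_start :: "(nat \<Rightarrow> bool) \<Rightarrow> nat \<Rightarrow> nat" where
  "block_start w 0 = (if w 0 then 0 else 1)"
| "block_start w (Suc i) = (if w (Suc (block_start w i)) then Suc (block_start w i) else Suc (Suc (block_start w i)))"

definition renorm :: "(nat \<Rightarrow> bool) \<Rightarrow> nat \<Rightarrow> bool" where
  "renorm w i = (\<not> w (Suc (block_start w i)))"

lemma block_start_True: "coded w \<Longrightarrow> w (block_start w i)"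
  by (induction i) (auto intro: coded_False_True)

lemma coded_renorm:
  assumes "coded w"
  shows "coded (renorm w)"
proof -
  obtain x where x: "\<And>n. 0 \<le> x n \<and> x n \<le> 1 \<and> x (Suc n) = x n + slope - of_bool (w n)"
    using assms coded_def by blast
  \<comment> \<open>At block starts the phase lies in [1 - slope, 1]. This interval is stretched to
    unit length and reflected; because \<open>slope\<^sup>2 = 1 - slope\<close>, the return steps
    \<open>slope - 1\<close> and \<open>2 * slope - 1\<close> turn into \<open>slope\<close> and
    \<open>slope - 1\<close>, which is the original rotation.\<close>
  define y where "y i = (1 - x (block_start w i)) / slope" for i
  have "0 \<le> y i \<and> y i \<le> 1 \<and> y (Suc i) = y i + slope - of_bool (renorm w i)" for i
  proof (intro conjI)
    let ?q = "block_start w i"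
    have wq: "w ?q" using block_start_True[OF assms] .
    show "0 \<le> y i" using x[of ?q] slope_bounds by (simp add: y_def)
    show "y i \<le> 1" using x[of ?q] x[of "Suc ?q"] slope_bounds wq by (simp add: y_def field_simps)
    have sl: "slope * slope = 1 - slope" using slope_square by (simp add: power2_eq_square)
    show "y (Suc i) = y i + slope - of_bool (renorm w i)"
    proof (cases "w (Suc ?q)")
      case True
      then show ?thesis using x[of ?q] wq slope_bounds sl by (simp add: y_def renorm_def field_simps)
    next
      case False
      then show ?thesis using x[of ?q] x[of "Suc ?q"] wq slope_bounds sl by (simp add: y_def renorm_def field_simps)
    qed
  qed
  then show ?thesis unfolding coded_def by blast
qed

section \<open>Transfer matrices along words and Fibonacci blocks\<close>

fun word_prod :: "(bool \<Rightarrow> 'a::comm_ring_1 mat2) \<Rightarrow> (nat \<Rightarrow> bool) \<Rightarrow> nat \<Rightarrow> nat \<Rightarrow> 'a mat2" where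
  "word_prod L w a 0 = 1"
| "word_prod L w a (Suc l) = L (w (a + l)) * word_prod L w a l"

lemma word_prod_add: "word_prod L w a (l + m) = word_prod L w (a + l) m * word_prod L w a l"
  by (induction m) (auto simp: algebra_simps)

text \<open>The right factor acts first: the word of level \<open>n + 1\<close> is followed by that
  of level \<open>n\<close>, in accordance with the substitution of \<open>True\<close> by
  \<open>True False\<close>.\<close>

fun fib_mat :: "(bool \<Rightarrow> 'a::comm_ring_1 mat2) \<Rightarrow> nat \<Rightarrow> 'a mat2" where
  "fib_mat L 0 = L False"
| "fib_mat L (Suc 0) = L True"
| "fib_mat L (Suc (Suc n)) = fib_mat L n * fib_mat L (Suc n)"

text \<open>Possible transfer matrices across the incomplete block preceding the first block of level \<open>j\<close>.\<close>

fun fib_tails :: "(bool \<Rightarrow> 'a::comm_ring_1 mat2) \<Rightarrow> nat \<Rightarrow> 'a mat2 set" where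
  "fib_tails L 0 = {1}"
| "fib_tails L (Suc j) = fib_tails L j \<union> (\<lambda>R. fib_mat L j * R) ` fib_tails L j"

text \<open>Renormalisation iterated \<open>J\<close> times. The positions \<open>p\<close> are
  fixed before \<open>L\<close>, so the same blocks serve all energies; the Plancherel argument
  compares sums over fixed sets of sites and relies on this.\<close>

lemma block_decomposition:
  assumes "coded w"
  shows "\<exists>w' p. coded w' \<and> (\<forall>i. p (Suc i) = p i + (if w' i then fib (J + 2) else fib (J + 1)) \<and>
      (\<forall>L::bool \<Rightarrow> 'a::comm_ring_1 mat2. word_prod L w (p i) (p (Suc i) - p i) = fib_mat L (if w' i then Suc J else J))) \<and>
      p 0 < fib (J + 2) \<and> (\<forall>L::bool \<Rightarrow> 'a mat2. word_prod L w 0 (p 0) \<in> fib_tails L J)"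
proof (induction J)
  case 0
  show ?case
    by (rule exI[of _ w], rule exI[of _ "\<lambda>i. i"]) (use assms in \<open>auto simp: numeral_2_eq_2\<close>)
next
  case (Suc J)
  then obtain w' p where w': "coded w'"
    and p: "\<And>i. p (Suc i) = p i + (if w' i then fib (J + 2) else fib (J + 1))"
      "\<And>i L. word_prod L w (p i) (p (Suc i) - p i) = (fib_mat L (if w' i then Suc J else J) :: 'a mat2)"
    and p0: "p 0 < fib (J + 2)" "\<And>L::bool \<Rightarrow> 'a mat2. word_prod L w 0 (p 0) \<in> fib_tails L J"
    by metis
  define q where "q = block_start w'"
  have True_q: "w' (q i)" for i using block_start_True[OF w'] by (simp add: q_def)
  have step: "p (q (Suc i)) = p (q i) + (if renorm w' i then fib (Suc J + 2) else fib (Suc J + 1))"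
    "word_prod L w (p (q i)) (p (q (Suc i)) - p (q i)) = fib_mat L (if renorm w' i then Suc (Suc J) else Suc J)"
    for i and L :: "bool \<Rightarrow> 'a mat2"
  proof -
    show "p (q (Suc i)) = p (q i) + (if renorm w' i then fib (Suc J + 2) else fib (Suc J + 1))"
      using True_q[of i] p(1)[of "q i"] p(1)[of "Suc (q i)"]
      by (auto simp: q_def[symmetric] renorm_def) (auto simp: q_def)
    show "word_prod L w (p (q i)) (p (q (Suc i)) - p (q i)) = fib_mat L (if renorm w' i then Suc (Suc J) else Suc J)"
    proof (cases "w' (Suc (q i))")
      case True
      then have "q (Suc i) = Suc (q i)" by (simp add: q_def)
      then show ?thesis using p(2)[of L "q i"] True_q[of i] True by (simp add: renorm_def q_def)
    next
      case False
      then have qq: "q (Suc i) = Suc (Suc (q i))" by (simp add: q_def)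
      have e: "p (Suc (Suc (q i))) - p (q i) = (p (Suc (q i)) - p (q i)) + (p (Suc (Suc (q i))) - p (Suc (q i)))"
        and e2: "p (q i) + (p (Suc (q i)) - p (q i)) = p (Suc (q i))"
        using p(1)[of "q i"] p(1)[of "Suc (q i)"] by auto
      show ?thesis unfolding qq e word_prod_add e2 p(2) using True_q[of i] False
        by (simp add: renorm_def q_def)
    qed
  qed
  have p1: "p 1 - p 0 = fib (J + 1)" "p 0 + (p 1 - p 0) = p 1" if "\<not> w' 0"
    using p(1)[of 0] that by auto
  \<comment> \<open>If \<open>w'\<close> begins with \<open>False\<close>, that block of length
    \<open>fib (J + 1)\<close> joins the incomplete part.\<close>
  have init: "p (q 0) < fib (Suc J + 2)"
    using p(1)[of 0] p0(1) by (auto simp: q_def)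
  have init2: "word_prod L w 0 (p (q 0)) \<in> fib_tails L (Suc J)" for L :: "bool \<Rightarrow> 'a mat2"
  proof (cases "w' 0")
    case True
    then show ?thesis using p0(2)[of L] by (simp add: q_def)
  next
    case False
    have "word_prod L w 0 (p 1) = word_prod L w 0 (p 0 + (p 1 - p 0))" using p1[OF False] by simp
    also have "\<dots> = fib_mat L J * word_prod L w 0 (p 0)"
      unfolding word_prod_add using p(2)[of L 0] False by simp
    finally show ?thesis using p0(2)[of L] False by (simp add: q_def)
  qed
  show ?case
    by (rule exI[of _ "renorm w'"], rule exI[of _ "\<lambda>i. p (q i)"])
      (use step init init2 coded_renorm[OF w'] in \<open>auto simp del: fib_tails.simps\<close>)
qed

lemma mdet_fib_mat: "mdet (L True) = 1 \<Longrightarrow> mdet (L False) = 1 \<Longrightarrow> mdet (fib_mat L j) = 1"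
  by (induction L j rule: fib_mat.induct) (auto simp: mdet_mult)

section \<open>Polynomial bounds for transfer matrices with bounded traces\<close>

lemma mscale_algebra:
  "mscale a (M + N) = mscale a M + mscale a N"
  "mscale a (M - N) = mscale a M - mscale a N"
  "mscale (a + b) M = mscale a M + mscale b M"
  "mscale (a - b) M = mscale a M - mscale b M"
  "mscale (- a) M = - mscale a M"
  "mscale a (- M) = - mscale a M"
  "mscale a (mscale b M) = mscale (a * b) M"
  "mscale a M * N = mscale a (M * N)"
  "M * mscale a N = mscale a (M * N)"
  by (auto intro!: mat2_eqI simp: mat2_defs mscale_def algebra_simps)

text \<open>Coordinates of a matrix with respect to \<open>1, A, B, B * A\<close>. They grow by a bounded factor
  when passing to the previous level and when multiplying by \<open>A\<close>, whereas bounding a product of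
  matrices from different levels by the product of their norms would lose too much.\<close>

definition mcomb :: "complex mat2 \<Rightarrow> complex mat2 \<Rightarrow> real \<Rightarrow> complex mat2 set" where
  "mcomb A B c = {mscale a 1 + mscale b A + mscale d B + mscale e (B * A) |a b d e.
      cmod a \<le> c \<and> cmod b \<le> c \<and> cmod d \<le> c \<and> cmod e \<le> c}"

lemma mcomb_basis:
  "A \<in> mcomb A B 1" "B \<in> mcomb A B 1"
proof -
  have "A = mscale 0 1 + mscale 1 A + mscale 0 B + mscale 0 (B * A)"
    "B = mscale 0 1 + mscale 0 A + mscale 1 B + mscale 0 (B * A)"
    by (auto intro!: mat2_eqI simp: mscale_def mat2_defs)
  then show "A \<in> mcomb A B 1" "B \<in> mcomb A B 1"
    unfolding mcomb_def by (smt (verit) mem_Collect_eq norm_one norm_zero)+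
qed

lemma mcomb_mono:
  assumes "c \<le> c'" "X \<in> mcomb A B c"
  shows "X \<in> mcomb A B c'"
proof -
  obtain a b d e where "X = mscale a 1 + mscale b A + mscale d B + mscale e (B * A)"
    and "cmod a \<le> c" "cmod b \<le> c" "cmod d \<le> c" "cmod e \<le> c"
    using assms(2) unfolding mcomb_def by blast
  moreover from this have "cmod a \<le> c'" "cmod b \<le> c'" "cmod d \<le> c'" "cmod e \<le> c'"
    using assms(1) by auto
  ultimately show ?thesis unfolding mcomb_def by blast
qed

text \<open>Cayley-Hamilton reduces \<open>A * A\<close>, so right multiplication by
  \<open>A\<close> maps the span of the four basis matrices into itself.\<close>

lemma mcomb_mult:
  assumes X: "X \<in> mcomb A B c" and A: "mdet A = 1" "cmod (mtr A) \<le> K"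
  shows "X * A \<in> mcomb A B ((1 + K) * c)"
proof -
  obtain a b d e where X: "X = mscale a 1 + mscale b A + mscale d B + mscale e (B * A)"
    and c: "cmod a \<le> c" "cmod b \<le> c" "cmod d \<le> c" "cmod e \<le> c"
    using X unfolding mcomb_def by blast
  have AA: "A * A = mscale (mtr A) A - mscale 1 1" using mat2_square[of A] A by simp
  have "X * A = mscale (- b) 1 + mscale (a + mtr A * b) A + mscale (- e) B + mscale (d + mtr A * e) (B * A)"
    unfolding X by (simp add: mscale_algebra algebra_simps mult.assoc AA)
  moreover have "cmod (p + mtr A * q) \<le> (1 + K) * c" if "cmod p \<le> c" "cmod q \<le> c" for p q
  proof -
    have "cmod (p + mtr A * q) \<le> cmod p + cmod (mtr A) * cmod q"
      by (metis norm_mult norm_triangle_ineq)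
    also have "\<dots> \<le> c + K * c"
      using that A(2) by (intro add_mono mult_mono) (auto intro: order_trans[OF norm_ge_zero])
    finally show ?thesis by (simp add: algebra_simps)
  qed
  moreover have "0 \<le> K * c"
    using A(2) c(1) by (meson mult_nonneg_nonneg norm_ge_zero order_trans)
  then have "cmod (- b) \<le> (1 + K) * c" "cmod (- e) \<le> (1 + K) * c"
    using c by (auto simp: algebra_simps)
  ultimately show ?thesis unfolding mcomb_def using c by blast
qed

text \<open>With \<open>A\<close>, \<open>B\<close> of levels J and J + 1, \<open>A * B\<close> has
  level J + 2. Rewriting the basis of the upper pair in that of the lower one produces
  \<open>B * B\<close>, reduced by Cayley-Hamilton, and \<open>A * B\<close>, reordered by the
  polarised identity.\<close>

lemma mcomb_descend:
  assumes X: "X \<in> mcomb B (A * B) c" and det: "mdet B = 1"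
    and K: "cmod (mtr A) \<le> K" "cmod (mtr B) \<le> K" "cmod (mtr (A * B)) \<le> K" "K \<ge> 1"
  shows "X \<in> mcomb A B ((1 + K) ^ 4 * c)"
proof -
  obtain a b d e where X: "X = mscale a 1 + mscale b B + mscale d (A * B) + mscale e ((A * B) * B)"
    and c: "cmod a \<le> c" "cmod b \<le> c" "cmod d \<le> c" "cmod e \<le> c"
    using X unfolding mcomb_def by blast
  define s where "s = mtr (A * B) - mtr A * mtr B"
  define f where "f = d + e * mtr B"
  have c0: "c \<ge> 0" using c(1) norm_ge_zero order_trans by blast
  have BB: "B * B = mscale (mtr B) B - mscale 1 1" using mat2_square[of B] det by simp
  have AB: "A * B = mscale (mtr A) B + mscale (mtr B) A + mscale s 1 - B * A"
    using mat2_mult_commute[of A B] by (simp add: s_def)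
  have "X = mscale a 1 + mscale b B + mscale f (A * B) - mscale e A"
    unfolding X f_def by (simp add: mscale_algebra algebra_simps mult.assoc BB)
  also have "\<dots> = mscale (a + f * s) 1 + mscale (f * mtr B - e) A + mscale (b + f * mtr A) B + mscale (- f) (B * A)"
    unfolding AB by (simp add: mscale_algebra algebra_simps)
  finally have XX: "X = \<dots>" .
  have nf: "cmod f \<le> (1 + K) * c"
  proof -
    have "cmod f \<le> cmod d + cmod e * cmod (mtr B)"
      unfolding f_def by (metis norm_mult norm_triangle_ineq)
    also have "\<dots> \<le> c + c * K"
      using c K c0 by (intro add_mono mult_mono) auto
    finally show ?thesis by (simp add: algebra_simps)
  qed
  have ns: "cmod s \<le> (1 + K)\<^sup>2"
  proof -
    have "cmod s \<le> cmod (mtr (A * B)) + cmod (mtr A) * cmod (mtr B)"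
      unfolding s_def by (metis norm_mult norm_triangle_ineq4)
    also have "\<dots> \<le> K + K * K"
      using K by (intro add_mono mult_mono) auto
    also have "\<dots> \<le> (1 + K)\<^sup>2" using K by (simp add: power2_eq_square algebra_simps)
    finally show ?thesis .
  qed
  have gen: "cmod p + cmod f * cmod r \<le> (1 + K) ^ 4 * c" if "cmod p \<le> c" "cmod r \<le> (1 + K)\<^sup>2" for p r
  proof -
    have "cmod p + cmod f * cmod r \<le> c + ((1 + K) * c) * (1 + K)\<^sup>2"
      using that nf K c0 by (intro add_mono mult_mono) auto
    also have "\<dots> = c * (1 + (1 + K) ^ 3)" by (simp add: power2_eq_square power3_eq_cube algebra_simps)
    also have "\<dots> \<le> c * (1 + K) ^ 4"
    proof (intro mult_left_mono c0)
      have "(1::real) \<le> (1 + K) ^ 3" using K by (intro one_le_power) auto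
      then have "1 + (1 + K) ^ 3 \<le> 2 * (1 + K) ^ 3" by simp
      also have "\<dots> \<le> (1 + K) * (1 + K) ^ 3" using K by (intro mult_right_mono) auto
      finally show "1 + (1 + K) ^ 3 \<le> (1 + K) ^ 4" by (simp add: power_Suc[symmetric] del: power_Suc)
    qed
    finally show ?thesis by (simp add: mult.commute)
  qed
  have K2: "K \<le> (1 + K)\<^sup>2" using K by (simp add: power2_eq_square algebra_simps)
  have 1: "cmod (a + f * s) \<le> (1 + K) ^ 4 * c"
    using gen[OF c(1) ns] by (smt (verit) norm_mult norm_triangle_ineq)
  have 2: "cmod (f * mtr B - e) \<le> (1 + K) ^ 4 * c"
    using gen[OF c(4), of "mtr B"] K K2 by (smt (verit) norm_mult norm_triangle_ineq4)
  have 3: "cmod (b + f * mtr A) \<le> (1 + K) ^ 4 * c"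
    using gen[OF c(2), of "mtr A"] K K2 by (smt (verit) norm_mult norm_triangle_ineq)
  have "(1::real) \<le> (1 + K)\<^sup>2" using K by (intro one_le_power) auto
  then have 4: "cmod (- f) \<le> (1 + K) ^ 4 * c"
    using gen[of 0 1] c0 by simp
  show ?thesis unfolding mcomb_def using XX 1 2 3 4 by blast
qed

text \<open>Each level costs four powers of \<open>1 + K\<close> for the descent and one for a
  possible factor from the tail. The result is exponential in the level, hence polynomial in the
  length of the word.\<close>

lemma fib_tails_mcomb:
  fixes L :: "bool \<Rightarrow> complex mat2"
  assumes det: "mdet (L True) = 1" "mdet (L False) = 1" and K: "K \<ge> 1"
    and tr: "\<And>i. i \<le> Suc J \<Longrightarrow> cmod (mtr (fib_mat L i)) \<le> K"
    and R: "R \<in> fib_tails L J" and X: "X \<in> mcomb (fib_mat L J) (fib_mat L (Suc J)) c"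
  shows "X * R \<in> mcomb (L False) (L True) ((1 + K) ^ (5 * J) * c)"
  using tr R X
proof (induction J arbitrary: R X c)
  case 0
  then show ?case by simp
next
  case (Suc J)
  note D = mdet_fib_mat[of L, OF det]
  have 1: "X \<in> mcomb (fib_mat L J) (fib_mat L (Suc J)) ((1 + K) ^ 4 * c)"
    using Suc.prems(3) Suc.prems(1)[of J] Suc.prems(1)[of "Suc J"] Suc.prems(1)[of "Suc (Suc J)"] K D
    by (intro mcomb_descend) auto
  from mcomb_mult[OF this D, of K] Suc.prems(1)[of J]
  have 2: "X * fib_mat L J \<in> mcomb (fib_mat L J) (fib_mat L (Suc J)) ((1 + K) * ((1 + K) ^ 4 * c))"
    by simp
  have c0: "c \<ge> 0" using Suc.prems(3) unfolding mcomb_def by (auto intro: order_trans[OF norm_ge_zero])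
  have "(1 + K) ^ 4 * c \<le> (1 + K) ^ 5 * c" using K c0 by (intro mult_right_mono power_increasing) auto
  then have 1: "X \<in> mcomb (fib_mat L J) (fib_mat L (Suc J)) ((1 + K) ^ 5 * c)"
    using 1 mcomb_mono by blast
  have 2: "X * fib_mat L J \<in> mcomb (fib_mat L J) (fib_mat L (Suc J)) ((1 + K) ^ 5 * c)"
    using 2 by (simp add: numeral_eq_Suc mult.assoc)
  have e: "(1 + K) ^ (5 * Suc J) * c = (1 + K) ^ (5 * J) * ((1 + K) ^ 5 * c)"
    by (simp add: power_add)
  have IH: "\<And>R X c. R \<in> fib_tails L J \<Longrightarrow> X \<in> mcomb (fib_mat L J) (fib_mat L (Suc J)) c \<Longrightarrow>
      X * R \<in> mcomb (L False) (L True) ((1 + K) ^ (5 * J) * c)"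
    using Suc.IH Suc.prems(1) by simp
  from Suc.prems(2) consider "R \<in> fib_tails L J" | R' where "R' \<in> fib_tails L J" "R = fib_mat L J * R'"
    by auto
  then show ?case
  proof cases
    case 1
    then show ?thesis unfolding e using IH \<open>X \<in> mcomb _ _ ((1 + K) ^ 5 * c)\<close> by blast
  next
    case 2
    have "X * R = X * fib_mat L J * R'" using 2 by (simp add: mult.assoc)
    then show ?thesis unfolding e using IH[OF 2(1) \<open>X * fib_mat L J \<in> mcomb _ _ ((1 + K) ^ 5 * c)\<close>] by simp
  qed
qed

lemma mnorm_mcomb:
  assumes "X \<in> mcomb A B c"
  shows "mnorm X \<le> c * (2 + mnorm A + mnorm B + mnorm B * mnorm A)"
proof -
  obtain a b d e where X: "X = mscale a 1 + mscale b A + mscale d B + mscale e (B * A)"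
    and c: "cmod a \<le> c" "cmod b \<le> c" "cmod d \<le> c" "cmod e \<le> c"
    using assms unfolding mcomb_def by blast
  have c0: "c \<ge> 0" using c(1) norm_ge_zero order_trans by blast
  have "mnorm X \<le> mnorm (mscale a 1) + mnorm (mscale b A) + mnorm (mscale d B) + mnorm (mscale e (B * A))"
    unfolding X by (intro order.trans[OF mnorm_add] add_mono) auto
  also have "\<dots> \<le> c * 2 + c * mnorm A + c * mnorm B + c * (mnorm B * mnorm A)"
    unfolding mnorm_mscale mnorm_one using c c0
    by (intro add_mono mult_mono mnorm_nonneg mnorm_mult) auto
  finally show ?thesis by (simp add: algebra_simps)
qed

text \<open>The position \<open>n\<close> is the end of the first complete block, where the product
  is one Fibonacci matrix times a tail.\<close>

lemma word_prod_bound: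
  fixes L :: "bool \<Rightarrow> complex mat2"
  assumes det: "mdet (L True) = 1" "mdet (L False) = 1" and K: "K \<ge> 1"
    and tr: "\<And>i. i \<le> Suc J \<Longrightarrow> cmod (mtr (fib_mat L i)) \<le> K" and w: "coded w"
  shows "\<exists>n\<ge>fib (J + 1). mnorm (word_prod L w 0 n) \<le>
     (1 + K) ^ (5 * J) * (2 + mnorm (L False) + mnorm (L True) + mnorm (L True) * mnorm (L False))"
proof -
  obtain w' p where p: "\<And>i. p (Suc i) = p i + (if w' i then fib (J + 2) else fib (J + 1))"
      "\<And>i. word_prod L w (p i) (p (Suc i) - p i) = fib_mat L (if w' i then Suc J else J)"
    and p0: "word_prod L w 0 (p 0) \<in> fib_tails L J"
    using block_decomposition[OF w, of J] by metis
  let ?X = "fib_mat L (if w' 0 then Suc J else J)"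
  have X: "?X \<in> mcomb (fib_mat L J) (fib_mat L (Suc J)) 1" using mcomb_basis by auto
  have 1: "p 0 + (p 1 - p 0) = p 1" using p(1)[of 0] by simp
  have "fib (J + 1) \<le> p 1" using p(1)[of 0] by (auto intro: fib_mono order_trans[of _ "fib (J + 2)"])
  moreover have "word_prod L w 0 (p 1) = ?X * word_prod L w 0 (p 0)"
    using word_prod_add[of L w 0 "p 0" "p 1 - p 0"] p(2)[of 0] unfolding 1 by simp
  moreover have "mnorm (?X * word_prod L w 0 (p 0)) \<le> (1 + K) ^ (5 * J) * (2 + mnorm (L False) + mnorm (L True) + mnorm (L True) * mnorm (L False))"
    using mnorm_mcomb[OF fib_tails_mcomb[OF det K tr p0 X]] by simp
  ultimately show ?thesis by metis
qed

section \<open>Site matrices\<close>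

definition site_mat :: "'a::comm_ring_1 \<Rightarrow> 'a \<Rightarrow> bool \<Rightarrow> 'a mat2" where
  "site_mat v z b = Mat2 (z - (if b then v else 0)) (-1) 1 0"

lemma mdet_site_mat: "mdet (site_mat v z b) = 1"
  by (simp add: mdet_def site_mat_def)

lemma mtr_fib_mat: "mtr (fib_mat (site_mat v z) j) = ftrace v z (Suc j)"
proof (induction j rule: less_induct)
  case (less j)
  consider "j = 0" | "j = 1" | "j = 2" | i where "j = Suc (Suc (Suc i))"
    by (metis One_nat_def Suc_1 not0_implies_Suc)
  then show ?case
  proof cases
    case 4
    have "mtr (fib_mat (site_mat v z) j) = mtr (fib_mat (site_mat v z) (Suc (Suc i))) * mtr (fib_mat (site_mat v z) (Suc i))
       - mtr (fib_mat (site_mat v z) i)"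
      using 4 mtr_sandwich[OF mdet_fib_mat, of "site_mat v z" "Suc i" "fib_mat (site_mat v z) i"]
      by (simp add: mdet_site_mat)
    also have "\<dots> = ftrace v z (Suc j)"
      using less[of "Suc (Suc i)"] less[of "Suc i"] less[of i] 4 by (simp del: fib_mat.simps)
    finally show ?thesis .
  qed (auto simp: mtr_def site_mat_def mat2_defs numeral_2_eq_2 algebra_simps)
qed

text \<open>Up to a constant factor, the Wronskian of a solution with its complex conjugate. Across
  one site it grows by \<open>Im z\<close> times the squared modulus of the first component.\<close>

definition current :: "complex \<times> complex \<Rightarrow> real" where
  "current x = Im (cnj (snd x) * fst x)"

text \<open>Every site contributes with the sign of \<open>Im z\<close>, and only the first
  contribution is kept. The factor \<open>Im z\<close> treats both half-planes together.\<close>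

lemma current_fib_mat:
  fixes lam :: real
  shows "Im z * (current (mapply (fib_mat (site_mat (of_real lam) z) j) x) - current x) \<ge> (Im z)\<^sup>2 * (cmod (fst x))\<^sup>2"
proof (induction j arbitrary: x rule: less_induct)
  case (less j)
  have site: "Im z * (current (mapply (site_mat (of_real lam) z b) x) - current x) = (Im z)\<^sup>2 * (cmod (fst x))\<^sup>2" for b x
    unfolding current_def mapply_def site_mat_def cmod_power2
    by (simp add: power2_eq_square algebra_simps)
  consider "j = 0" | "j = 1" | i where "j = Suc (Suc i)"
    by (metis One_nat_def not0_implies_Suc)
  then show ?case
  proof cases
    case 3
    let ?y = "mapply (fib_mat (site_mat (of_real lam) z) (Suc i)) x"
    have "Im z * (current (mapply (fib_mat (site_mat (of_real lam) z) j) x) - current x)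
      = Im z * (current (mapply (fib_mat (site_mat (of_real lam) z) i) ?y) - current ?y) + Im z * (current ?y - current x)"
      using 3 by (simp add: mapply_mult algebra_simps)
    moreover have "Im z * (current (mapply (fib_mat (site_mat (of_real lam) z) i) ?y) - current ?y) \<ge> (Im z)\<^sup>2 * (cmod (fst ?y))\<^sup>2"
      using less 3 by simp
    moreover have "(Im z)\<^sup>2 * (cmod (fst ?y))\<^sup>2 \<ge> 0" by simp
    moreover have "Im z * (current ?y - current x) \<ge> (Im z)\<^sup>2 * (cmod (fst x))\<^sup>2" using less 3 by simp
    ultimately show ?thesis by linarith
  qed (auto simp: site)
qed

text \<open>If the trace vanishes, the square of the matrix is \<open>-1\<close> and preserves the current.\<close>

lemma ftrace_roots_real:
  fixes lam :: real
  assumes "ftrace (of_real lam) z (Suc j) = 0"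
  shows "Im z = 0"
proof (rule ccontr)
  assume "Im z \<noteq> 0"
  let ?M = "fib_mat (site_mat (of_real lam) z) j"
  have "mtr ?M = 0" using assms by (simp add: mtr_fib_mat)
  then have MM: "?M * ?M = - 1"
    using mat2_square[of ?M] mdet_fib_mat[of "site_mat (of_real lam) z" j]
    by (simp add: mdet_site_mat mscale_def mat2_defs)
  \<comment> \<open>Zero current, but a nonzero first component: the first passage already gains
    \<open>(Im z)\<^sup>2\<close>, which the second cannot undo.\<close>
  let ?x = "(1, 0) :: complex \<times> complex"
  have "mapply ?M (mapply ?M ?x) = mapply (- 1) ?x" by (simp add: mapply_mult[symmetric] MM)
  then have e: "current (mapply ?M (mapply ?M ?x)) = current ?x"
    by (simp add: mapply_def current_def mat2_defs)
  have "Im z * (current (mapply ?M (mapply ?M ?x)) - current (mapply ?M ?x)) \<ge> 0"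
    using current_fib_mat[where z = z and lam = lam and j = j and x = "mapply ?M ?x"] by (smt (verit) zero_le_mult_iff zero_le_power2)
  moreover have "Im z * (current (mapply ?M ?x) - current ?x) \<ge> (Im z)\<^sup>2"
    using current_fib_mat[where z = z and lam = lam and j = j and x = ?x] by simp
  moreover have "(Im z)\<^sup>2 > 0" using \<open>Im z \<noteq> 0\<close> by simp
  ultimately show False unfolding e by (smt (verit) mult_minus_right)
qed

text \<open>A trace of modulus at most 3 would have a derivative of modulus at least
  \<open>(lam / 2) ^ (k div 2 - 1)\<close> and, by its real roots, at most
  \<open>3 * fib k / Im z\<close>. The real part of \<open>z\<close> is arbitrary.\<close>

lemma ftrace_large:
  fixes lam :: real
  assumes lam: "lam \<ge> 80" and k: "2 \<le> k" and z: "Im z > 0"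
    and large: "(lam / 2) ^ (k div 2 - 1) * Im z > 3 * fib k"
  shows "cmod (ftrace (of_real lam) z k) > 3"
proof (rule ccontr)
  assume "\<not> ?thesis"
  then have s: "cmod (ftrace (of_real lam) z k) \<le> 3" by simp
  have "(lam / 2) ^ (k div 2 - 1) \<le> cmod (dtrace (of_real lam) z k)"
    using dtrace_lower_bound[OF lam k s] by blast
  also have "\<dots> \<le> degree (trace_poly (of_real lam) k) / Im z * cmod (ftrace (of_real lam) z k)"
    unfolding dtrace_def poly_trace_poly[symmetric]
  proof (rule pderiv_bound_real_roots[OF _ z])
    fix r assume "poly (trace_poly (of_real lam) k) r = 0"
    then show "Im r = 0" using ftrace_roots_real[of lam r "k - 1"] k by (simp add: poly_trace_poly)
  qed
  also have "\<dots> \<le> fib k / Im z * 3"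
    using s z degree_trace_poly[of "of_real lam" k] by (intro mult_mono divide_right_mono) auto
  finally show False using large z by (simp add: field_simps)
qed

section \<open>Energies with bounded traces\<close>

text \<open>\<open>b'\<close> is the first point where \<open>f\<close> reaches 2, and
  \<open>a'\<close> the last point before \<open>b'\<close> where \<open>f\<close> is at most -2; in
  between neither value is passed.\<close>

lemma crossing_interval_aux:
  fixes f :: "real \<Rightarrow> real"
  assumes ab: "a \<le> b" and f: "continuous_on {a..b} f" and "f a \<le> -2" "2 \<le> f b"
  shows "\<exists>a' b'. a \<le> a' \<and> a' \<le> b' \<and> b' \<le> b \<and> f a' = -2 \<and> f b' = 2 \<and> (\<forall>x\<in>{a'..b'}. \<bar>f x\<bar> \<le> 2)"
proof -
  have "compact ({a..b} \<inter> f -` {2..})"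
    using continuous_closed_preimage[OF f, of "{2..}"] by (simp add: compact_eq_bounded_closed bounded_Int)
  moreover have "b \<in> {a..b} \<inter> f -` {2..}" using assms by auto
  ultimately have "\<exists>s\<in>{a..b} \<inter> f -` {2..}. \<forall>x\<in>{a..b} \<inter> f -` {2..}. s \<le> x"
    by (intro compact_attains_inf) auto
  then obtain b' where b': "b' \<in> {a..b}" "f b' \<ge> 2" "\<And>x. x \<in> {a..b} \<Longrightarrow> f x \<ge> 2 \<Longrightarrow> b' \<le> x"
    by auto
  have f': "continuous_on {a..b'} f" using f b'(1) by (auto intro: continuous_on_subset)
  have "\<exists>y\<ge>a. y \<le> b' \<and> f y = 2"
    using b'(1,2) assms(3) f' by (intro IVT') auto
  then have fb': "f b' = 2" using b' by (metis atLeastAtMost_iff dual_order.trans order_antisym order_refl)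
  have "compact ({a..b'} \<inter> f -` {..-2})"
    using continuous_closed_preimage[OF f', of "{..-2}"] by (simp add: compact_eq_bounded_closed bounded_Int)
  moreover have "a \<in> {a..b'} \<inter> f -` {..-2}" using assms b' by auto
  ultimately have "\<exists>s\<in>{a..b'} \<inter> f -` {..-2}. \<forall>x\<in>{a..b'} \<inter> f -` {..-2}. x \<le> s"
    by (intro compact_attains_sup) auto
  then obtain a' where a': "a' \<in> {a..b'}" "f a' \<le> -2" "\<And>x. x \<in> {a..b'} \<Longrightarrow> f x \<le> -2 \<Longrightarrow> x \<le> a'"
    by auto
  have "\<exists>y\<ge>a'. y \<le> b' \<and> f y = -2"
    using a' fb' by (intro IVT') (auto intro: continuous_on_subset[OF f'])
  then have fa': "f a' = -2" using a' by (metis atLeastAtMost_iff dual_order.trans order_antisym order_refl)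
  have "\<bar>f x\<bar> \<le> 2" if "x \<in> {a'..b'}" for x
  proof -
    have "f x \<le> 2"
    proof (rule ccontr)
      assume "\<not> ?thesis"
      then have "b' \<le> x" using b'(1) b'(3)[of x] that a'(1) by auto
      then show False using that fb' \<open>\<not> _\<close> by simp
    qed
    moreover have "f x \<ge> -2"
    proof (rule ccontr)
      assume "\<not> ?thesis"
      then have "x \<le> a'" using a'(3)[of x] that a'(1) by auto
      then show False using that fa' \<open>\<not> _\<close> by simp
    qed
    ultimately show ?thesis by simp
  qed
  then show ?thesis using a'(1) b'(1) fa' fb' by (intro exI[of _ a'] exI[of _ b']) auto
qed

lemma crossing_interval:
  fixes f :: "real \<Rightarrow> real"
  assumes ab: "a \<le> b" and f: "continuous_on {a..b} f"
    and "(f a \<le> -2 \<and> 2 \<le> f b) \<or> (2 \<le> f a \<and> f b \<le> -2)"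
  shows "\<exists>a' b'. a \<le> a' \<and> a' \<le> b' \<and> b' \<le> b \<and> {f a', f b'} = {-2, 2} \<and> (\<forall>x\<in>{a'..b'}. \<bar>f x\<bar> \<le> 2)"
  using assms(3)
proof
  assume "f a \<le> -2 \<and> 2 \<le> f b"
  then show ?thesis using crossing_interval_aux[OF ab f] by (metis insert_commute)
next
  assume *: "2 \<le> f a \<and> f b \<le> -2"
  have "continuous_on {a..b} (\<lambda>x. - f x)" using f by (intro continuous_intros)
  from crossing_interval_aux[OF ab this] * obtain a' b' where
    "a \<le> a'" "a' \<le> b'" "b' \<le> b" "- f a' = -2" "- f b' = 2" "\<forall>x\<in>{a'..b'}. \<bar>- f x\<bar> \<le> 2" by auto
  then show ?thesis by (intro exI[of _ a'] exI[of _ b']) auto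
qed

lemma continuous_on_ftrace: "continuous_on S (\<lambda>z. ftrace v z n)"
  for v :: "'a::real_normed_field"
proof (induction n rule: less_induct)
  case (less n)
  consider "n = 0" | "n = 1" | "n = 2" | i where "n = Suc (Suc (Suc i))"
    by (metis One_nat_def Suc_1 not0_implies_Suc)
  then show ?case
    by cases (auto simp: numeral_2_eq_2 intro!: continuous_intros less)
qed

text \<open>On an interval where levels 2j and 2j + 2 are small (\<open>h\<close> and
  \<open>f\<close>), the level between them (\<open>g\<close>) is big and of constant sign. Level 2j
  + 4 is \<open>(f * g - h) * f - g\<close>, which equals \<open>- g\<close> where
  \<open>f = 0\<close> and \<open>3 * g - 2 * h\<close> where \<open>f = 2\<close>. These values are
  large and of opposite sign, so a subinterval is mapped onto the range from -2 to 2.\<close>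

lemma band_interval:
  fixes lam :: real
  assumes lam: "lam \<ge> 80"
  shows "\<exists>a b. a \<le> b \<and> {ftrace lam a (2 * Suc j), ftrace lam b (2 * Suc j)} = {-2, 2} \<and>
    (\<forall>E\<in>{a..b}. \<forall>i\<le>Suc j. \<bar>ftrace lam E (2 * i)\<bar> \<le> 2)"
proof (induction j)
  case 0
  have "\<bar>ftrace lam E (2 * i)\<bar> \<le> 2" if "E \<in> {lam - 2..lam + 2}" "i \<le> Suc 0" for E i
    using that by (cases i) (auto simp: numeral_2_eq_2)
  then show ?case by (intro exI[of _ "lam - 2"] exI[of _ "lam + 2"]) (auto simp: numeral_2_eq_2)
next
  case (Suc j)
  then obtain a b where ab: "a \<le> b" "{ftrace lam a (2 * Suc j), ftrace lam b (2 * Suc j)} = {-2, 2}"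
    and sm: "\<And>E i. E \<in> {a..b} \<Longrightarrow> i \<le> Suc j \<Longrightarrow> \<bar>ftrace lam E (2 * i)\<bar> \<le> 2" by metis
  define m where "m = 2 * j"
  have idx: "2 * Suc j = Suc (Suc m)" "2 * Suc (Suc j) = Suc (Suc (Suc (Suc m)))" by (auto simp: m_def)
  define f where "f E = ftrace lam E (Suc (Suc m))" for E
  define g where "g E = ftrace lam E (Suc m)" for E
  define h where "h E = ftrace lam E m" for E
  define F where "F E = ftrace lam E (2 * Suc (Suc j))" for E
  have F: "F E = (f E * g E - h E) * f E - g E" for E unfolding F_def f_def g_def h_def idx by simp
  have fs: "\<bar>f E\<bar> \<le> 2" "\<bar>h E\<bar> \<le> 2" if "E \<in> {a..b}" for E
    using sm[of E "Suc j"] sm[of E j] that by (auto simp: f_def h_def m_def)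
  have gb: "\<bar>g E\<bar> \<ge> 68" if E: "E \<in> {a..b}" for E
  proof -
    have "\<bar>g E\<bar> > 3" using ftrace_no_three_small[of lam E m] fs[OF E] lam unfolding f_def g_def h_def
      by (force simp: not_le[symmetric])
    then show ?thesis using ftrace_big_between_small(2)[of lam E m] fs[OF E] lam unfolding f_def g_def h_def by simp
  qed
  have cont: "continuous_on S f" "continuous_on S g" "continuous_on S F" for S
    unfolding f_def g_def F_def by (rule continuous_on_ftrace)+
  have same: "g c > 0 \<longleftrightarrow> g e > 0" if "c \<in> {a..b}" "e \<in> {a..b}" "c \<le> e" for c e
  proof (rule ccontr)
    assume ne: "\<not> ?thesis"
    have ge: "\<bar>g c\<bar> \<ge> 68" "\<bar>g e\<bar> \<ge> 68" using gb that by auto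
    have "\<exists>y\<ge>c. y \<le> e \<and> g y = 0"
    proof (cases "g c > 0")
      case True
      then show ?thesis using ne ge that cont by (intro IVT2') auto
    next
      case False
      then show ?thesis using ne ge that cont by (intro IVT') auto
    qed
    then obtain y where y: "c \<le> y" "y \<le> e" "g y = 0" by blast
    then show False using gb[of y] that by auto
  qed
  have "\<exists>c\<ge>a. c \<le> b \<and> f c = 0"
  proof (cases "f a = -2")
    case True
    then have "f b = 2" using ab(2) by (auto simp: f_def idx[symmetric] doubleton_eq_iff)
    then show ?thesis using True ab cont by (intro IVT') auto
  next
    case False
    then have "f a = 2" "f b = -2" using ab(2) by (auto simp: f_def idx[symmetric] doubleton_eq_iff)
    then show ?thesis using ab cont by (intro IVT2') auto
  qed
  then obtain c where c: "c \<in> {a..b}" "f c = 0" by auto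
  obtain e where e: "e \<in> {a..b}" "f e = 2"
    using ab by (auto simp: f_def idx[symmetric] doubleton_eq_iff)
  have Fc: "F c = - g c" using F[of c] c by simp
  have Fe: "F e = 3 * g e - 2 * h e" using F[of e] e by simp
  have g_same: "g c > 0 \<longleftrightarrow> g e > 0"
  proof (cases "c \<le> e")
    case True
    then show ?thesis by (rule same[OF c(1) e(1)])
  next
    case False
    then show ?thesis using same[OF e(1) c(1)] by (metis linear)
  qed
  have alt: "(F c \<le> -2 \<and> 2 \<le> F e) \<or> (2 \<le> F c \<and> F e \<le> -2)"
  proof (cases "g c > 0")
    case True
    then show ?thesis using gb[OF c(1)] gb[OF e(1)] fs(2)[OF e(1)] g_same Fc Fe by auto
  next
    case False
    then show ?thesis using gb[OF c(1)] gb[OF e(1)] fs(2)[OF e(1)] g_same Fc Fe by auto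
  qed
  have "\<exists>a' b'. min c e \<le> a' \<and> a' \<le> b' \<and> b' \<le> max c e \<and> {F a', F b'} = {-2, 2} \<and> (\<forall>x\<in>{a'..b'}. \<bar>F x\<bar> \<le> 2)"
    by (rule crossing_interval[OF _ cont(3)]) (use alt in \<open>auto simp: min_def max_def\<close>)
  then obtain a' b' where a'b': "min c e \<le> a'" "a' \<le> b'" "b' \<le> max c e" "{F a', F b'} = {-2, 2}"
    "\<And>x. x \<in> {a'..b'} \<Longrightarrow> \<bar>F x\<bar> \<le> 2" by blast
  have sub: "{a'..b'} \<subseteq> {a..b}" using a'b' c e by auto
  have "\<bar>ftrace lam E (2 * i)\<bar> \<le> 2" if "E \<in> {a'..b'}" "i \<le> Suc (Suc j)" for E i
    using sm[of E i] a'b'(5)[of E] that sub by (cases "i = Suc (Suc j)") (auto simp: F_def)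
  then show ?case using a'b' unfolding F_def by blast
qed

text \<open>The deviation from the traces at \<open>E\<close> grows by at most the factor
  \<open>17 * (lam + 13)\<close> per two levels. While it is at most 1, the bound
  \<open>lam + 12\<close> for big traces at \<open>E\<close> becomes
  \<open>lam + 13\<close>.\<close>

lemma ftrace_perturbation:
  fixes lam E :: real and z :: complex
  assumes lam: "lam \<ge> 80" and E: "\<And>i. i \<le> j \<Longrightarrow> \<bar>ftrace lam E (2 * i)\<bar> \<le> 2"
    and z: "cmod (z - of_real E) * (17 * (lam + 13)) ^ Suc j \<le> 1" and n: "n \<le> 2 * j"
  shows "cmod (ftrace (of_real lam) z n) \<le> lam + 13"
proof -
  define B where "B = lam + 13"
  define Q where "Q = 17 * B"
  define t where "t = ftrace (complex_of_real lam) z"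
  define s where "s = ftrace (complex_of_real lam) (of_real E)"
  define D where "D n = cmod (t n - s n)" for n
  define d where "d = cmod (z - of_real E)"
  have B: "B \<ge> 93" and Q: "Q \<ge> 17" using lam by (auto simp: B_def Q_def)
  have d0: "d \<ge> 0" by (simp add: d_def)
  have dQ: "d * Q ^ Suc j \<le> 1" using z by (simp add: d_def Q_def B_def)
  have s_real: "cmod (s n) = \<bar>ftrace lam E n\<bar>" for n
    unfolding s_def ftrace_of_real by simp
  have s_even: "cmod (s (2 * i)) \<le> 2" if "i \<le> j" for i using E that by (simp add: s_real)
  have s_odd: "cmod (s (Suc (2 * i))) \<le> lam + 12" if "Suc i \<le> j" for i
    using ftrace_big_between_small(1)[of "lam" E "2 * i"] E[of i] E[of "Suc i"] that lam by (simp add: s_real)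
  \<comment> \<open>The hypothesis has one power of \<open>Q\<close> to spare, which pays for the
    additional factor \<open>B\<close> at odd levels.\<close>
  have small: "d * Q ^ i * B \<le> 1" "d * Q ^ i \<le> 1" if "i \<le> j" for i
  proof -
    have "d * Q ^ i * B \<le> d * Q ^ j * Q"
      using that Q B d0 by (intro mult_mono mult_left_mono power_increasing) (auto simp: Q_def)
    also have "\<dots> \<le> 1" using dQ by (simp add: mult_ac)
    finally show *: "d * Q ^ i * B \<le> 1" .
    have "d * Q ^ i * 1 \<le> d * Q ^ i * B" using B Q d0 by (intro mult_left_mono) auto
    then show "d * Q ^ i \<le> 1" using * by simp
  qed
  have Drec: "D (Suc (Suc (Suc n))) \<le> cmod (s (Suc (Suc n))) * D (Suc n) + cmod (s (Suc n)) * D (Suc (Suc n))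
     + D (Suc n) * D (Suc (Suc n)) + D n" for n
  proof -
    have "t (Suc (Suc (Suc n))) - s (Suc (Suc (Suc n))) = s (Suc (Suc n)) * (t (Suc n) - s (Suc n))
        + s (Suc n) * (t (Suc (Suc n)) - s (Suc (Suc n))) + (t (Suc n) - s (Suc n)) * (t (Suc (Suc n)) - s (Suc (Suc n)))
        - (t n - s n)"
      by (simp add: t_def s_def algebra_simps)
    then show ?thesis unfolding D_def norm_mult[symmetric]
      by (smt (verit) norm_triangle_ineq norm_triangle_ineq4)
  qed
  have Dnn: "D n \<ge> 0" for n by (simp add: D_def)
  have main: "D (2 * i) \<le> d * Q ^ Suc i \<and> D (Suc (2 * i)) \<le> B * (d * Q ^ Suc i) \<and> D (Suc (Suc (2 * i))) \<le> d * Q ^ Suc i"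
    if "Suc i \<le> j" for i
    using that
  proof (induction i)
    case 0
    have "d * 1 \<le> d * Q" "0 \<le> d * Q" "d * 1 \<le> d * (B * Q)"
      using Q B d0 mult_mono[of 1 B 1 Q] by (intro mult_left_mono mult_nonneg_nonneg; simp)+
    moreover have "D (Suc 0) = d" "D (Suc (Suc 0)) = d"
      by (auto simp: D_def t_def s_def d_def)
    moreover have "D 0 = 0" by (simp add: D_def t_def s_def)
    ultimately show ?case by (simp add: mult_ac)
  next
    case (Suc i)
    define e where "e = d * Q ^ Suc i"
    have e0: "e \<ge> 0" using d0 Q by (simp add: e_def)
    have IH: "D (2 * i) \<le> e" "D (Suc (2 * i)) \<le> B * e" "D (Suc (Suc (2 * i))) \<le> e"
      using Suc by (auto simp: e_def)
    have e1: "e \<le> 1" using small(2)[of "Suc i"] Suc.prems by (simp add: e_def)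
    have s2: "cmod (s (Suc (Suc (2 * i)))) \<le> 2" using s_even[of "Suc i"] Suc.prems by simp
    have s1: "cmod (s (Suc (2 * i))) \<le> B" using s_odd[of i] Suc.prems by (simp add: B_def)
    have s3: "cmod (s (Suc (Suc (Suc (2 * i))))) \<le> B" using s_odd[of "Suc i"] Suc.prems by (simp add: B_def)
    have eB: "e \<le> B * e" using B e0 mult_right_mono[of 1 B e] by simp
    have "D (Suc (Suc (Suc (2 * i)))) \<le> 2 * (B * e) + B * e + (B * e) * 1 + e"
      by (rule order_trans[OF Drec], intro add_mono mult_mono) (use s1 s2 IH e0 e1 Dnn B in \<open>auto intro: order_trans\<close>)
    then have D3: "D (Suc (Suc (Suc (2 * i)))) \<le> 5 * (B * e)" using eB by simp
    \<comment> \<open>The four terms add up to 1 + 10 + 5 + 1 = 17, the constant in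
      \<open>Q\<close>.\<close>
    have "D (Suc (Suc (Suc (Suc (2 * i))))) \<le> B * e + 2 * (5 * (B * e)) + 1 * (5 * (B * e)) + B * e"
      by (rule order_trans[OF Drec], intro add_mono mult_mono) (use s3 s2 IH e0 e1 Dnn B D3 in \<open>auto intro: order_trans\<close>)
    then have D4: "D (Suc (Suc (Suc (Suc (2 * i))))) \<le> Q * e" by (simp add: Q_def)
    have "e \<le> Q * e" using Q e0 mult_right_mono[of 1 Q e] by simp
    then have D2: "D (Suc (Suc (2 * i))) \<le> Q * e" using IH by simp
    have "5 * (B * e) \<le> Q * (B * e)" using Q B e0 by (intro mult_right_mono) auto
    then have "D (Suc (Suc (Suc (2 * i)))) \<le> B * (Q * e)" using D3 by (simp add: mult_ac)
    moreover have "Q * e = d * Q ^ Suc (Suc i)" by (simp add: e_def)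
    moreover have "2 * Suc i = Suc (Suc (2 * i))" by simp
    ultimately show ?case using D2 D4 by metis
  qed
  have "cmod (t n) \<le> cmod (s n) + D n"
    unfolding D_def using norm_triangle_sub[of "t n" "s n"] by simp
  also have "\<dots> \<le> B"
  proof (cases "even n")
    case True
    then obtain i where i: "n = 2 * i" by blast
    show ?thesis
    proof (cases i)
      case 0
      then show ?thesis using i B by (simp add: D_def t_def s_def)
    next
      case (Suc k)
      then show ?thesis using main[of k] small(2)[of "Suc k"] s_even[of i] i n B by auto
    qed
  next
    case False
    then obtain i where i: "n = Suc (2 * i)" by (metis oddE Suc_eq_plus1)
    then show ?thesis using main[of i] small(1)[of "Suc i"] s_odd[of i] n B_def
      by (auto simp: mult_ac)
  qed
  finally show ?thesis by (simp add: t_def B_def)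
qed

lemma bounded_trace_energy:
  fixes lam :: real
  assumes lam: "lam \<ge> 80"
  shows "\<exists>E::real. \<forall>z. cmod (z - of_real E) * (17 * (lam + 13)) ^ Suc (Suc j) \<le> 1 \<longrightarrow>
     (\<forall>n \<le> 2 * Suc j. cmod (ftrace (of_real lam) z n) \<le> lam + 13)"
proof -
  obtain a b where "a \<le> b" "\<forall>E\<in>{a..b}. \<forall>i\<le>Suc j. \<bar>ftrace lam E (2 * i)\<bar> \<le> 2"
    using band_interval[OF lam] by blast
  then have "\<And>i. i \<le> Suc j \<Longrightarrow> \<bar>ftrace lam a (2 * i)\<bar> \<le> 2" by auto
  then show ?thesis using ftrace_perturbation[OF lam, of "Suc j" a] by blast
qed

section \<open>Solutions on a half-line\<close>

text \<open>The letter \<open>w n\<close> is the potential at site \<open>n + 1\<close>. The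
  recurrence starts beyond site 0, where the resolvent equation has its source, so the transform
  restricted to either half of the line is an instance.\<close>

locale half_line =
  fixes lam :: real and z :: complex and w :: "nat \<Rightarrow> bool" and u :: "nat \<Rightarrow> complex"
  assumes recurrence: "\<And>n. u (Suc (Suc n)) = (z - (if w n then of_real lam else 0)) * u (Suc n) - u n"
begin

abbreviation "L \<equiv> site_mat (complex_of_real lam) z"

lemma transfer: "mapply (word_prod L w a l) (u (Suc a), u a) = (u (Suc (a + l)), u (a + l))"
proof (induction l)
  case (Suc l)
  then show ?case by (simp add: mapply_mult) (simp add: mapply_def site_mat_def recurrence)
qed (simp add: mapply_one)

lemma mdet_word_prod: "mdet (word_prod L w a l) = 1"
  by (induction l) (auto simp: mdet_one mdet_mult mdet_site_mat)

text \<open>The inverse of a matrix of determinant one has the same entries up to sign and position.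
  Thus an upper bound on the transfer matrix bounds the solution at distance \<open>l\<close> from
  below.\<close>

lemma initial_le:
  "cmod (u (Suc a)) + cmod (u a) \<le> 2 * mnorm (word_prod L w a l) * (cmod (u (Suc (a + l))) + cmod (u (a + l)))"
proof -
  let ?M = "word_prod L w a l"
  let ?x = "u (Suc (a + l))" and ?y = "u (a + l)"
  have t: "m11 ?M * u (Suc a) + m12 ?M * u a = ?x" "m21 ?M * u (Suc a) + m22 ?M * u a = ?y"
    using transfer[of a l] by (auto simp: mapply_def)
  have d: "m11 ?M * m22 ?M - m12 ?M * m21 ?M = 1" using mdet_word_prod[of a l] by (simp add: mdet_def)
  have 1: "u (Suc a) = m22 ?M * ?x - m12 ?M * ?y"
  proof -
    have "m22 ?M * ?x - m12 ?M * ?y = (m11 ?M * m22 ?M - m12 ?M * m21 ?M) * u (Suc a)"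
      unfolding t[symmetric] by (simp add: algebra_simps)
    then show ?thesis using d by simp
  qed
  have 2: "u a = m11 ?M * ?y - m21 ?M * ?x"
  proof -
    have "m11 ?M * ?y - m21 ?M * ?x = (m11 ?M * m22 ?M - m12 ?M * m21 ?M) * u a"
      unfolding t[symmetric] by (simp add: algebra_simps)
    then show ?thesis using d by simp
  qed
  have e: "cmod (m11 ?M) \<le> mnorm ?M" "cmod (m12 ?M) \<le> mnorm ?M" "cmod (m21 ?M) \<le> mnorm ?M" "cmod (m22 ?M) \<le> mnorm ?M"
    by (auto simp: mnorm_def)
  have "cmod (u (Suc a)) \<le> mnorm ?M * cmod ?x + mnorm ?M * cmod ?y"
    unfolding 1 by (rule order_trans[OF norm_triangle_ineq4]) (use e in \<open>auto simp: norm_mult intro!: add_mono mult_right_mono\<close>)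
  moreover have "cmod (u a) \<le> mnorm ?M * cmod ?y + mnorm ?M * cmod ?x"
    unfolding 2 by (rule order_trans[OF norm_triangle_ineq4]) (use e in \<open>auto simp: norm_mult intro!: add_mono mult_right_mono\<close>)
  ultimately show ?thesis by (simp add: algebra_simps)
qed

section \<open>Currents and Wronskians along a half-line\<close>

lemma current_step:
  "current (mapply (word_prod L w a (Suc l)) x) =
     current (mapply (word_prod L w a l) x) + Im z * (cmod (fst (mapply (word_prod L w a l) x)))\<^sup>2"
proof -
  obtain p q where pq: "mapply (word_prod L w a l) x = (p, q)" by (cases "mapply (word_prod L w a l) x")
  show ?thesis unfolding word_prod.simps mapply_mult pq
    by (simp add: current_def mapply_def site_mat_def cmod_power2) (simp add: power2_eq_square algebra_simps)
qed

lemma current_solution: "current (u (Suc (Suc n)), u (Suc n)) = current (u (Suc n), u n) + Im z * (cmod (u (Suc n)))\<^sup>2"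
  unfolding recurrence cmod_power2 by (simp add: current_def power2_eq_square algebra_simps)

lemma wronskian:
  "snd (mapply (word_prod L w a l) x) * u (Suc (a + l)) - fst (mapply (word_prod L w a l) x) * u (a + l)
     = snd x * u (Suc a) - fst x * u a"
proof (induction l)
  case (Suc l)
  obtain p q where pq: "mapply (word_prod L w a l) x = (p, q)" by (cases "mapply (word_prod L w a l) x")
  show ?case using Suc unfolding word_prod.simps mapply_mult pq
    by (simp add: mapply_def site_mat_def recurrence algebra_simps)
qed (simp add: mapply_one)

text \<open>The current identity telescopes, and the current vanishes at infinity. For empty
  \<open>F\<close> this yields the sign of the current.\<close>

lemma solution_tail:
  assumes z: "Im z > 0" and lim: "u \<longlonglongrightarrow> 0" and F: "finite F" "F \<subseteq> {m<..}"
  shows "Im z * (\<Sum>n\<in>F. (cmod (u n))\<^sup>2) \<le> - current (u (Suc m), u m)"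
proof -
  have sum: "Im z * (\<Sum>n\<in>{m<..m + k}. (cmod (u n))\<^sup>2) = current (u (Suc (m + k)), u (m + k)) - current (u (Suc m), u m)" for k
  proof (induction k)
    case (Suc k)
    have "{m<..m + Suc k} = insert (Suc (m + k)) {m<..m + k}" by auto
    then show ?case using Suc current_solution[of "m + k"] by (simp add: algebra_simps)
  qed simp
  have "(\<lambda>k. current (u (Suc (m + k)), u (m + k)) - current (u (Suc m), u m)) \<longlonglongrightarrow>
     Im (cnj 0 * 0) - current (u (Suc m), u m)"
    unfolding current_def fst_conv snd_conv
    using LIMSEQ_ignore_initial_segment[OF lim, of m] LIMSEQ_ignore_initial_segment[OF lim, of "Suc m"]
    by (intro tendsto_intros) (simp_all add: add.commute)
  then have lim2: "(\<lambda>k. Im z * (\<Sum>n\<in>{m<..m + k}. (cmod (u n))\<^sup>2)) \<longlonglongrightarrow> - current (u (Suc m), u m)"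
    unfolding sum by simp
  show ?thesis
  proof (rule tendsto_lowerbound[OF lim2])
    have "Im z * (\<Sum>n\<in>F. (cmod (u n))\<^sup>2) \<le> Im z * (\<Sum>n\<in>{m<..m + k}. (cmod (u n))\<^sup>2)" if "k \<ge> Max F" for k
    proof (intro mult_left_mono sum_mono2)
      show "F \<subseteq> {m<..m + k}"
      proof
        fix x assume "x \<in> F"
        then show "x \<in> {m<..m + k}" using F(2) that Max_ge[OF F(1), of x] by auto
      qed
    qed (use z in auto)
    then show "\<forall>\<^sub>F k in sequentially. Im z * (\<Sum>n\<in>F. (cmod (u n))\<^sup>2) \<le> Im z * (\<Sum>n\<in>{m<..m + k}. (cmod (u n))\<^sup>2)"
      by (auto simp: eventually_sequentially)
  qed auto
qed

text \<open>The currents of the given solution and of a solution \<open>p\<close> with real initial data at \<open>a\<close>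
  have opposite signs, so the conserved Wronskian controls \<open>\<bar>p\<bar> \<bar>u\<bar>\<close>.\<close>

lemma solution_small:
  assumes z: "Im z > 0" and lim: "u \<longlonglongrightarrow> 0" and l: "l \<ge> 1" and x: "x \<in> {(1, 0), (0, 1)}"
  shows "Im z * cmod (snd (mapply (word_prod L w a l) x)) * cmod (u (a + l)) \<le> cmod (u a) + cmod (u (Suc a))"
proof -
  define P where "P i = mapply (word_prod L w a i) x" for i
  define W where "W = snd x * u (Suc a) - fst x * u a"
  obtain l' where l': "l = Suc l'" using l by (cases l) auto
  have "current (P i) \<ge> 0" for i
  proof (induction i)
    case 0
    then show ?case using x by (auto simp: P_def mapply_one current_def)
  next
    case (Suc i)
    then show ?case using current_step[of a i x] z by (simp add: P_def)
  qed
  then have J: "current (P l) \<ge> Im z * (cmod (snd (P l)))\<^sup>2"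
    unfolding l' using current_step[of a l' x]
    by (simp add: P_def mapply_mult) (simp add: mapply_def site_mat_def)
  have Ju: "current (u (Suc (a + l)), u (a + l)) \<le> 0"
    using solution_tail[OF z lim, of "{}" "a + l"] by simp
  let ?p = "snd (P l)" and ?p' = "fst (P l)" and ?u = "u (a + l)" and ?u' = "u (Suc (a + l))"
  have wr: "?p * ?u' - ?p' * ?u = W"
    using wronskian[of a l x] by (simp add: P_def W_def)
  \<comment> \<open>The imaginary part of this multiple of the Wronskian is a combination of the two
    currents in which both terms have the same sign, so they cannot cancel.\<close>
  have "cnj ?p * cnj ?u * W = of_real ((cmod ?p)\<^sup>2) * (cnj ?u * ?u') - of_real ((cmod ?u)\<^sup>2) * (cnj ?p * ?p')"
    unfolding wr[symmetric] complex_norm_square by (simp add: algebra_simps)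
  moreover have Im_comb: "Im (of_real r * X - of_real s * Y) = r * Im X - s * Im Y" for r s X Y
    by simp
  ultimately have "Im (cnj ?p * cnj ?u * W) = (cmod ?p)\<^sup>2 * current (?u', ?u) - (cmod ?u)\<^sup>2 * current (P l)"
    by (simp only: Im_comb current_def fst_conv snd_conv)
  moreover have "(cmod ?p)\<^sup>2 * current (?u', ?u) \<le> 0" using Ju by (simp add: mult_nonneg_nonpos)
  moreover have "(cmod ?u)\<^sup>2 * current (P l) \<ge> (cmod ?u)\<^sup>2 * (Im z * (cmod ?p)\<^sup>2)"
    using J by (intro mult_left_mono) auto
  moreover have "\<bar>Im (cnj ?p * cnj ?u * W)\<bar> \<le> cmod ?p * cmod ?u * cmod W"
    using abs_Im_le_cmod[of "cnj ?p * cnj ?u * W"] by (simp add: norm_mult)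
  ultimately have "(cmod ?p * cmod ?u) * (Im z * cmod ?p * cmod ?u) \<le> (cmod ?p * cmod ?u) * cmod W"
    by (simp add: power2_eq_square algebra_simps)
  then have "Im z * cmod ?p * cmod ?u \<le> cmod W"
    by (cases "cmod ?p * cmod ?u = 0") (auto simp: mult_le_cancel_left)
  also have "cmod W \<le> cmod (u a) + cmod (u (Suc a))"
    using x by (auto simp: W_def)
  finally show ?thesis by (simp add: P_def)
qed

text \<open>One diagonal entry of the block matrix has modulus at least \<open>t / 2\<close>, which
  makes a solution with real data large and hence \<open>u\<close> small at the end of the block.
  The mass beyond is at most a product of two neighbouring values divided by \<open>Im z\<close>.
  The product is turned into a sum of squares, the form that the Plancherel inequality
  accepts.\<close>

lemma solution_decay:
  assumes z: "Im z > 0" and lim: "u \<longlonglongrightarrow> 0" and l: "l \<ge> 1"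
    and tr: "cmod (mtr (word_prod L w a l)) \<ge> t" "t > 0" and F: "finite F" "F \<subseteq> {Suc (a + l)<..}"
  shows "(\<Sum>n\<in>F. (cmod (u n))\<^sup>2) \<le> 2 / ((Im z)\<^sup>2 * t) *
     ((cmod (u a))\<^sup>2 + (cmod (u (Suc a)))\<^sup>2 + (cmod (u (Suc (a + l))))\<^sup>2 + (cmod (u (Suc (Suc (a + l)))))\<^sup>2)"
proof -
  have main: "(\<Sum>n\<in>F. (cmod (u n))\<^sup>2) \<le> 2 / ((Im z)\<^sup>2 * t) *
      ((cmod (u a))\<^sup>2 + (cmod (u (Suc a)))\<^sup>2 + (cmod (u (Suc (a + k))))\<^sup>2)"
    if k: "k \<ge> 1" "F \<subseteq> {a + k<..}" and x: "x \<in> {(1, 0), (0, 1)}"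
      and big: "cmod (snd (mapply (word_prod L w a k) x)) \<ge> t / 2" for k x
  proof -
    let ?A = "cmod (u a)" and ?B = "cmod (u (Suc a))" and ?C = "cmod (u (Suc (a + k)))" and ?U = "cmod (u (a + k))"
    let ?S = "\<Sum>n\<in>F. (cmod (u n))\<^sup>2"
    have "Im z * (t / 2) * ?U \<le> Im z * cmod (snd (mapply (word_prod L w a k) x)) * ?U"
      using big z by (intro mult_right_mono mult_left_mono) auto
    also have "\<dots> \<le> ?A + ?B" by (rule solution_small[OF z lim k(1) x])
    finally have 1: "Im z * (t / 2) * ?U \<le> ?A + ?B" .
    have "Im z * ?S \<le> - current (u (Suc (a + k)), u (a + k))"
      by (rule solution_tail[OF z lim F(1) k(2)])
    also have "\<dots> \<le> ?U * ?C"
      using abs_Im_le_cmod[of "cnj (u (a + k)) * u (Suc (a + k))"] by (simp add: current_def norm_mult)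
    finally have "Im z * (t / 2) * (Im z * ?S) \<le> Im z * (t / 2) * (?U * ?C)"
      using z tr(2) by (intro mult_left_mono) auto
    also have "\<dots> \<le> (?A + ?B) * ?C" using mult_right_mono[OF 1, of ?C] by (simp add: mult_ac)
    also have "\<dots> \<le> ?A\<^sup>2 + ?B\<^sup>2 + ?C\<^sup>2"
    proof -
      have "0 \<le> (?A - ?C)\<^sup>2 + (?B - ?C)\<^sup>2 + ?A\<^sup>2 + ?B\<^sup>2" by simp
      then show ?thesis by (simp add: power2_diff algebra_simps)
    qed
    finally have "(Im z)\<^sup>2 * t * ?S \<le> 2 * (?A\<^sup>2 + ?B\<^sup>2 + ?C\<^sup>2)" by (simp add: power2_eq_square algebra_simps)
    moreover have "(Im z)\<^sup>2 * t > 0" using z tr(2) by simp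
    ultimately have "?S \<le> 2 * (?A\<^sup>2 + ?B\<^sup>2 + ?C\<^sup>2) / ((Im z)\<^sup>2 * t)"
      by (simp add: pos_le_divide_eq mult_ac)
    then show ?thesis by simp
  qed
  have c: "2 / ((Im z)\<^sup>2 * t) \<ge> 0" using tr(2) by simp
  let ?M = "word_prod L w a l"
  have "cmod (m11 ?M) + cmod (m22 ?M) \<ge> t" using tr(1) norm_triangle_ineq[of "m11 ?M" "m22 ?M"] by (simp add: mtr_def)
  then consider "cmod (m22 ?M) \<ge> t / 2" | "cmod (m11 ?M) \<ge> t / 2" by linarith
  then show ?thesis
  proof cases
    case 1
    have "(\<Sum>n\<in>F. (cmod (u n))\<^sup>2) \<le> 2 / ((Im z)\<^sup>2 * t) *
      ((cmod (u a))\<^sup>2 + (cmod (u (Suc a)))\<^sup>2 + (cmod (u (Suc (a + l))))\<^sup>2)"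
      by (rule main[OF l, of "(0, 1)"]) (use F 1 in \<open>auto simp: mapply_def\<close>)
    also have "\<dots> \<le> 2 / ((Im z)\<^sup>2 * t) * ((cmod (u a))\<^sup>2 + (cmod (u (Suc a)))\<^sup>2 + (cmod (u (Suc (a + l))))\<^sup>2 + (cmod (u (Suc (Suc (a + l)))))\<^sup>2)"
      using c by (intro mult_left_mono) auto
    finally show ?thesis .
  next
    \<comment> \<open>The entry \<open>m11\<close> is the first component of the solution started at
      (1, 0). One more site makes it the second component, hence \<open>Suc l\<close> and the fourth
      summand.\<close>
    case 2
    have "(\<Sum>n\<in>F. (cmod (u n))\<^sup>2) \<le> 2 / ((Im z)\<^sup>2 * t) *
      ((cmod (u a))\<^sup>2 + (cmod (u (Suc a)))\<^sup>2 + (cmod (u (Suc (a + Suc l))))\<^sup>2)"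
      by (rule main[of "Suc l" "(1, 0)"]) (use F 2 in \<open>auto simp: mapply_mult\<close>, simp add: mapply_def site_mat_def)
    also have "\<dots> \<le> 2 / ((Im z)\<^sup>2 * t) * ((cmod (u a))\<^sup>2 + (cmod (u (Suc a)))\<^sup>2 + (cmod (u (Suc (a + l))))\<^sup>2 + (cmod (u (Suc (Suc (a + l)))))\<^sup>2)"
      using c by (intro mult_left_mono) auto
    finally show ?thesis .
  qed
qed

end

section \<open>A Plancherel inequality\<close>

lemma integrable_indicator_exp:
  "(e::real) > 0 \<Longrightarrow> integrable lborel (\<lambda>t::real. indicator {0<..} t * exp (- e * t))"
  using integrable_I0i_exp_mscale[of e] by (simp add: set_integrable_def mult_ac)

lemma integrable_exp_abs:
  fixes e :: real
  assumes "e > 0"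
  shows "integrable lborel (\<lambda>t::real. exp (- e * \<bar>t\<bar>))"
proof -
  let ?f = "\<lambda>t::real. indicator {0<..} t * exp (- e * t)"
  have i: "integrable lborel ?f" by (rule integrable_indicator_exp[OF assms])
  have "integrable lborel (\<lambda>t. ?f (0 + (-1) * t))"
    by (rule lborel_integrable_real_affine[OF i]) simp
  from Bochner_Integration.integrable_add[OF i this]
  have "integrable lborel (\<lambda>t. ?f t + ?f (0 + (-1) * t))" .
  moreover have "AE t in lborel. ?f t + ?f (0 + (-1) * t) = exp (- e * \<bar>t\<bar>)"
    using AE_lborel_singleton[of "0::real"] by eventually_elim (auto simp: indicator_def)
  ultimately show ?thesis
    by (subst integrable_cong_AE[where g = "\<lambda>t. ?f t + ?f (0 + (-1) * t)"]) auto
qed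

lemma cnj_borel_measurable [measurable]: "cnj \<in> borel_measurable borel"
  by (intro borel_measurable_continuous_onI continuous_intros)

abbreviation "gauss \<equiv> std_normal_distribution"

text \<open>Modelled on an amplitude multiplied by exp (-e t) and cut off at \<open>t = 0\<close>.
  The transform \<open>ft\<close> below carries no factor 2 pi, as energies are only compared with
  each other.\<close>

locale causal =
  fixes e :: real and h :: "real \<Rightarrow> complex"
  assumes e: "e > 0"
    and bound: "\<And>t. cmod (h t) \<le> indicator {0<..} t * exp (- e * t)"
    and meas [measurable]: "h \<in> borel_measurable borel"
    and cont: "\<And>t. t > 0 \<Longrightarrow> isCont h t"
begin

definition ft :: "real \<Rightarrow> complex" where "ft E = (\<integral>t. iexp (E * t) * h t \<partial>lborel)"

definition acorr :: "real \<Rightarrow> complex" where "acorr r = (\<integral>t. h (t + r) * cnj (h t) \<partial>lborel)"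

definition energy :: real where "energy = (\<integral>t. (cmod (h t))\<^sup>2 \<partial>lborel)"

lemma h_zero: "t \<le> 0 \<Longrightarrow> h t = 0"
  using bound[of t] by simp

lemma h_le1: "cmod (h t) \<le> 1"
  using bound[of t] e by (cases "t > 0") (auto intro: order_trans)

lemma integrable_h2: "integrable lborel (\<lambda>t. (cmod (h t))\<^sup>2)"
proof (rule Bochner_Integration.integrable_bound[OF integrable_indicator_exp[OF e]])
  have "(cmod (h t))\<^sup>2 \<le> indicator {0<..} t * exp (- e * t)" for t
    using mult_mono[OF bound[of t] h_le1[of t]] by (simp add: power2_eq_square)
  then show "AE t in lborel. norm ((cmod (h t))\<^sup>2) \<le> norm (indicator {0<..} t * exp (- e * t) :: real)"
    by (auto intro!: AE_I2)
qed auto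

text \<open>Half of the decay is given to each variable, so that the majorant is integrable over the
  plane and Fubini applies. On the support |t| + |r| is at most 2 (2t + r).\<close>

lemma product_bound:
  "cmod (h (t + r) * cnj (h t)) \<le> exp (- (e/2) * \<bar>t\<bar>) * exp (- (e/2) * \<bar>r\<bar>)"
proof (cases "t > 0 \<and> t + r > 0")
  case True
  have "cmod (h (t + r) * cnj (h t)) \<le> exp (- e * (t + r)) * exp (- e * t)"
    unfolding norm_mult complex_mod_cnj using bound[of "t + r"] bound[of t] True by (intro mult_mono) auto
  also have "\<dots> = exp (- e * (t + r + t))" by (simp add: exp_add[symmetric] algebra_simps)
  also have "\<dots> \<le> exp (- (e/2) * (\<bar>t\<bar> + \<bar>r\<bar>))"
  proof -
    have "\<bar>t\<bar> + \<bar>r\<bar> \<le> 2 * (t + r + t)" using True by auto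
    then have "(e/2) * (\<bar>t\<bar> + \<bar>r\<bar>) \<le> (e/2) * (2 * (t + r + t))" using e by (intro mult_left_mono) auto
    then show ?thesis unfolding exp_le_cancel_iff by (simp add: algebra_simps)
  qed
  finally show ?thesis by (simp only: distrib_left exp_add)
next
  case False
  then show ?thesis using h_zero[of t] h_zero[of "t + r"] by (auto simp: not_less)
qed

lemma integrable_product: "integrable lborel (\<lambda>t. h (t + r) * cnj (h t))"
  by (rule Bochner_Integration.integrable_bound[where f = "\<lambda>t. exp (- (e/2) * \<bar>t\<bar>) * exp (- (e/2) * \<bar>r\<bar>)"])
    (use product_bound integrable_exp_abs[of "e/2"] e in auto)

lemma acorr_zero: "acorr 0 = of_real energy"
  unfolding acorr_def energy_def integral_complex_of_real[symmetric]
  by (intro Bochner_Integration.integral_cong) (auto simp: complex_norm_square[symmetric])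

lemma energy_shift: "integrable lborel (\<lambda>t. (cmod (h (t + r)))\<^sup>2)" "(\<integral>t. (cmod (h (t + r)))\<^sup>2 \<partial>lborel) = energy"
  using lborel_integrable_real_affine[OF integrable_h2, of 1 r]
    lborel_integral_real_affine[of 1 "\<lambda>t. (cmod (h t))\<^sup>2" r]
  by (simp_all add: add.commute energy_def)

lemma acorr_le: "cmod (acorr r) \<le> energy"
proof -
  have "cmod (acorr r) \<le> (\<integral>t. cmod (h (t + r) * cnj (h t)) \<partial>lborel)"
    unfolding acorr_def by (rule integral_norm_bound)
  also have "\<dots> \<le> (\<integral>t. ((cmod (h (t + r)))\<^sup>2 + (cmod (h t))\<^sup>2) / 2 \<partial>lborel)"
  proof (rule integral_mono)
    show "integrable lborel (\<lambda>t. cmod (h (t + r) * cnj (h t)))"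
      using integrable_product by (rule integrable_norm)
    show "integrable lborel (\<lambda>t. ((cmod (h (t + r)))\<^sup>2 + (cmod (h t))\<^sup>2) / 2)"
      using energy_shift(1) integrable_h2 by simp
    show "cmod (h (t + r) * cnj (h t)) \<le> ((cmod (h (t + r)))\<^sup>2 + (cmod (h t))\<^sup>2) / 2" for t
      using sum_squares_bound[of "cmod (h (t + r))" "cmod (h t)"] by (simp add: norm_mult)
  qed
  also have "\<dots> = energy"
    using energy_shift[of r] integrable_h2 by (simp add: energy_def)
  finally show ?thesis .
qed

lemma acorr_bound: "cmod (acorr r) \<le> exp (- (e/2) * \<bar>r\<bar>) * (\<integral>t. exp (- (e/2) * \<bar>t\<bar>) \<partial>lborel)"
proof -
  have "cmod (acorr r) \<le> (\<integral>t. cmod (h (t + r) * cnj (h t)) \<partial>lborel)"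
    unfolding acorr_def by (rule integral_norm_bound)
  also have "\<dots> \<le> (\<integral>t. exp (- (e/2) * \<bar>t\<bar>) * exp (- (e/2) * \<bar>r\<bar>) \<partial>lborel)"
  proof (rule integral_mono)
    show "integrable lborel (\<lambda>t. cmod (h (t + r) * cnj (h t)))"
      using integrable_product by (rule integrable_norm)
    show "integrable lborel (\<lambda>t. exp (- (e/2) * \<bar>t\<bar>) * exp (- (e/2) * \<bar>r\<bar>))"
      using integrable_exp_abs[of "e/2"] e by simp
  qed (rule product_bound)
  finally show ?thesis by (simp add: mult.commute)
qed

lemma acorr_measurable [measurable]: "acorr \<in> borel_measurable borel"
proof -
  have "(\<lambda>r. \<integral>t. h (t + r) * cnj (h t) \<partial>lborel) \<in> borel_measurable lborel" by measurable
  then show ?thesis by (simp add: acorr_def[abs_def])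
qed

text \<open>Dominated convergence: for \<open>t > 0\<close> the shifted factor converges by
  continuity, elsewhere the factor \<open>h t\<close> vanishes.\<close>

lemma acorr_limit:
  assumes "s \<longlonglongrightarrow> 0"
  shows "(\<lambda>i. acorr (s i)) \<longlonglongrightarrow> of_real energy"
  unfolding acorr_zero[symmetric] unfolding acorr_def
proof (rule integral_dominated_convergence[where w = "\<lambda>t. indicator {0<..} t * exp (- e * t)"])
  show "AE t in lborel. (\<lambda>i. h (t + s i) * cnj (h t)) \<longlonglongrightarrow> h (t + 0) * cnj (h t)"
  proof (rule AE_I2)
    fix t :: real
    show "(\<lambda>i. h (t + s i) * cnj (h t)) \<longlonglongrightarrow> h (t + 0) * cnj (h t)"
    proof (cases "t > 0")
      case True
      have "(\<lambda>i. t + s i) \<longlonglongrightarrow> t + 0" by (intro tendsto_intros assms)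
      then have "(\<lambda>i. h (t + s i)) \<longlonglongrightarrow> h (t + 0)"
        using cont[OF True] by (intro isCont_tendsto_compose[of "t + 0" h]) auto
      then show ?thesis by (intro tendsto_intros)
    next
      case False
      then show ?thesis using h_zero[of t] by simp
    qed
  qed
  show "AE t in lborel. cmod (h (t + s i) * cnj (h t)) \<le> indicator {0<..} t * exp (- e * t)" for i
    using mult_mono[OF h_le1 bound] by (intro AE_I2) (simp add: norm_mult)
qed (use integrable_indicator_exp[OF e] in auto)

lemma ft_measurable [measurable]: "ft \<in> borel_measurable borel"
proof -
  have "(\<lambda>E. \<integral>t. iexp (E * t) * h t \<partial>lborel) \<in> borel_measurable lborel" by measurable
  then show ?thesis by (simp add: ft_def[abs_def])
qed

text \<open>The Wiener-Khinchin formula: Fubini and a translation by \<open>t\<close> separate the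
  double integral into \<open>ft E\<close> and its conjugate.\<close>

lemma ft_square: "complex_of_real ((cmod (ft E))\<^sup>2) = (\<integral>r. iexp (E * r) * acorr r \<partial>lborel)"
proof -
  let ?c = "\<integral>t. exp (- (e/2) * \<bar>t\<bar>) \<partial>lborel"
  let ?F = "\<lambda>r t. iexp (E * r) * (h (t + r) * cnj (h t))"
  have ex: "integrable lborel (\<lambda>t::real. exp (- (e/2) * \<bar>t\<bar>))" using integrable_exp_abs[of "e/2"] e by simp
  have int: "integrable (lborel \<Otimes>\<^sub>M lborel) (case_prod ?F)"
  proof (rule lborel_pair.Fubini_integrable)
    show "case_prod ?F \<in> borel_measurable (lborel \<Otimes>\<^sub>M lborel)" by measurable
    show "integrable lborel (\<lambda>r. \<integral>t. norm (case_prod ?F (r, t)) \<partial>lborel)"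
    proof (rule Bochner_Integration.integrable_bound[where f = "\<lambda>r. ?c * exp (- (e/2) * \<bar>r\<bar>)"])
      show "AE r in lborel. norm (\<integral>t. norm (case_prod ?F (r, t)) \<partial>lborel) \<le> norm (?c * exp (- (e/2) * \<bar>r\<bar>))"
      proof (rule AE_I2)
        fix r :: real
        have "(\<integral>t. norm (?F r t) \<partial>lborel) \<le> (\<integral>t. exp (- (e/2) * \<bar>t\<bar>) * exp (- (e/2) * \<bar>r\<bar>) \<partial>lborel)"
        proof (rule integral_mono)
          show "integrable lborel (\<lambda>t. norm (?F r t))"
            using integrable_norm[OF integrable_product[of r]] by (simp add: norm_mult)
          show "integrable lborel (\<lambda>t. exp (- (e/2) * \<bar>t\<bar>) * exp (- (e/2) * \<bar>r\<bar>))"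
            using ex by simp
          show "norm (?F r t) \<le> exp (- (e/2) * \<bar>t\<bar>) * exp (- (e/2) * \<bar>r\<bar>)" for t
            using product_bound[of t r] by (simp add: norm_mult)
        qed
        then show "norm (\<integral>t. norm (case_prod ?F (r, t)) \<partial>lborel) \<le> norm (?c * exp (- (e/2) * \<bar>r\<bar>))"
          by (simp add: abs_mult abs_of_nonneg integral_nonneg)
      qed
      show "(\<lambda>r. \<integral>t. norm (case_prod ?F (r, t)) \<partial>lborel) \<in> borel_measurable lborel" by measurable
    qed (use ex in simp)
    show "AE r in lborel. integrable lborel (\<lambda>t. case (r, t) of (r, t) \<Rightarrow> ?F r t)"
      using integrable_product by (intro AE_I2) simp
  qed
  have "(\<integral>r. iexp (E * r) * acorr r \<partial>lborel) = (\<integral>r. (\<integral>t. ?F r t \<partial>lborel) \<partial>lborel)"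
    unfolding acorr_def by (simp only: integral_mult_right_zero)
  also have "\<dots> = (\<integral>t. (\<integral>r. ?F r t \<partial>lborel) \<partial>lborel)"
    by (rule lborel_pair.Fubini_integral[OF int, symmetric])
  also have "\<dots> = (\<integral>t. ft E * cnj (iexp (E * t) * h t) \<partial>lborel)"
  proof (rule Bochner_Integration.integral_cong)
    fix t :: real
    have "(\<integral>r. ?F r t \<partial>lborel) = (\<integral>r. (iexp (E * (t + 1 * r)) * h (t + 1 * r)) * cnj (iexp (E * t) * h t) \<partial>lborel)"
    proof (rule Bochner_Integration.integral_cong)
      fix r :: real
      have a: "iexp (E * (t + 1 * r)) = iexp (E * t) * iexp (E * r)"
        by (simp add: exp_add[symmetric] algebra_simps)
      have "iexp (E * t) * cnj (iexp (E * t)) = 1"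
        unfolding complex_norm_square[symmetric] by simp
      moreover have "(iexp (E * (t + 1 * r)) * h (t + 1 * r)) * cnj (iexp (E * t) * h t) =
          (iexp (E * t) * cnj (iexp (E * t))) * ?F r t"
        unfolding a by (simp only: complex_cnj_mult mult_1 mult_ac)
      ultimately show "?F r t = (iexp (E * (t + 1 * r)) * h (t + 1 * r)) * cnj (iexp (E * t) * h t)"
        by (simp only: mult_1)
    qed simp
    also have "\<dots> = (\<integral>r. iexp (E * (t + 1 * r)) * h (t + 1 * r) \<partial>lborel) * cnj (iexp (E * t) * h t)"
      by (rule integral_mult_left_zero)
    also have "(\<integral>r. iexp (E * (t + 1 * r)) * h (t + 1 * r) \<partial>lborel) = ft E"
      using lborel_integral_real_affine[of 1 "\<lambda>r. iexp (E * r) * h r" t] by (simp add: ft_def)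
    finally show "(\<integral>r. ?F r t \<partial>lborel) = ft E * cnj (iexp (E * t) * h t)" .
  qed auto
  also have "\<dots> = ft E * cnj (ft E)"
    unfolding ft_def by (simp only: integral_mult_right_zero Bochner_Integration.integral_cnj)
  finally show ?thesis by (simp add: complex_norm_square[symmetric])
qed

lemma ft_le: "(cmod (ft E))\<^sup>2 \<le> (\<integral>t. cmod (h t) \<partial>lborel)\<^sup>2"
proof (intro power_mono)
  have "cmod (ft E) \<le> (\<integral>t. cmod (iexp (E * t) * h t) \<partial>lborel)"
    unfolding ft_def by (rule integral_norm_bound)
  then show "cmod (ft E) \<le> (\<integral>t. cmod (h t) \<partial>lborel)" by (simp add: norm_mult)
qed auto

text \<open>Gaussian regularisation replaces Fourier inversion: as \<open>s\<close> tends to \<open>0\<close> only the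
  autocorrelation near \<open>0\<close> survives.\<close>

lemma gaussian_average:
  assumes s: "s > 0"
  shows "complex_of_real (\<integral>x. (cmod (ft (x / s)))\<^sup>2 \<partial>gauss) =
     of_real (s * sqrt (2 * pi)) * (\<integral>y. acorr (s * y) \<partial>gauss)"
proof -
  let gauss = "gauss"
  interpret N: real_distribution gauss by (rule real_dist_normal_dist)
  interpret P: pair_sigma_finite gauss lborel ..
  let ?c = "\<integral>t. exp (- (e/2) * \<bar>t\<bar>) \<partial>lborel"
  let ?F = "\<lambda>x r. iexp (x / s * r) * acorr r"
  have ex: "integrable lborel (\<lambda>t::real. exp (- (e/2) * \<bar>t\<bar>))" using integrable_exp_abs[of "e/2"] e by simp
  have ia: "integrable lborel acorr"
    by (rule Bochner_Integration.integrable_bound[where f = "\<lambda>r. ?c * exp (- (e/2) * \<bar>r\<bar>)"])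
      (use acorr_bound ex in \<open>auto intro!: AE_I2 order_trans[OF acorr_bound] simp: mult.commute abs_mult\<close>)
  have iaE: "integrable lborel (\<lambda>r. iexp (E * r) * acorr r)" for E
    by (rule Bochner_Integration.integrable_bound[OF ia]) (auto simp: norm_mult)
  have int: "integrable (gauss \<Otimes>\<^sub>M lborel) (case_prod ?F)"
  proof (rule P.Fubini_integrable)
    show "case_prod ?F \<in> borel_measurable (gauss \<Otimes>\<^sub>M lborel)" by measurable
    show "integrable gauss (\<lambda>x. \<integral>r. norm (case (x, r) of (x, r) \<Rightarrow> ?F x r) \<partial>lborel)"
      by (simp add: norm_mult)
    show "AE x in gauss. integrable lborel (\<lambda>r. case (x, r) of (x, r) \<Rightarrow> ?F x r)"
      by (intro AE_I2) (simp only: prod.case iaE)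
  qed
  have "complex_of_real (\<integral>x. (cmod (ft (x / s)))\<^sup>2 \<partial>gauss) = (\<integral>x. (\<integral>r. ?F x r \<partial>lborel) \<partial>gauss)"
    unfolding integral_complex_of_real[symmetric] ft_square ..
  also have "\<dots> = (\<integral>r. (\<integral>x. ?F x r \<partial>gauss) \<partial>lborel)"
    by (rule P.Fubini_integral[OF int, symmetric])
  \<comment> \<open>The integral over \<open>x\<close> is the characteristic function of the normal
    law, again a Gaussian. The substitution r = s y then restores the normal density.\<close>
  also have "\<dots> = (\<integral>r. complex_of_real (exp (- (r / s)\<^sup>2 / 2)) * acorr r \<partial>lborel)"
  proof (rule Bochner_Integration.integral_cong)
    fix r :: real
    have "(\<integral>x. ?F x r \<partial>gauss) = (\<integral>x. iexp ((r / s) * x) \<partial>gauss) * acorr r"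
      by (simp only: integral_mult_left_zero times_divide_eq_left times_divide_eq_right) (simp only: mult.commute)
    also have "(\<integral>x. iexp ((r / s) * x) \<partial>gauss) = char gauss (r / s)" by (simp add: char_def)
    finally show "(\<integral>x. ?F x r \<partial>gauss) = complex_of_real (exp (- (r / s)\<^sup>2 / 2)) * acorr r"
      by (simp add: char_std_normal_distribution)
  qed simp
  also have "\<dots> = of_real s * (\<integral>y. complex_of_real (exp (- y\<^sup>2 / 2)) * acorr (s * y) \<partial>lborel)"
    using lborel_integral_real_affine[of s "\<lambda>r. complex_of_real (exp (- (r / s)\<^sup>2 / 2)) * acorr r" 0] s
    by (simp add: scaleR_conv_of_real)
  also have "(\<integral>y. complex_of_real (exp (- y\<^sup>2 / 2)) * acorr (s * y) \<partial>lborel) =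
     of_real (sqrt (2 * pi)) * (\<integral>y. std_normal_density y *\<^sub>R acorr (s * y) \<partial>lborel)"
    unfolding integral_mult_right_zero[symmetric]
    by (intro Bochner_Integration.integral_cong) (auto simp: std_normal_density_def scaleR_conv_of_real)
  also have "(\<integral>y. std_normal_density y *\<^sub>R acorr (s * y) \<partial>lborel) = (\<integral>y. acorr (s * y) \<partial>gauss)"
    by (subst integral_density) (auto simp: normal_density_nonneg)
  finally show ?thesis by (simp add: mult.assoc)
qed

lemma gaussian_average_le:
  assumes s: "s > 0"
  shows "(\<integral>x. (cmod (ft (x / s)))\<^sup>2 \<partial>gauss) \<le> s * sqrt (2 * pi) * energy"
proof -
  interpret N: real_distribution gauss by (rule real_dist_normal_dist)
  have "(\<integral>x. (cmod (ft (x / s)))\<^sup>2 \<partial>gauss) \<le> cmod (complex_of_real (\<integral>x. (cmod (ft (x / s)))\<^sup>2 \<partial>gauss))"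
    by simp
  also have "\<dots> = s * sqrt (2 * pi) * cmod (\<integral>y. acorr (s * y) \<partial>gauss)"
    unfolding gaussian_average[OF s] using s by (simp add: norm_mult)
  also have "cmod (\<integral>y. acorr (s * y) \<partial>gauss) \<le> (\<integral>y. cmod (acorr (s * y)) \<partial>gauss)"
    by (rule integral_norm_bound)
  also have "\<dots> \<le> (\<integral>y. energy \<partial>gauss)"
    by (rule integral_mono) (auto intro!: acorr_le N.integrable_const_bound[where B = energy])
  also have "\<dots> = energy" using N.prob_space by simp
  finally show ?thesis using s by simp
qed

lemma gaussian_average_limit:
  assumes s: "\<And>i::nat. s i > 0" "s \<longlonglongrightarrow> 0"
  shows "(\<lambda>i. (\<integral>x. (cmod (ft (x / s i)))\<^sup>2 \<partial>gauss) / (s i * sqrt (2 * pi))) \<longlonglongrightarrow> energy"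
proof -
  interpret N: real_distribution gauss by (rule real_dist_normal_dist)
  have "(\<lambda>i. \<integral>y. acorr (s i * y) \<partial>gauss) \<longlonglongrightarrow> (\<integral>y. of_real energy \<partial>gauss)"
  proof (rule integral_dominated_convergence[where w = "\<lambda>_. energy"])
    show "AE y in gauss. (\<lambda>i. acorr (s i * y)) \<longlonglongrightarrow> of_real energy"
      by (intro AE_I2 acorr_limit tendsto_mult_left_zero s)
    show "AE y in gauss. cmod (acorr (s i * y)) \<le> energy" for i
      by (intro AE_I2 acorr_le)
  qed auto
  then have "(\<lambda>i. \<integral>y. acorr (s i * y) \<partial>gauss) \<longlonglongrightarrow> of_real energy"
    using N.prob_space by simp
  moreover have "(\<integral>y. acorr (s i * y) \<partial>gauss) =
      of_real ((\<integral>x. (cmod (ft (x / s i)))\<^sup>2 \<partial>gauss) / (s i * sqrt (2 * pi)))" for i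
    using gaussian_average[OF s(1)[of i]] s(1)[of i] by (simp add: field_simps)
  ultimately show ?thesis by (simp only: tendsto_of_real_iff)
qed

lemma integrable_gaussian: "integrable gauss (\<lambda>x. (cmod (ft (x / s)))\<^sup>2)"
proof -
  interpret N: real_distribution gauss by (rule real_dist_normal_dist)
  show ?thesis
  proof (rule N.integrable_const_bound[where B = "(\<integral>t. cmod (h t) \<partial>lborel)\<^sup>2"])
    have "norm ((cmod (ft (x / s)))\<^sup>2) \<le> (\<integral>t. cmod (h t) \<partial>lborel)\<^sup>2" for x
      using ft_le[of "x / s"] by (simp only: real_norm_def abs_power2)
    then show "AE x in gauss. norm ((cmod (ft (x / s)))\<^sup>2) \<le> (\<integral>t. cmod (h t) \<partial>lborel)\<^sup>2"
      by (rule AE_I2)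
  qed measurable
qed

end

text \<open>The inequality between transforms is averaged over energies with a Gaussian of width 1 /
  s. The limit in \<open>s\<close> is taken on the side of \<open>F\<close> only; on the side of
  \<open>W\<close> the bound \<open>gaussian_average_le\<close> holds for each
  \<open>s\<close>.\<close>

theorem plancherel_sum_le:
  fixes h :: "'i \<Rightarrow> real \<Rightarrow> complex"
  assumes h: "\<And>n. causal e (h n)" and fin: "finite F" "finite W" and eta: "\<eta> \<ge> 0"
    and le: "\<And>E. (\<Sum>n\<in>F. (cmod (causal.ft (h n) E))\<^sup>2) \<le> \<eta> * (\<Sum>n\<in>W. (cmod (causal.ft (h n) E))\<^sup>2)"
  shows "(\<Sum>n\<in>F. causal.energy (h n)) \<le> \<eta> * (\<Sum>n\<in>W. causal.energy (h n))"
proof -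
  let ?G = "\<lambda>n s. \<integral>x. (cmod (causal.ft (h n) (x / s)))\<^sup>2 \<partial>gauss"
  define s where "s i = inverse (real (Suc i))" for i
  have s: "s i > 0" "s \<longlonglongrightarrow> 0" for i
    using LIMSEQ_inverse_real_of_nat by (auto simp: s_def[abs_def])
  have lim: "(\<lambda>i. \<Sum>n\<in>F. ?G n (s i) / (s i * sqrt (2 * pi))) \<longlonglongrightarrow> (\<Sum>n\<in>F. causal.energy (h n))"
    by (intro tendsto_sum causal.gaussian_average_limit[OF h] s)
  have "(\<Sum>n\<in>F. ?G n (s i) / (s i * sqrt (2 * pi))) \<le> \<eta> * (\<Sum>n\<in>W. causal.energy (h n))" for i
  proof -
    note I = causal.integrable_gaussian[OF h]
    have "(\<Sum>n\<in>F. ?G n (s i)) = (\<integral>x. (\<Sum>n\<in>F. (cmod (causal.ft (h n) (x / s i)))\<^sup>2) \<partial>gauss)"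
      by (rule Bochner_Integration.integral_sum[symmetric]) (rule I)
    also have "\<dots> \<le> (\<integral>x. \<eta> * (\<Sum>n\<in>W. (cmod (causal.ft (h n) (x / s i)))\<^sup>2) \<partial>gauss)"
      by (intro integral_mono le Bochner_Integration.integrable_sum integrable_mult_right I)
    also have "\<dots> = \<eta> * (\<Sum>n\<in>W. ?G n (s i))"
      by (simp add: Bochner_Integration.integral_sum I)
    also have "\<dots> \<le> \<eta> * (\<Sum>n\<in>W. s i * sqrt (2 * pi) * causal.energy (h n))"
      by (intro mult_left_mono sum_mono causal.gaussian_average_le[OF h] s eta)
    finally have "(\<Sum>n\<in>F. ?G n (s i)) \<le> (\<eta> * (\<Sum>n\<in>W. causal.energy (h n))) * (s i * sqrt (2 * pi))"
      by (simp add: sum_distrib_left mult_ac)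
    then show ?thesis
      unfolding sum_divide_distrib[symmetric] using s(1)[of i] by (subst pos_divide_le_eq) auto
  qed
  then show ?thesis by (intro LIMSEQ_le_const2[OF lim]) auto
qed

section \<open>Amplitudes of the evolution\<close>

lemma bounded_linear_ell2_apply: "bounded_linear (\<lambda>f. ell2_apply f n)"
  by (rule bounded_linear_intro[where K = 1])
    (auto simp: plus_ell2.rep_eq scaleR_ell2.rep_eq ell2_apply_norm_le)

lemma norm_delta: "norm (delta k) = 1"
proof -
  have "(norm (delta k))\<^sup>2 = (\<Sum>\<^sub>\<infinity>n\<in>{k}. (cmod (ell2_apply (delta k) n))\<^sup>2)"
    unfolding norm_ell2_power2 by (rule infsum_cong_neutral) (auto simp: delta.rep_eq)
  then show ?thesis by (simp add: delta.rep_eq power2_eq_1_iff) (smt (verit) norm_ge_zero)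
qed

abbreviation "hnorm lam \<theta> \<equiv> onorm (fib_hamiltonian lam \<theta>)"

definition moment :: "real \<Rightarrow> real \<Rightarrow> nat \<Rightarrow> int \<Rightarrow> complex" where
  "moment lam \<theta> k n = ell2_apply ((fib_hamiltonian lam \<theta> ^^ k) (delta 0)) n"

lemma moment_0: "moment lam \<theta> 0 n = (if n = 0 then 1 else 0)"
  by (simp add: moment_def delta.rep_eq)

lemma moment_Suc: "moment lam \<theta> (Suc k) n =
    moment lam \<theta> k (n + 1) + moment lam \<theta> k (n - 1) + of_real (fib_potential lam \<theta> n) * moment lam \<theta> k n"
  by (simp add: moment_def fib_hamiltonian.rep_eq)

lemma moment_support: "int k < \<bar>n\<bar> \<Longrightarrow> moment lam \<theta> k n = 0"
  by (induction k arbitrary: n) (auto simp: moment_0 moment_Suc)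

lemma norm_fib_hamiltonian_le: "norm (fib_hamiltonian lam \<theta> x) \<le> hnorm lam \<theta> * norm x"
  by (rule onorm[OF bounded_linear_fib_hamiltonian])

lemma moment_bound: "cmod (moment lam \<theta> k n) \<le> hnorm lam \<theta> ^ k"
proof -
  have "norm ((fib_hamiltonian lam \<theta> ^^ k) (delta 0)) \<le> hnorm lam \<theta> ^ k"
  proof (induction k)
    case (Suc k)
    have "norm ((fib_hamiltonian lam \<theta> ^^ Suc k) (delta 0)) \<le> hnorm lam \<theta> * norm ((fib_hamiltonian lam \<theta> ^^ k) (delta 0))"
      using norm_fib_hamiltonian_le by simp
    also have "\<dots> \<le> hnorm lam \<theta> * hnorm lam \<theta> ^ k"
      by (intro mult_left_mono Suc onorm_pos_le[OF bounded_linear_fib_hamiltonian])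
    finally show ?case by simp
  qed (simp add: norm_delta)
  then show ?thesis unfolding moment_def using ell2_apply_norm_le order_trans by blast
qed

definition ampl :: "real \<Rightarrow> real \<Rightarrow> int \<Rightarrow> real \<Rightarrow> complex" where
  "ampl lam \<theta> n t = ell2_apply (evolution (fib_hamiltonian lam \<theta>) t (delta 0)) n"

definition taylor :: "real \<Rightarrow> real \<Rightarrow> int \<Rightarrow> nat \<Rightarrow> complex" where
  "taylor lam \<theta> n k = (- \<i>) ^ k / fact k * moment lam \<theta> k n"

lemma norm_taylor: "cmod (taylor lam \<theta> n k * z ^ k) \<le> (hnorm lam \<theta> * cmod z) ^ k /\<^sub>R fact k"
proof -
  have "cmod (taylor lam \<theta> n k * z ^ k) = cmod (moment lam \<theta> k n) * cmod z ^ k / fact k"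
    by (simp add: taylor_def norm_mult norm_divide norm_power)
  also have "\<dots> \<le> hnorm lam \<theta> ^ k * cmod z ^ k / fact k"
    by (intro divide_right_mono mult_right_mono moment_bound) auto
  finally show ?thesis by (simp add: power_mult_distrib field_simps)
qed

lemma summable_taylor: "summable (\<lambda>k. taylor lam \<theta> n k * z ^ k)"
  by (rule summable_comparison_test'[OF summable_exp_generic norm_taylor])

lemma ampl_taylor: "ampl lam \<theta> n t = (\<Sum>k. taylor lam \<theta> n k * of_real t ^ k)"
proof -
  interpret bounded_linear "\<lambda>f. ell2_apply f n" by (rule bounded_linear_ell2_apply)
  have "ampl lam \<theta> n t = (\<Sum>k. ell2_apply (cscale ((- \<i> * complex_of_real t) ^ k / fact k)
      ((fib_hamiltonian lam \<theta> ^^ k) (delta 0))) n)"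
    unfolding ampl_def evolution_def
    by (rule suminf[OF summable_evolution[OF bounded_linear_fib_hamiltonian]])
  also have "\<dots> = (\<Sum>k. taylor lam \<theta> n k * of_real t ^ k)"
    by (intro suminf_cong) (simp only: cscale.rep_eq taylor_def moment_def power_mult_distrib times_divide_eq_left times_divide_eq_right mult_ac)
  finally show ?thesis .
qed

lemma diffs_taylor: "diffs (taylor lam \<theta> n) k = - \<i> * (taylor lam \<theta> (n + 1) k + taylor lam \<theta> (n - 1) k
     + of_real (fib_potential lam \<theta> n) * taylor lam \<theta> n k)"
proof -
  have "of_nat (Suc k) * (a / fact (Suc k)) = a / (fact k :: complex)" for a
    by (simp add: fact_Suc del: of_nat_Suc)
  then have "of_nat (Suc k) * ((- \<i>) ^ Suc k / fact (Suc k)) = - \<i> * ((- \<i>) ^ k / (fact k :: complex))"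
    by (simp only: power_Suc times_divide_eq_right)
  then have "diffs (taylor lam \<theta> n) k = - \<i> * ((- \<i>) ^ k / fact k) * moment lam \<theta> (Suc k) n"
    unfolding diffs_def taylor_def by (simp only: mult.assoc[symmetric])
  then show ?thesis by (simp add: moment_Suc taylor_def algebra_simps)
qed

text \<open>The Schroedinger equation site by site, by termwise differentiation of an everywhere
  convergent power series; this keeps the calculus scalar.\<close>

lemma ampl_deriv:
  "(ampl lam \<theta> n has_vector_derivative - \<i> * (ampl lam \<theta> (n + 1) t + ampl lam \<theta> (n - 1) t
     + of_real (fib_potential lam \<theta> n) * ampl lam \<theta> n t)) (at t)"
proof -
  have "((\<lambda>x. \<Sum>k. taylor lam \<theta> n k * x ^ k) has_field_derivative
      (\<Sum>k. diffs (taylor lam \<theta> n) k * of_real t ^ k)) (at (of_real t))"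
    by (rule termdiffs_strong_converges_everywhere[OF summable_taylor])
  then have "((\<lambda>s. \<Sum>k. taylor lam \<theta> n k * of_real s ^ k) has_vector_derivative
      (\<Sum>k. diffs (taylor lam \<theta> n) k * of_real t ^ k)) (at t)"
    by (rule has_vector_derivative_real_field)
  moreover have "(\<Sum>k. diffs (taylor lam \<theta> n) k * of_real t ^ k) =
      - \<i> * (ampl lam \<theta> (n + 1) t + ampl lam \<theta> (n - 1) t + of_real (fib_potential lam \<theta> n) * ampl lam \<theta> n t)"
  proof -
    note s = summable_taylor[of lam \<theta> _ "of_real t"]
    have "(\<lambda>k. - \<i> * (taylor lam \<theta> (n + 1) k * of_real t ^ k + taylor lam \<theta> (n - 1) k * of_real t ^ k
       + of_real (fib_potential lam \<theta> n) * (taylor lam \<theta> n k * of_real t ^ k))) sums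
      (- \<i> * (ampl lam \<theta> (n + 1) t + ampl lam \<theta> (n - 1) t + of_real (fib_potential lam \<theta> n) * ampl lam \<theta> n t))"
      unfolding ampl_taylor by (intro sums_mult sums_add summable_sums s)
    then show ?thesis unfolding diffs_taylor by (intro sums_unique[symmetric]) (simp add: algebra_simps)
  qed
  ultimately show ?thesis by (simp add: ampl_taylor[abs_def])
qed

lemma ampl_0: "ampl lam \<theta> n 0 = (if n = 0 then 1 else 0)"
proof -
  have "ampl lam \<theta> n 0 = taylor lam \<theta> n 0"
    unfolding ampl_taylor by (simp add: powser_zero)
  then show ?thesis by (simp add: taylor_def moment_0)
qed

lemma continuous_ampl: "isCont (ampl lam \<theta> n) t"
  using ampl_deriv has_vector_derivative_continuous by blast

lemma continuous_on_ampl: "continuous_on S (ampl lam \<theta> n)"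
  by (simp add: continuous_at_imp_continuous_on continuous_ampl)

lemma ampl_measurable [measurable]: "ampl lam \<theta> n \<in> borel_measurable borel"
  by (intro borel_measurable_continuous_onI continuous_on_ampl)

section \<open>Finite propagation and the bound on the total mass\<close>

definition ampl_tail :: "real \<Rightarrow> real \<Rightarrow> real \<Rightarrow> nat \<Rightarrow> real" where
  "ampl_tail lam \<theta> T m = (\<Sum>k. (hnorm lam \<theta> * T) ^ (k + m) /\<^sub>R fact (k + m))"

lemma ampl_tail_limit: "ampl_tail lam \<theta> T \<longlonglongrightarrow> 0"
proof -
  let ?f = "\<lambda>k. (hnorm lam \<theta> * T) ^ k /\<^sub>R fact k"
  have s: "summable ?f" by (rule summable_exp_generic)
  have "(\<lambda>m. suminf ?f - sum ?f {..<m}) \<longlonglongrightarrow> suminf ?f - suminf ?f"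
    by (intro tendsto_intros summable_LIMSEQ s)
  moreover have "suminf ?f - sum ?f {..<m} = ampl_tail lam \<theta> T m" for m
    unfolding ampl_tail_def using suminf_minus_initial_segment[OF s, of m] by simp
  ultimately show ?thesis by simp
qed

text \<open>Each power of the Hamiltonian moves by at most one site, so the Taylor coefficients of
  order below |n| vanish. What is left is bounded by a remainder of the exponential series,
  uniformly for times up to \<open>T\<close>.\<close>

lemma ampl_le_tail:
  assumes "\<bar>t\<bar> \<le> T" "int m \<le> \<bar>n\<bar>"
  shows "cmod (ampl lam \<theta> n t) \<le> ampl_tail lam \<theta> T m"
proof -
  let ?f = "\<lambda>k. taylor lam \<theta> n k * of_real t ^ k"
  let ?g = "\<lambda>k. (hnorm lam \<theta> * T) ^ k /\<^sub>R fact k"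
  have sg: "summable (\<lambda>k. ?g (k + m))"
    by (rule summable_ignore_initial_segment[OF summable_exp_generic])
  have "sum ?f {..<m} = 0"
  proof (intro sum.neutral ballI)
    fix k assume "k \<in> {..<m}"
    then have "int k < \<bar>n\<bar>" using assms by auto
    then show "?f k = 0" by (simp add: taylor_def moment_support)
  qed
  then have "ampl lam \<theta> n t = (\<Sum>k. ?f (k + m))"
    unfolding ampl_taylor using suminf_split_initial_segment[OF summable_taylor, of lam \<theta> n "of_real t" m] by simp
  moreover have le: "cmod (?f (k + m)) \<le> ?g (k + m)" for k
  proof -
    have "cmod (?f (k + m)) \<le> (hnorm lam \<theta> * \<bar>t\<bar>) ^ (k + m) /\<^sub>R fact (k + m)"
      using norm_taylor[of lam \<theta> n "k + m" "of_real t"] by simp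
    also have "\<dots> \<le> ?g (k + m)"
      using assms(1) onorm_pos_le[OF bounded_linear_fib_hamiltonian, of lam \<theta>]
      by (intro scaleR_left_mono power_mono mult_left_mono mult_nonneg_nonneg) auto
    finally show ?thesis .
  qed
  moreover have "cmod (\<Sum>k. ?f (k + m)) \<le> (\<Sum>k. cmod (?f (k + m)))"
    by (rule summable_norm, rule summable_comparison_test'[OF sg, of 0]) (use le in simp)
  moreover have "(\<Sum>k. cmod (?f (k + m))) \<le> (\<Sum>k. ?g (k + m))"
    by (intro suminf_le le sg summable_comparison_test'[OF sg, of 0]) (use le in simp)
  ultimately show ?thesis by (simp add: ampl_tail_def)
qed

lemma ampl_tendsto_0: "(\<lambda>m. ampl lam \<theta> (int m) t) \<longlonglongrightarrow> 0" "(\<lambda>m. ampl lam \<theta> (- int m) t) \<longlonglongrightarrow> 0"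
  by (rule tendsto_norm_zero_cancel, rule tendsto_sandwich[OF _ _ tendsto_const ampl_tail_limit[of lam \<theta> "\<bar>t\<bar>"]],
      auto intro!: always_eventually ampl_le_tail)+

text \<open>The potential is real and drops out; the currents inside the window telescope.\<close>

lemma ampl_mass_deriv:
  "((\<lambda>t. \<Sum>n\<in>{- int l..int l}. (cmod (ampl lam \<theta> n t))\<^sup>2) has_real_derivative
     2 * Im (cnj (ampl lam \<theta> (int l) t) * ampl lam \<theta> (int l + 1) t)
     - 2 * Im (cnj (ampl lam \<theta> (- int l - 1) t) * ampl lam \<theta> (- int l) t)) (at t)"
proof -
  let ?f = "\<lambda>n. ampl lam \<theta> n t"
  let ?J = "\<lambda>n. 2 * Im (cnj (?f n) * ?f (n + 1))"
  let ?d = "\<lambda>n. - \<i> * (?f (n + 1) + ?f (n - 1) + of_real (fib_potential lam \<theta> n) * ?f n)"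
  have single: "((\<lambda>t. (cmod (ampl lam \<theta> n t))\<^sup>2) has_real_derivative ?J n - ?J (n - 1)) (at t)" for n
  proof -
    have "((\<lambda>t. ampl lam \<theta> n t * cnj (ampl lam \<theta> n t)) has_vector_derivative
       (ampl lam \<theta> n t * cnj (?d n) + ?d n * cnj (ampl lam \<theta> n t))) (at t)"
      by (intro has_vector_derivative_mult ampl_deriv has_vector_derivative_cnj)
    then have "((\<lambda>t. Re (ampl lam \<theta> n t * cnj (ampl lam \<theta> n t))) has_vector_derivative
       Re (ampl lam \<theta> n t * cnj (?d n) + ?d n * cnj (ampl lam \<theta> n t))) (at t)"
      by (rule bounded_linear.has_vector_derivative[OF bounded_linear_Re])
    moreover have "Re (ampl lam \<theta> n s * cnj (ampl lam \<theta> n s)) = (cmod (ampl lam \<theta> n s))\<^sup>2" for s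
      by (simp add: complex_norm_square[symmetric])
    moreover have "Re (ampl lam \<theta> n t * cnj (?d n) + ?d n * cnj (ampl lam \<theta> n t)) = ?J n - ?J (n - 1)"
      by (simp add: algebra_simps)
    ultimately show ?thesis by (simp add: has_real_derivative_iff_has_vector_derivative)
  qed
  have tel: "(\<Sum>n\<in>{- int l..int l}. J n - J (n - 1)) = J (int l) - J (- int l - 1)" for J :: "int \<Rightarrow> real"
  proof (induction l)
    case (Suc l)
    have "{- int (Suc l)..int (Suc l)} = insert (int (Suc l)) (insert (- int (Suc l)) {- int l..int l})"
      by auto
    then have "(\<Sum>n\<in>{- int (Suc l)..int (Suc l)}. J n - J (n - 1)) =
       J (int (Suc l)) - J (int (Suc l) - 1) + (J (- int (Suc l)) - J (- int (Suc l) - 1)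
       + (\<Sum>n\<in>{- int l..int l}. J n - J (n - 1)))" by simp
    moreover have "int (Suc l) - 1 = int l" "- int (Suc l) = - int l - 1" by simp_all
    ultimately show ?case using Suc by (simp only:)
  qed simp
  have "((\<lambda>t. \<Sum>n\<in>{- int l..int l}. (cmod (ampl lam \<theta> n t))\<^sup>2) has_real_derivative
      (\<Sum>n\<in>{- int l..int l}. ?J n - ?J (n - 1))) (at t)"
    by (intro DERIV_sum single)
  then show ?thesis unfolding tel[of ?J] by simp
qed

text \<open>Takes the place of unitarity: the mass in a window is 1 at time 0, and the flux through
  its boundary tends to 0 as the window grows.\<close>

lemma ampl_mass_le:
  assumes F: "finite F" and t: "t \<ge> 0"
  shows "(\<Sum>n\<in>F. (cmod (ampl lam \<theta> n t))\<^sup>2) \<le> 1"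
proof -
  let ?S = "\<lambda>l t. \<Sum>n\<in>{- int l..int l}. (cmod (ampl lam \<theta> n t))\<^sup>2"
  let ?r = "ampl_tail lam \<theta> t"
  let ?B = "\<lambda>l. 4 * (?r l * ?r l)"
  have r0: "?r l \<ge> 0" for l
    using ampl_le_tail[of 0 t l "int l" lam \<theta>] t by (simp add: order_trans[OF norm_ge_zero])
  have S: "?S l t \<le> 1 + t * ?B l" for l
  proof -
    let ?d = "\<lambda>s. 2 * Im (cnj (ampl lam \<theta> (int l) s) * ampl lam \<theta> (int l + 1) s)
     - 2 * Im (cnj (ampl lam \<theta> (- int l - 1) s) * ampl lam \<theta> (- int l) s)"
    have d: "\<bar>?d s\<bar> \<le> ?B l" if "0 \<le> s" "s \<le> t" for s
    proof -
      have *: "\<bar>Im (cnj (ampl lam \<theta> n s) * ampl lam \<theta> m s)\<bar> \<le> ?r l * ?r l" if "int l \<le> \<bar>n\<bar>" "int l \<le> \<bar>m\<bar>" for n m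
      proof -
        have "\<bar>Im (cnj (ampl lam \<theta> n s) * ampl lam \<theta> m s)\<bar> \<le> cmod (ampl lam \<theta> n s) * cmod (ampl lam \<theta> m s)"
          using abs_Im_le_cmod[of "cnj (ampl lam \<theta> n s) * ampl lam \<theta> m s"] by (simp add: norm_mult)
        also have "\<dots> \<le> ?r l * ?r l"
          using that \<open>0 \<le> s\<close> \<open>s \<le> t\<close> r0 by (intro mult_mono ampl_le_tail) auto
        finally show ?thesis .
      qed
      show ?thesis using *[of "int l" "int l + 1"] *[of "- int l - 1" "- int l"] by linarith
    qed
    have "?S l t \<le> ?S l 0 + t * ?B l"
    proof (cases "t = 0")
      case False
      then have "0 < t" using t by simp
      then obtain s where s: "0 < s" "s < t" "?S l t - ?S l 0 = (t - 0) * ?d s"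
        using MVT2[of 0 t "?S l" ?d] ampl_mass_deriv by blast
      have "t * ?d s \<le> t * ?B l" using d[of s] s(1,2) t by (intro mult_left_mono) linarith+
      then show ?thesis using s(3)[unfolded diff_zero] by linarith
    qed simp
    moreover have "?S l 0 = 1"
    proof -
      have "?S l 0 = (\<Sum>n\<in>{- int l..int l}. if n = 0 then 1 else 0)"
        by (intro sum.cong) (auto simp: ampl_0)
      then show ?thesis by simp
    qed
    ultimately show ?thesis by simp
  qed
  obtain N where N: "\<And>n. n \<in> F \<Longrightarrow> \<bar>n\<bar> \<le> int N"
  proof
    show "\<bar>n\<bar> \<le> int (nat (Max (insert 0 (abs ` F))))" if "n \<in> F" for n
      using F that by auto
  qed
  show ?thesis
  proof (rule LIMSEQ_le_const)
    show "(\<lambda>l. 1 + t * ?B l) \<longlonglongrightarrow> 1"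
      using tendsto_add[OF tendsto_const[of 1] tendsto_mult[OF tendsto_const[of t] tendsto_mult[OF tendsto_const[of 4]
          tendsto_mult[OF ampl_tail_limit[of lam \<theta> t] ampl_tail_limit[of lam \<theta> t]]]]] by simp
    have "(\<Sum>n\<in>F. (cmod (ampl lam \<theta> n t))\<^sup>2) \<le> 1 + t * ?B l" if "l \<ge> N" for l
    proof -
      have "(\<Sum>n\<in>F. (cmod (ampl lam \<theta> n t))\<^sup>2) \<le> ?S l t"
        by (intro sum_mono2) (use N that in fastforce)+
      then show ?thesis using S[of l] by simp
    qed
    then show "\<exists>N. \<forall>l\<ge>N. (\<Sum>n\<in>F. (cmod (ampl lam \<theta> n t))\<^sup>2) \<le> 1 + t * ?B l" by blast
  qed
qed

lemma ampl_le_1: "t \<ge> 0 \<Longrightarrow> cmod (ampl lam \<theta> n t) \<le> 1"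
  using ampl_mass_le[of "{n}" t lam \<theta>] by (simp add: power2_le_imp_le[of _ 1, simplified] abs_square_le_1)

section \<open>The Laplace transform of the amplitudes\<close>

text \<open>For \<open>e = 1 / T\<close> the squared modulus carries exactly the weight exp (-2t/T)
  of the time average.\<close>

definition damped :: "real \<Rightarrow> real \<Rightarrow> real \<Rightarrow> int \<Rightarrow> real \<Rightarrow> complex" where
  "damped lam \<theta> e n t = of_real (indicator {0<..} t * exp (- e * t)) * ampl lam \<theta> n t"

lemma causal_damped: "e > 0 \<Longrightarrow> causal e (damped lam \<theta> e n)"
proof
  fix t :: real
  show "cmod (damped lam \<theta> e n t) \<le> indicator {0<..} t * exp (- e * t)"
    using ampl_le_1[of t lam \<theta> n] by (cases "t > 0") (auto simp: damped_def norm_mult)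
  show "damped lam \<theta> e n \<in> borel_measurable borel"
    unfolding damped_def[abs_def] by measurable
  assume t: "t > 0"
  have "isCont (\<lambda>t. of_real (exp (- e * t)) * ampl lam \<theta> n t) t"
    by (intro continuous_intros continuous_ampl)
  moreover have "\<forall>\<^sub>F s in nhds t. damped lam \<theta> e n s = of_real (exp (- e * s)) * ampl lam \<theta> n s"
    using eventually_nhds_in_open[of "{0<..}" t] t by (auto elim!: eventually_mono simp: damped_def)
  ultimately show "isCont (damped lam \<theta> e n) t" by (subst isCont_cong)
qed

definition laplace :: "real \<Rightarrow> real \<Rightarrow> complex \<Rightarrow> int \<Rightarrow> complex" where
  "laplace lam \<theta> z n = (LBINT t:{0<..}. exp (\<i> * z * of_real t) * ampl lam \<theta> n t)"

lemma laplace_ft: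
  assumes "e > 0"
  shows "laplace lam \<theta> (Complex E e) n = causal.ft (damped lam \<theta> e n) E"
proof -
  have "exp (\<i> * Complex E e * of_real t) = iexp (E * t) * of_real (exp (- e * t))" for t
  proof -
    have "\<i> * Complex E e * of_real t = \<i> * of_real (E * t) + of_real (- e * t)"
      by (simp add: complex_eq_iff)
    then show ?thesis by (simp only: exp_add exp_of_real)
  qed
  then show ?thesis
    unfolding laplace_def causal.ft_def[OF causal_damped[OF assms]] set_lebesgue_integral_def damped_def
    by (intro Bochner_Integration.integral_cong) (auto simp: scaleR_conv_of_real)
qed

lemma laplace_integrable:
  assumes "Im z > 0"
  shows "set_integrable lborel {0<..} (\<lambda>t. exp (\<i> * z * of_real t) * ampl lam \<theta> n t)"
  unfolding set_integrable_def
proof (rule Bochner_Integration.integrable_bound[OF integrable_indicator_exp[OF assms]])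
  have "norm (indicator {0<..} t *\<^sub>R (exp (\<i> * z * of_real t) * ampl lam \<theta> n t)) \<le> indicator {0<..} t * exp (- Im z * t)" for t
    using ampl_le_1[of t lam \<theta> n] by (cases "t > 0") (auto simp: norm_mult)
  then show "AE t in lborel. norm (indicator {0<..} t *\<^sub>R (exp (\<i> * z * of_real t) * ampl lam \<theta> n t))
       \<le> norm (indicator {0<..} t * exp (- Im z * t))"
    by (intro AE_I2) (simp add: abs_mult)
qed measurable

text \<open>The transform is \<open>- \<i>\<close> times the resolvent applied to \<open>delta 0\<close>.\<close>

lemma laplace_equation:
  assumes z: "Im z > 0"
  shows "laplace lam \<theta> z (n + 1) + laplace lam \<theta> z (n - 1) + (of_real (fib_potential lam \<theta> n) - z) * laplace lam \<theta> z n
     = (if n = 0 then - \<i> else 0)"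
proof -
  let ?e = "\<lambda>t. exp (\<i> * z * complex_of_real t)"
  let ?a = "\<lambda>n t. ampl lam \<theta> n t"
  let ?v = "complex_of_real (fib_potential lam \<theta> n)"
  let ?F = "\<lambda>t. ?e t * ?a n t"
  let ?F' = "\<lambda>t. \<i> * z * (?e t * ?a n t) + (- \<i> * (?e t * ?a (n + 1) t) + - \<i> * (?e t * ?a (n - 1) t) + - \<i> * ?v * (?e t * ?a n t))"
  note I = laplace_integrable[OF z, of lam \<theta>]
  have int: "set_integrable lborel {0<..} ?F'"
    by (intro set_integral_add set_integrable_mult_right I)
  \<comment> \<open>Integrating the derivative of \<open>?F\<close> leaves only the boundary term at
    0, the initial state: at infinity \<open>?F\<close> decays because
    \<open>Im z > 0\<close>.\<close>
  have "(LBINT t=0..\<infinity>. ?F' t) = 0 - ?a n 0"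
  proof (rule interval_integral_FTC_integrable)
    have e': "(?e has_vector_derivative \<i> * z * ?e t) (at t)" for t
    proof -
      have "((\<lambda>w. exp (\<i> * z * w)) has_field_derivative \<i> * z * exp (\<i> * z * of_real t)) (at (of_real t))"
        by (auto intro!: derivative_eq_intros)
      then show ?thesis by (rule has_vector_derivative_real_field)
    qed
    show "(?F has_vector_derivative ?F' t) (at t)" for t
    proof -
      have "(?F has_vector_derivative (?e t * (- \<i> * (?a (n + 1) t + ?a (n - 1) t + ?v * ?a n t)) + \<i> * z * ?e t * ?a n t)) (at t)"
        by (rule has_vector_derivative_mult[OF e' ampl_deriv])
      then show ?thesis by (simp add: algebra_simps)
    qed
    show "isCont ?F' t" for t
      by (intro continuous_intros continuous_ampl)
    show "set_integrable lborel (einterval 0 \<infinity>) ?F'"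
      using int by (simp add: zero_ereal_def)
    have "isCont ?F 0" by (intro continuous_intros continuous_ampl)
    then have "(?F \<longlongrightarrow> ?F 0) (at_right 0)" by (simp add: continuous_at filterlim_at_split)
    then show "((?F \<circ> real_of_ereal) \<longlongrightarrow> ?a n 0) (at_right 0)"
      unfolding zero_ereal_def by (subst ereal_tendsto_simps) simp
    have "(?F \<longlongrightarrow> 0) at_top"
    proof (rule Lim_null_comparison)
      show "\<forall>\<^sub>F t in at_top. norm (?F t) \<le> exp (- Im z * t)"
        using eventually_ge_at_top[of 0]
        by eventually_elim (use ampl_le_1 in \<open>auto simp: norm_mult\<close>)
      show "((\<lambda>t. exp (- Im z * t)) \<longlongrightarrow> 0) at_top"
        using z by (intro filterlim_compose[OF exp_at_bot] filterlim_tendsto_neg_mult_at_bot[OF tendsto_const _ filterlim_ident]) auto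
    qed
    then show "((?F \<circ> real_of_ereal) \<longlongrightarrow> 0) (at_left \<infinity>)"
      by (subst ereal_tendsto_simps)
  qed simp
  moreover have "(LBINT t=0..\<infinity>. ?F' t) = (LBINT t:{0<..}. ?F' t)"
    unfolding zero_ereal_def by (rule interval_integral_to_infinity_eq)
  moreover have "(LBINT t:{0<..}. ?F' t) = \<i> * z * laplace lam \<theta> z n +
     (- \<i> * laplace lam \<theta> z (n + 1) + - \<i> * laplace lam \<theta> z (n - 1) + - \<i> * ?v * laplace lam \<theta> z n)"
  proof -
    have J: "set_integrable lborel {0<..} (\<lambda>t. c * (?e t * ?a m t))" for c m
      by (intro set_integrable_mult_right I)
    have "(LBINT t:{0<..}. c * (?e t * ?a m t)) = c * laplace lam \<theta> z m" for c m
      by (simp add: laplace_def)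
    then show ?thesis
      by (simp only: set_integral_add(2)[OF J set_integral_add(1)[OF set_integral_add(1)[OF J J] J]]
          set_integral_add(2)[OF set_integral_add(1)[OF J J] J] set_integral_add(2)[OF J J])
  qed
  ultimately have eq: "\<i> * z * laplace lam \<theta> z n +
     (- \<i> * laplace lam \<theta> z (n + 1) + - \<i> * laplace lam \<theta> z (n - 1) + - \<i> * ?v * laplace lam \<theta> z n) = - ?a n 0"
    by simp
  have "laplace lam \<theta> z (n + 1) + laplace lam \<theta> z (n - 1) + (?v - z) * laplace lam \<theta> z n = \<i> * (\<i> * z * laplace lam \<theta> z n +
     (- \<i> * laplace lam \<theta> z (n + 1) + - \<i> * laplace lam \<theta> z (n - 1) + - \<i> * ?v * laplace lam \<theta> z n))"
    by (simp add: algebra_simps)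
  then show ?thesis unfolding eq by (simp add: ampl_0)
qed

text \<open>Supplies the behaviour at infinity that the half-line estimates start from.\<close>

lemma laplace_tendsto_0:
  assumes z: "Im z > 0"
  shows "(\<lambda>m. laplace lam \<theta> z (int m)) \<longlonglongrightarrow> 0" "(\<lambda>m. laplace lam \<theta> z (- int m)) \<longlonglongrightarrow> 0"
proof -
  let ?g = "\<lambda>n t. indicator {0<..} t *\<^sub>R (exp (\<i> * z * of_real t) * ampl lam \<theta> n t)"
  have "(\<lambda>m. laplace lam \<theta> z (s m)) \<longlonglongrightarrow> integral\<^sup>L lborel (\<lambda>t::real. 0 :: complex)"
    if s: "\<And>t. (\<lambda>m. ampl lam \<theta> (s m) t) \<longlonglongrightarrow> 0" for s :: "nat \<Rightarrow> int"
    unfolding laplace_def set_lebesgue_integral_def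
  proof (rule integral_dominated_convergence[where w = "\<lambda>t. indicator {0<..} t * exp (- Im z * t)"])
    show "AE t in lborel. (\<lambda>m. ?g (s m) t) \<longlonglongrightarrow> 0"
    proof (rule AE_I2)
      fix t :: real
      have "(\<lambda>m. ?g (s m) t) \<longlonglongrightarrow> indicator {0<..} t *\<^sub>R (exp (\<i> * z * of_real t) * 0)"
        by (intro tendsto_intros s)
      then show "(\<lambda>m. ?g (s m) t) \<longlonglongrightarrow> 0" by simp
    qed
    show "AE t in lborel. norm (?g (s m) t) \<le> indicator {0<..} t * exp (- Im z * t)" for m
    proof (rule AE_I2)
      fix t :: real
      show "norm (?g (s m) t) \<le> indicator {0<..} t * exp (- Im z * t)"
        using ampl_le_1[of t lam \<theta> "s m"] by (cases "t > 0") (auto simp: norm_mult)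
    qed
    show "integrable lborel (\<lambda>t. indicator {0<..} t * exp (- Im z * t))" by (rule integrable_indicator_exp[OF z])
  qed measurable
  from this[of int] this[of "\<lambda>m. - int m"]
  show "(\<lambda>m. laplace lam \<theta> z (int m)) \<longlonglongrightarrow> 0" "(\<lambda>m. laplace lam \<theta> z (- int m)) \<longlonglongrightarrow> 0"
    using ampl_tendsto_0 by auto
qed

section \<open>Outside probabilities and their time averages\<close>

definition site_prob :: "real \<Rightarrow> real \<Rightarrow> int \<Rightarrow> real \<Rightarrow> real" where
  "site_prob lam \<theta> n t = (cmod (ampl lam \<theta> n t))\<^sup>2"

lemma site_prob_nonneg: "0 \<le> site_prob lam \<theta> n t"
  by (simp add: site_prob_def)

lemma site_prob_measurable [measurable]: "site_prob lam \<theta> n \<in> borel_measurable borel"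
  unfolding site_prob_def[abs_def] by measurable

lemma outside_prob_eq:
  "outside_prob (fib_hamiltonian lam \<theta>) N t =
     (\<Sum>\<^sub>\<infinity>n\<in>{n::int. real_of_int n \<ge> N}. site_prob lam \<theta> n t) + (\<Sum>\<^sub>\<infinity>n\<in>{n::int. real_of_int n \<le> - N}. site_prob lam \<theta> n t)"
  by (simp add: outside_prob_def cinner_delta site_prob_def ampl_def)

lemma site_prob_summable:
  assumes "t \<ge> 0"
  shows "(\<lambda>n. site_prob lam \<theta> n t) summable_on A"
proof (rule nonneg_bdd_above_summable_on)
  show "bdd_above (sum (\<lambda>n. site_prob lam \<theta> n t) ` {F. F \<subseteq> A \<and> finite F})"
    using ampl_mass_le[OF _ assms] by (auto intro!: bdd_aboveI[where M = 1] simp: site_prob_def)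
qed (simp add: site_prob_nonneg)

text \<open>Turns an unordered sum into a limit along a sequence, the form in which dominated
  convergence applies.\<close>

lemma infsum_int_limit:
  fixes f :: "int \<Rightarrow> real"
  assumes "f summable_on A"
  shows "(\<lambda>l. sum f (A \<inter> {- int l..int l})) \<longlonglongrightarrow> infsum f A"
proof -
  have "filterlim (\<lambda>l. A \<inter> {- int l..int l}) (finite_subsets_at_top A) sequentially"
    unfolding filterlim_finite_subsets_at_top
  proof (intro allI impI)
    fix X assume X: "finite X \<and> X \<subseteq> A"
    define q where "q = nat (Max (insert 0 (abs ` X)))"
    have m: "\<bar>n\<bar> \<le> int q" if "n \<in> X" for n
      using X that by (auto simp: q_def)
    have "X \<subseteq> A \<inter> {- int l..int l}" if "l \<ge> q" for l
    proof
      fix n assume "n \<in> X"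
      then show "n \<in> A \<inter> {- int l..int l}" using X m[of n] that by auto
    qed
    then show "\<forall>\<^sub>F l in sequentially. finite (A \<inter> {- int l..int l}) \<and> X \<subseteq> A \<inter> {- int l..int l} \<and> A \<inter> {- int l..int l} \<subseteq> A"
      by (auto simp: eventually_sequentially intro!: exI[of _ q])
  qed
  moreover have "(sum f \<longlongrightarrow> infsum f A) (finite_subsets_at_top A)"
    using has_sum_infsum[OF assms] by (simp add: has_sum_def)
  ultimately show ?thesis by (rule filterlim_compose[rotated])
qed

section \<open>Weighted time integrals\<close>

definition weight :: "real \<Rightarrow> real \<Rightarrow> real" where
  "weight T t = indicator {0<..} t * exp (- 2 * t / T)"

lemma weight_nonneg: "0 \<le> weight T t"
  by (simp add: weight_def)

lemma weight_measurable [measurable]: "weight T \<in> borel_measurable borel"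
  unfolding weight_def[abs_def] by measurable

lemma weight_integrable: "T > 0 \<Longrightarrow> integrable lborel (weight T)"
  using integrable_indicator_exp[of "2 / T"] by (simp add: weight_def[abs_def])

lemma weight_integral: "T > 0 \<Longrightarrow> (\<integral>t. weight T t \<partial>lborel) = T / 2"
  using LBINT_I0i_exp_mscale[of "2 / T"]
  by (simp add: interval_lebesgue_integral_0_infty set_lebesgue_integral_def weight_def[abs_def] mult.commute)

abbreviation "region_prob lam \<theta> A t \<equiv> (\<Sum>\<^sub>\<infinity>n\<in>A. site_prob lam \<theta> n t)"

lemma weight_infsum:
  assumes T: "T > 0"
  shows "integrable lborel (\<lambda>t. weight T t * region_prob lam \<theta> A t)"
    and "(\<lambda>l. \<integral>t. weight T t * (\<Sum>n\<in>A \<inter> {- int l..int l}. site_prob lam \<theta> n t) \<partial>lborel)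
      \<longlonglongrightarrow> (\<integral>t. weight T t * region_prob lam \<theta> A t \<partial>lborel)"
proof -
  let ?s = "\<lambda>l t. weight T t * (\<Sum>n\<in>A \<inter> {- int l..int l}. site_prob lam \<theta> n t)"
  let ?f = "\<lambda>t. weight T t * region_prob lam \<theta> A t"
  have lim: "(\<lambda>l. ?s l t) \<longlonglongrightarrow> ?f t" for t
  proof (cases "t > 0")
    case True
    then show ?thesis by (intro tendsto_intros infsum_int_limit site_prob_summable) simp
  qed (simp add: weight_def)
  have s: "?s l \<in> borel_measurable lborel" for l by measurable
  have f: "?f \<in> borel_measurable lborel" by (rule borel_measurable_LIMSEQ_real[OF lim s])
  have bd: "norm (?s l t) \<le> weight T t" for l t
  proof (cases "t > 0")
    case True
    have "(\<Sum>n\<in>A \<inter> {- int l..int l}. site_prob lam \<theta> n t) \<le> 1"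
      unfolding site_prob_def by (rule ampl_mass_le) (use True in auto)
    then show ?thesis
      using mult_left_mono[OF _ weight_nonneg, of _ 1 T t]
      by (simp add: abs_mult weight_nonneg sum_nonneg site_prob_nonneg)
  qed (simp add: weight_def)
  show "integrable lborel ?f"
    by (rule integrable_dominated_convergence[where s = ?s and w = "weight T"])
      (use lim s f bd weight_integrable[OF T] in auto)
  show "(\<lambda>l. integral\<^sup>L lborel (?s l)) \<longlonglongrightarrow> integral\<^sup>L lborel ?f"
    by (rule integral_dominated_convergence[where w = "weight T"])
      (use lim s f bd weight_integrable[OF T] in auto)
qed

text \<open>The prefactor 2 / T is left out, which makes this the \<open>energy\<close> of the
  damped amplitude.\<close>

definition mean_prob :: "real \<Rightarrow> real \<Rightarrow> int \<Rightarrow> real \<Rightarrow> real" where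
  "mean_prob lam \<theta> n T = (\<integral>t. weight T t * site_prob lam \<theta> n t \<partial>lborel)"

lemma integrable_mean_prob: "T > 0 \<Longrightarrow> integrable lborel (\<lambda>t. weight T t * site_prob lam \<theta> n t)"
  using weight_infsum(1)[where A = "{n}"] by simp

lemma time_average_outside:
  assumes T: "T > 0"
  shows "time_average (outside_prob (fib_hamiltonian lam \<theta>) N) T = 2 / T *
    ((\<integral>t. weight T t * region_prob lam \<theta> {n. real_of_int n \<ge> N} t \<partial>lborel) +
     (\<integral>t. weight T t * region_prob lam \<theta> {n. real_of_int n \<le> - N} t \<partial>lborel))"
proof -
  have "time_average (outside_prob (fib_hamiltonian lam \<theta>) N) T = 2 / T *
     (\<integral>t. weight T t * region_prob lam \<theta> {n. real_of_int n \<ge> N} t +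
       weight T t * region_prob lam \<theta> {n. real_of_int n \<le> - N} t \<partial>lborel)"
    unfolding time_average_def set_lebesgue_integral_def outside_prob_eq weight_def
    by (simp add: algebra_simps)
  then show ?thesis by (simp add: weight_infsum[OF T])
qed

lemma mean_prob_le_time_average:
  assumes T: "T > 0" and n: "real_of_int n \<ge> N \<or> real_of_int n \<le> - N"
  shows "2 / T * mean_prob lam \<theta> n T \<le> time_average (outside_prob (fib_hamiltonian lam \<theta>) N) T"
proof -
  let ?I = "\<lambda>A. \<integral>t. weight T t * region_prob lam \<theta> A t \<partial>lborel"
  have nonneg: "?I A \<ge> 0" for A
    by (intro Bochner_Integration.integral_nonneg mult_nonneg_nonneg weight_nonneg infsum_nonneg site_prob_nonneg)
  have le: "mean_prob lam \<theta> n T \<le> ?I A" if "n \<in> A" for A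
    unfolding mean_prob_def
  proof (rule integral_mono[OF integrable_mean_prob[OF T] weight_infsum(1)[OF T]])
    fix t :: real
    show "weight T t * site_prob lam \<theta> n t \<le> weight T t * region_prob lam \<theta> A t"
    proof (cases "t > 0")
      case True
      have "(\<Sum>n\<in>{n}. site_prob lam \<theta> n t) \<le> region_prob lam \<theta> A t"
        using True that by (intro finite_sum_le_infsum site_prob_summable site_prob_nonneg) auto
      then show ?thesis by (intro mult_left_mono weight_nonneg) simp
    qed (simp add: weight_def)
  qed
  have "mean_prob lam \<theta> n T \<le> ?I {n. real_of_int n \<ge> N} + ?I {n. real_of_int n \<le> - N}"
    using n le[of "{n. real_of_int n \<ge> N}"] le[of "{n. real_of_int n \<le> - N}"] nonneg[of "{n. real_of_int n \<ge> N}"]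
      nonneg[of "{n. real_of_int n \<le> - N}"] by auto
  then show ?thesis unfolding time_average_outside[OF T] using T by (intro mult_left_mono) auto
qed

lemma time_average_le:
  assumes T: "T > 0"
    and le: "\<And>F. finite F \<Longrightarrow> F \<subseteq> {n. real_of_int n \<ge> N} \<Longrightarrow> (\<Sum>n\<in>F. mean_prob lam \<theta> n T) \<le> c"
      "\<And>F. finite F \<Longrightarrow> F \<subseteq> {n. real_of_int n \<le> - N} \<Longrightarrow> (\<Sum>n\<in>F. mean_prob lam \<theta> n T) \<le> c"
  shows "time_average (outside_prob (fib_hamiltonian lam \<theta>) N) T \<le> 4 * c / T"
proof -
  let ?I = "\<lambda>A. \<integral>t. weight T t * region_prob lam \<theta> A t \<partial>lborel"
  have "?I A \<le> c" if A: "\<And>F. finite F \<Longrightarrow> F \<subseteq> A \<Longrightarrow> (\<Sum>n\<in>F. mean_prob lam \<theta> n T) \<le> c" for A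
  proof (rule LIMSEQ_le_const2[OF weight_infsum(2)[OF T]])
    have "(\<integral>t. weight T t * (\<Sum>n\<in>A \<inter> {- int l..int l}. site_prob lam \<theta> n t) \<partial>lborel) \<le> c" for l
    proof -
      have "(\<integral>t. weight T t * (\<Sum>n\<in>A \<inter> {- int l..int l}. site_prob lam \<theta> n t) \<partial>lborel) = (\<Sum>n\<in>A \<inter> {- int l..int l}. mean_prob lam \<theta> n T)"
        unfolding mean_prob_def sum_distrib_left
        by (rule Bochner_Integration.integral_sum) (rule integrable_mean_prob[OF T])
      then show ?thesis using A[of "A \<inter> {- int l..int l}"] by simp
    qed
    then show "\<exists>N. \<forall>l\<ge>N. (\<integral>t. weight T t * (\<Sum>n\<in>A \<inter> {- int l..int l}. site_prob lam \<theta> n t) \<partial>lborel) \<le> c" by blast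
  qed
  then have "?I {n. real_of_int n \<ge> N} + ?I {n. real_of_int n \<le> - N} \<le> c + c"
    using le by (intro add_mono) auto
  then have "2 / T * (?I {n. real_of_int n \<ge> N} + ?I {n. real_of_int n \<le> - N}) \<le> 2 / T * (c + c)"
    using T by (intro mult_left_mono) auto
  then show ?thesis unfolding time_average_outside[OF T] by simp
qed

lemma mean_prob_sum_le:
  assumes T: "T > 0" and W: "finite W"
  shows "(\<Sum>n\<in>W. mean_prob lam \<theta> n T) \<le> T / 2"
proof -
  have "(\<Sum>n\<in>W. mean_prob lam \<theta> n T) = (\<integral>t. (\<Sum>n\<in>W. weight T t * site_prob lam \<theta> n t) \<partial>lborel)"
    unfolding mean_prob_def
    by (rule Bochner_Integration.integral_sum[symmetric]) (rule integrable_mean_prob[OF T])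
  also have "\<dots> \<le> (\<integral>t. weight T t \<partial>lborel)"
  proof (rule integral_mono[OF _ weight_integrable[OF T]])
    show "integrable lborel (\<lambda>t. \<Sum>n\<in>W. weight T t * site_prob lam \<theta> n t)"
      by (intro Bochner_Integration.integrable_sum integrable_mean_prob[OF T])
    fix t :: real
    show "(\<Sum>n\<in>W. weight T t * site_prob lam \<theta> n t) \<le> weight T t"
    proof (cases "t > 0")
      case True
      have "(\<Sum>n\<in>W. site_prob lam \<theta> n t) \<le> 1"
        unfolding site_prob_def by (rule ampl_mass_le[OF W]) (use True in auto)
      from mult_left_mono[OF this weight_nonneg] show ?thesis by (simp add: sum_distrib_left)
    qed (simp add: weight_def)
  qed
  finally show ?thesis by (simp add: weight_integral[OF T])
qed

text \<open>Cauchy-Schwarz for the measure with density \<open>weight T\<close>: the integral of the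
  squared distance of the modulus from its mean \<open>m\<close> is nonnegative.\<close>

lemma laplace_le_mean_prob:
  assumes T: "T > 0"
  shows "(cmod (laplace lam \<theta> (Complex E (2 / T)) n))\<^sup>2 \<le> T / 2 * mean_prob lam \<theta> n T"
proof -
  let ?a = "\<lambda>t. cmod (ampl lam \<theta> n t)"
  define I where "I = (\<integral>t. weight T t * ?a t \<partial>lborel)"
  define m where "m = 2 / T * I"
  have i1: "integrable lborel (\<lambda>t. weight T t * ?a t)"
  proof (rule Bochner_Integration.integrable_bound[OF weight_integrable[OF T]])
    have "norm (weight T t * ?a t) \<le> norm (weight T t)" for t
      using ampl_le_1[of t lam \<theta> n] weight_nonneg[of T t]
      by (cases "t > 0") (auto simp: abs_mult mult_left_le weight_def)
    then show "AE t in lborel. norm (weight T t * ?a t) \<le> norm (weight T t)" by (intro AE_I2)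
  qed measurable
  have i2: "integrable lborel (\<lambda>t. weight T t * (?a t)\<^sup>2)"
    using integrable_mean_prob[OF T] by (simp add: site_prob_def)
  have "0 \<le> (\<integral>t. weight T t * (?a t - m)\<^sup>2 \<partial>lborel)"
    by (intro Bochner_Integration.integral_nonneg mult_nonneg_nonneg weight_nonneg) auto
  also have "\<dots> = (\<integral>t. weight T t * (?a t)\<^sup>2 - 2 * m * (weight T t * ?a t) + m\<^sup>2 * weight T t \<partial>lborel)"
    by (intro Bochner_Integration.integral_cong) (auto simp: power2_diff algebra_simps)
  also have "\<dots> = mean_prob lam \<theta> n T - 2 * m * I + m\<^sup>2 * (T / 2)"
    using i1 i2 weight_integrable[OF T] by (simp add: mean_prob_def site_prob_def I_def weight_integral[OF T])
  also have "\<dots> = mean_prob lam \<theta> n T - 2 / T * I\<^sup>2"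
    using T by (simp add: m_def power2_eq_square field_simps)
  finally have cs: "I\<^sup>2 \<le> T / 2 * mean_prob lam \<theta> n T"
    using T by (simp add: field_simps)
  have "cmod (laplace lam \<theta> (Complex E (2 / T)) n) \<le>
     (\<integral>t. cmod (indicator {0<..} t *\<^sub>R (exp (\<i> * Complex E (2 / T) * of_real t) * ampl lam \<theta> n t)) \<partial>lborel)"
    unfolding laplace_def set_lebesgue_integral_def by (rule integral_norm_bound)
  also have "\<dots> = I"
    unfolding I_def by (intro Bochner_Integration.integral_cong) (auto simp: norm_mult weight_def)
  finally have "(cmod (laplace lam \<theta> (Complex E (2 / T)) n))\<^sup>2 \<le> I\<^sup>2"
    by (intro power_mono) auto
  then show ?thesis using cs by simp
qed

lemma energy_damped:
  assumes T: "T > 0"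
  shows "causal.energy (damped lam \<theta> (1 / T) n) = mean_prob lam \<theta> n T"
proof -
  have "causal (1 / T) (damped lam \<theta> (1 / T) n)" using T by (intro causal_damped) simp
  then have "causal.energy (damped lam \<theta> (1 / T) n) = (\<integral>t. (cmod (damped lam \<theta> (1 / T) n t))\<^sup>2 \<partial>lborel)"
    by (rule causal.energy_def)
  also have "\<dots> = mean_prob lam \<theta> n T"
    unfolding mean_prob_def
  proof (intro Bochner_Integration.integral_cong refl)
    fix t :: real
    have "exp (- (1 / T) * t) * exp (- (1 / T) * t) = exp (- 2 * t / T)"
      by (simp add: exp_add[symmetric])
    then show "(cmod (damped lam \<theta> (1 / T) n t))\<^sup>2 = weight T t * site_prob lam \<theta> n t"
      by (simp add: damped_def weight_def site_prob_def norm_mult power_mult_distrib power2_eq_square indicator_def)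
  qed
  finally show ?thesis .
qed

section \<open>The two half-lines\<close>

definition fib_letter :: "real \<Rightarrow> int \<Rightarrow> bool" where
  "fib_letter \<theta> n \<longleftrightarrow> frac (real_of_int n * slope + \<theta>) \<ge> 1 - slope"

lemma fib_potential_letter: "fib_potential lam \<theta> n = (if fib_letter \<theta> n then lam else 0)"
  using frac_lt_1[of "real_of_int n * slope + \<theta>"]
  by (auto simp: fib_potential_def fib_letter_def slope_def indicator_def)

lemma frac_step:
  "frac (real_of_int (n + 1) * slope + \<theta>) = frac (real_of_int n * slope + \<theta>) + slope - of_bool (fib_letter \<theta> n)"
proof -
  let ?x = "real_of_int n * slope + \<theta>"
  have e: "real_of_int (n + 1) * slope + \<theta> = ?x + slope" by (simp add: algebra_simps)
  have f: "frac slope = slope" using slope_bounds by (simp add: frac_eq)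
  show ?thesis unfolding e frac_add f fib_letter_def by auto
qed

lemma coded_right: "coded (\<lambda>n. fib_letter \<theta> (int n + 1))"
  unfolding coded_def
proof (intro exI[of _ "\<lambda>n. frac (real_of_int (int n + 1) * slope + \<theta>)"] allI)
  fix n
  show "0 \<le> frac (real_of_int (int n + 1) * slope + \<theta>) \<and> frac (real_of_int (int n + 1) * slope + \<theta>) \<le> 1 \<and>
     frac (real_of_int (int (Suc n) + 1) * slope + \<theta>) =
     frac (real_of_int (int n + 1) * slope + \<theta>) + slope - of_bool (fib_letter \<theta> (int n + 1))"
    using frac_step[of "int n + 1" \<theta>] frac_lt_1[of "real_of_int (int n + 1) * slope + \<theta>"]
    by (simp add: add.commute)
qed

text \<open>Read leftward, the phase moves by \<open>- slope\<close>; the reflection restores the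
  direction. It takes the value 1 where the fractional part is 0, which the closed interval in
  \<open>coded\<close> allows.\<close>

lemma coded_left: "coded (\<lambda>n. fib_letter \<theta> (- int n - 1))"
  unfolding coded_def
proof (intro exI[of _ "\<lambda>n. 1 - frac (real_of_int (- int n) * slope + \<theta>)"] allI)
  fix n
  have e: "- int n - 1 + 1 = - int n" "- int (Suc n) = - int n - 1" by simp_all
  show "0 \<le> 1 - frac (real_of_int (- int n) * slope + \<theta>) \<and> 1 - frac (real_of_int (- int n) * slope + \<theta>) \<le> 1 \<and>
     1 - frac (real_of_int (- int (Suc n)) * slope + \<theta>) =
     1 - frac (real_of_int (- int n) * slope + \<theta>) + slope - of_bool (fib_letter \<theta> (- int n - 1))"
    using frac_step[of "- int n - 1" \<theta>] frac_lt_1[of "real_of_int (- int n) * slope + \<theta>"]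
      frac_ge_0[of "real_of_int (- int n) * slope + \<theta>"]
    unfolding e by linarith
qed

definition half_letters :: "real \<Rightarrow> int \<Rightarrow> nat \<Rightarrow> bool" where
  "half_letters \<theta> s n = fib_letter \<theta> (s * (int n + 1))"

lemma coded_half: "s \<in> {1, -1} \<Longrightarrow> coded (half_letters \<theta> s)"
  using coded_right[of \<theta>] coded_left[of \<theta>] by (auto simp: half_letters_def[abs_def])

lemma half_line_laplace:
  assumes z: "Im z > 0" and s: "s \<in> {1, -1}"
  shows "half_line lam z (half_letters \<theta> s) (\<lambda>n. laplace lam \<theta> z (s * int n))"
proof
  fix n
  have n: "s * (int n + 1) \<noteq> 0" using s by auto
  have e: "s * int (Suc (Suc n)) = s * (int n + 1) + s" "s * int (Suc n) = s * (int n + 1)" "s * int n = s * (int n + 1) - s"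
    by (simp_all add: algebra_simps)
  have "laplace lam \<theta> z (s * (int n + 1) + s) + laplace lam \<theta> z (s * (int n + 1) - s) +
     (of_real (fib_potential lam \<theta> (s * (int n + 1))) - z) * laplace lam \<theta> z (s * (int n + 1)) = 0"
    using laplace_equation[OF z, of lam \<theta> "s * (int n + 1)"] n s by (auto simp: add.commute)
  then show "laplace lam \<theta> z (s * int (Suc (Suc n))) = (z - (if half_letters \<theta> s n then of_real lam else 0)) *
      laplace lam \<theta> z (s * int (Suc n)) - laplace lam \<theta> z (s * int n)"
    unfolding e half_letters_def by (auto simp: fib_potential_letter algebra_simps split: if_splits)
qed

section \<open>Lower bound for the time averages\<close>

text \<open>With x = 2 lam + 15 bounding each site matrix, 2 + 2x + x^2 = (x + 1)^2 + 1 is at most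
  (x + 2)^2.\<close>

definition site_const :: "real \<Rightarrow> real" where
  "site_const lam = (2 * lam + 17)\<^sup>2"

lemma site_mat_norm:
  assumes "cmod z \<le> lam + 13" "lam \<ge> 0"
  shows "2 + mnorm (site_mat (of_real lam) z False) + mnorm (site_mat (of_real lam) z True) +
    mnorm (site_mat (of_real lam) z True) * mnorm (site_mat (of_real lam) z False) \<le> site_const lam"
proof -
  have b: "mnorm (site_mat (of_real lam) z b) \<le> 2 * lam + 15" for b
    using assms norm_triangle_ineq4[of z "of_real lam"] by (cases b) (auto simp: site_mat_def mnorm_def)
  have "mnorm (site_mat (of_real lam) z True) * mnorm (site_mat (of_real lam) z False) \<le> (2 * lam + 15) * (2 * lam + 15)"
    using assms(2) by (intro mult_mono b mnorm_nonneg) auto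
  then have "2 + mnorm (site_mat (of_real lam) z False) + mnorm (site_mat (of_real lam) z True) +
    mnorm (site_mat (of_real lam) z True) * mnorm (site_mat (of_real lam) z False) \<le>
    2 + (2 * lam + 15) + (2 * lam + 15) + (2 * lam + 15) * (2 * lam + 15)"
    using b by (intro add_mono) auto
  also have "\<dots> \<le> site_const lam" using assms(2) by (simp add: site_const_def power2_eq_square algebra_simps)
  finally show ?thesis .
qed

text \<open>The source at site 0 forces the transform at the sites -1, 0, 1 to be at least of order
  1 / lam. On the side where it is larger, the bound on transfer matrices carries this out to
  distance \<open>fib (2 * j + 1)\<close>.\<close>

lemma time_average_lower:
  fixes lam :: real
  assumes lam: "lam \<ge> 80" and T: "T > 0" and Q: "2 / T * (17 * (lam + 13)) ^ Suc (Suc j) \<le> 1"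
    and N: "N \<le> real (fib (2 * j + 1))"
  shows "(2 / (T * (8 * (lam + 14) ^ (10 * j) * site_const lam * (2 * lam + 13))))\<^sup>2 \<le>
     time_average (outside_prob (fib_hamiltonian lam \<theta>) N) T"
proof -
  obtain E :: real where E: "\<And>z n. cmod (z - of_real E) * (17 * (lam + 13)) ^ Suc (Suc j) \<le> 1 \<Longrightarrow>
     n \<le> 2 * Suc j \<Longrightarrow> cmod (ftrace (of_real lam) z n) \<le> lam + 13"
    using bounded_trace_energy[OF lam, of j] by blast
  define z where "z = Complex E (2 / T)"
  define G where "G = (lam + 14) ^ (10 * j) * site_const lam"
  define c where "c = 8 * G * (2 * lam + 13)"
  define u where "u = laplace lam \<theta> z"
  have Imz: "Im z > 0" using T by (simp add: z_def)
  have "z - of_real E = \<i> * of_real (2 / T)" by (simp add: z_def complex_eq_iff)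
  then have "cmod (z - of_real E) = 2 / T" using T by (simp add: norm_mult norm_divide)
  then have tr: "n \<le> 2 * Suc j \<Longrightarrow> cmod (ftrace (of_real lam) z n) \<le> lam + 13" for n
    using E Q by simp
  \<comment> \<open>The trace at level 1 is the energy itself.\<close>
  have zb: "cmod z \<le> lam + 13" using tr[of "Suc 0"] by simp
  have G1: "G \<ge> 1"
  proof -
    have "1 \<le> (lam + 14) ^ (10 * j)" using lam by (intro one_le_power) auto
    moreover have "1 \<le> site_const lam" using lam by (auto simp: site_const_def intro: one_le_power)
    ultimately have "1 * 1 \<le> (lam + 14) ^ (10 * j) * site_const lam" by (intro mult_mono) auto
    then show ?thesis by (simp add: G_def)
  qed
  have side: "\<exists>n. real n \<ge> N \<and> cmod (u (s * 1)) + cmod (u 0) \<le> 4 * G * cmod (u (s * int n))"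
    if s: "s \<in> {1, -1}" for s
  proof -
    interpret half_line lam z "half_letters \<theta> s" "\<lambda>n. laplace lam \<theta> z (s * int n)"
      by (rule half_line_laplace[OF Imz s])
    let ?M = "word_prod L (half_letters \<theta> s) 0" and ?c = "2 + mnorm (L False) + mnorm (L True) + mnorm (L True) * mnorm (L False)"
    have "\<exists>n\<ge>fib (2 * j + 1). mnorm (?M n) \<le>
       (1 + (lam + 13)) ^ (5 * (2 * j)) * ?c"
    proof (rule word_prod_bound[OF mdet_site_mat mdet_site_mat _ _ coded_half[OF s]])
      show "cmod (mtr (fib_mat L i)) \<le> lam + 13" if "i \<le> Suc (2 * j)" for i
        unfolding mtr_fib_mat by (rule tr) (use that in simp)
    qed (use lam in simp)
    then obtain n where n: "n \<ge> fib (2 * j + 1)" "mnorm (?M n) \<le>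
       (1 + (lam + 13)) ^ (5 * (2 * j)) * ?c"
      by blast
    have "mnorm (?M n) \<le> (1 + (lam + 13)) ^ (5 * (2 * j)) * site_const lam"
      using lam by (intro order_trans[OF n(2)] mult_left_mono site_mat_norm zb) auto
    also have "\<dots> = G" by (simp add: G_def add.commute)
    finally have nG: "mnorm (?M n) \<le> G" .
    have "cmod (u (s * 1)) + cmod (u 0) \<le> 2 * mnorm (?M n) * (cmod (u (s * int (Suc n))) + cmod (u (s * int n)))"
      using initial_le[of 0 n] by (simp add: u_def)
    also have "\<dots> \<le> 2 * G * (cmod (u (s * int (Suc n))) + cmod (u (s * int n)))"
      using nG by (intro mult_right_mono mult_left_mono) auto
    finally have le: "cmod (u (s * 1)) + cmod (u 0) \<le> 2 * G * (cmod (u (s * int (Suc n))) + cmod (u (s * int n)))" .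
    define m where "m = (if cmod (u (s * int n)) \<le> cmod (u (s * int (Suc n))) then Suc n else n)"
    have "cmod (u (s * int (Suc n))) + cmod (u (s * int n)) \<le> 2 * cmod (u (s * int m))" by (simp add: m_def)
    then have "2 * G * (cmod (u (s * int (Suc n))) + cmod (u (s * int n))) \<le> 2 * G * (2 * cmod (u (s * int m)))"
      using G1 by (intro mult_left_mono) auto
    moreover have "real m \<ge> N" using n(1) N by (auto simp: m_def)
    ultimately show ?thesis using le by (intro exI[of _ m]) simp
  qed
  have "u 1 + u (- 1) + (of_real (fib_potential lam \<theta> 0) - z) * u 0 = - \<i>"
    using laplace_equation[OF Imz, of lam \<theta> 0] by (simp add: u_def)
  then have "1 = cmod (u 1 + u (- 1) + (of_real (fib_potential lam \<theta> 0) - z) * u 0)" by simp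
  also have "\<dots> \<le> cmod (u 1) + cmod (u (- 1)) + cmod (of_real (fib_potential lam \<theta> 0) - z) * cmod (u 0)"
    unfolding norm_mult[symmetric] by (intro norm_triangle_le add_mono norm_triangle_ineq order_refl)
  also have "cmod (of_real (fib_potential lam \<theta> 0) - z) \<le> 2 * lam + 13"
    using norm_triangle_ineq4[of "of_real (fib_potential lam \<theta> 0)" z] zb abs_fib_potential_le[of lam \<theta> 0] lam by simp
  finally have one: "1 \<le> cmod (u 1) + cmod (u (- 1)) + (2 * lam + 13) * cmod (u 0)"
    by (auto simp: mult_right_mono)
  have "1 \<le> (2 * lam + 13) * ((cmod (u 1) + cmod (u 0)) + (cmod (u (- 1)) + cmod (u 0)))"
  proof -
    have "1 * cmod (u 1) \<le> (2 * lam + 13) * cmod (u 1)" "1 * cmod (u (-1)) \<le> (2 * lam + 13) * cmod (u (-1))"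
      "0 \<le> (2 * lam + 13) * cmod (u 0)"
      using lam by (intro mult_right_mono mult_nonneg_nonneg; simp)+
    then show ?thesis using one by (simp only: distrib_left)
  qed
  then have "\<exists>s\<in>{1, -1}. 1 \<le> (2 * lam + 13) * (2 * (cmod (u (s * 1)) + cmod (u 0)))"
  proof -
    let ?a = "cmod (u 1) + cmod (u 0)" and ?b = "cmod (u (- 1)) + cmod (u 0)"
    assume 1: "1 \<le> (2 * lam + 13) * (?a + ?b)"
    show ?thesis
    proof (cases "?b \<le> ?a")
      case True
      have "(2 * lam + 13) * (?a + ?b) \<le> (2 * lam + 13) * (2 * ?a)"
        by (rule mult_left_mono) (use True lam in auto)
      then show ?thesis using 1 by (intro bexI[of _ 1]) auto
    next
      case False
      have "(2 * lam + 13) * (?a + ?b) \<le> (2 * lam + 13) * (2 * ?b)"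
        by (rule mult_left_mono) (use False lam in auto)
      then show ?thesis using 1 by (intro bexI[of _ "-1"]) auto
    qed
  qed
  then obtain s :: int where s: "s \<in> {1, -1}" "1 \<le> (2 * lam + 13) * (2 * (cmod (u (s * 1)) + cmod (u 0)))" by blast
  obtain n where n: "real n \<ge> N" "cmod (u (s * 1)) + cmod (u 0) \<le> 4 * G * cmod (u (s * int n))" using side[OF s(1)] by blast
  have "1 \<le> (2 * lam + 13) * (2 * (4 * G * cmod (u (s * int n))))"
    by (rule order_trans[OF s(2)], intro mult_left_mono n(2)) (use lam in auto)
  then have "1 \<le> c * cmod (u (s * int n))" by (simp add: c_def algebra_simps)
  moreover have c: "c > 0" using G1 lam by (auto simp: c_def)
  ultimately have "1 / c \<le> cmod (u (s * int n))" by (simp add: field_simps)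
  then have "(1 / c)\<^sup>2 \<le> (cmod (u (s * int n)))\<^sup>2" using c by (intro power_mono) auto
  also have "\<dots> \<le> T / 2 * mean_prob lam \<theta> (s * int n) T"
    unfolding u_def z_def by (rule laplace_le_mean_prob[OF T])
  finally have "(2 / T)\<^sup>2 * (1 / c)\<^sup>2 \<le> (2 / T)\<^sup>2 * (T / 2 * mean_prob lam \<theta> (s * int n) T)"
    by (intro mult_left_mono) auto
  also have "\<dots> = 2 / T * mean_prob lam \<theta> (s * int n) T" using T by (simp add: power2_eq_square)
  also have "\<dots> \<le> time_average (outside_prob (fib_hamiltonian lam \<theta>) N) T"
    by (rule mean_prob_le_time_average[OF T]) (use s n in auto)
  finally show ?thesis by (simp add: c_def G_def power_mult_distrib power_divide mult_ac)
qed

section \<open>Upper bound for the time averages\<close>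

text \<open>Escape happens at level \<open>k\<close>; \<open>m\<close> further levels make the trace
  at least \<open>2 ^ fib m\<close> over the first complete block. The power of \<open>T\<close> is
  composed of 1 / (Im z)^2 and of the total mass T / 2 on \<open>W\<close>.\<close>

lemma mean_prob_half_line:
  fixes lam :: real
  assumes lam: "lam \<ge> 80" and T: "T > 0" and k: "k \<ge> 2"
    and big: "(lam / 2) ^ (k div 2 - 1) > 3 * real (fib (k + 1)) * T"
    and s: "s \<in> {1, -1}" and F: "finite F" "F \<subseteq> {2 * fib (k + m + 1)<..}"
  shows "(\<Sum>n\<in>F. mean_prob lam \<theta> (s * int n) T) \<le> T ^ 3 / 2 ^ fib m"
proof -
  define e where "e = 1 / T"
  \<comment> \<open>The complete block has level \<open>J\<close> or \<open>Suc J\<close>, thus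
    trace index \<open>k + m\<close> or \<open>k + m + 1\<close>: in both cases at least
    \<open>m\<close> levels past \<open>k\<close>.\<close>
  define J where "J = k + m - 1"
  have J: "J + 2 = k + m + 1" "Suc J = k + m" using k by (auto simp: J_def)
  have e: "e > 0" using T by (simp add: e_def)
  obtain w' p where p: "\<And>i. p (Suc i) = p i + (if w' i then fib (J + 2) else fib (J + 1))"
      "\<And>i L. word_prod L (half_letters \<theta> s) (p i) (p (Suc i) - p i) = (fib_mat L (if w' i then Suc J else J) :: complex mat2)"
    and p0: "p 0 < fib (J + 2)"
    using block_decomposition[OF coded_half[OF s], where J = J] by metis
  define a where "a = p 0"
  define l where "l = p 1 - p 0"
  have lr: "l = (if w' 0 then fib (J + 2) else fib (J + 1))" using p(1)[of 0] by (simp add: l_def)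
  have l1: "l \<ge> 1" using lr by (auto simp: Suc_leI fib_neq_0_nat)
  have l2: "l \<le> fib (J + 2)" using lr by (auto intro: fib_mono)
  have wp: "word_prod L (half_letters \<theta> s) a l = (fib_mat L (if w' 0 then Suc J else J) :: complex mat2)" for L
    using p(2)[of L 0] by (simp add: a_def l_def)
  have al: "a + l + 1 \<le> 2 * fib (J + 2)" using p0 l2 by (simp add: a_def)
  let ?\<eta> = "2 * T\<^sup>2 / 2 ^ fib m"
  \<comment> \<open>These four sites do not depend on the energy.\<close>
  define W where "W = {a, Suc a, Suc (a + l), Suc (Suc (a + l))}"
  let ?h = "\<lambda>n. damped lam \<theta> e (s * int n)"
  have main: "(\<Sum>n\<in>F. (cmod (causal.ft (?h n) E))\<^sup>2) \<le> ?\<eta> * (\<Sum>n\<in>W. (cmod (causal.ft (?h n) E))\<^sup>2)" for E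
  proof -
    define z where "z = Complex E e"
    let ?u = "\<lambda>n. (cmod (laplace lam \<theta> z (s * int n)))\<^sup>2"
    have Imz: "Im z > 0" using e by (simp add: z_def)
    interpret half_line lam z "half_letters \<theta> s" "\<lambda>n. laplace lam \<theta> z (s * int n)"
      by (rule half_line_laplace[OF Imz s])
    \<comment> \<open>Escape requires two consecutive big traces, which is why the hypothesis has
      \<open>fib (k + 1)\<close> in it.\<close>
    have trb: "cmod (ftrace (of_real lam) z i) > 3" if "i \<in> {k, Suc k}" for i
    proof (rule ftrace_large[OF lam _ Imz])
      have "(lam / 2) ^ (k div 2 - 1) \<le> (lam / 2) ^ (i div 2 - 1)"
        using lam that by (intro power_increasing diff_le_mono div_le_mono) auto
      moreover have "3 * real (fib i) * T \<le> 3 * real (fib (k + 1)) * T"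
        using that T by (intro mult_right_mono) (auto intro: fib_mono)
      ultimately have "3 * real (fib i) * T < (lam / 2) ^ (i div 2 - 1)" using big by linarith
      then show "real (3 * fib i) < (lam / 2) ^ (i div 2 - 1) * Im z"
        using T by (simp add: z_def e_def field_simps)
    qed (use that k in auto)
    have tb: "cmod (ftrace (of_real lam) z (k + q)) \<ge> 2 ^ fib q" for q
      by (rule ftrace_escape(1)) (use trb in auto)
    have "cmod (mtr (word_prod L (half_letters \<theta> s) a l)) \<ge> 2 ^ fib m"
    proof -
      have "cmod (ftrace (of_real lam) z (k + Suc m)) \<ge> 2 ^ fib m"
      proof -
        have "(2::real) ^ fib m \<le> 2 ^ fib (Suc m)" by (intro power_increasing fib_mono) auto
        then show ?thesis using tb[of "Suc m"] by linarith
      qed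
      then show ?thesis unfolding wp mtr_fib_mat using tb[of m] J by auto
    qed
    moreover have "(\<lambda>n. laplace lam \<theta> z (s * int n)) \<longlonglongrightarrow> 0"
      using laplace_tendsto_0[OF Imz, of lam \<theta>] s by auto
    moreover have "F \<subseteq> {Suc (a + l)<..}"
    proof
      fix n assume "n \<in> F"
      then have "2 * fib (k + m + 1) < n" using F(2) by blast
      then show "n \<in> {Suc (a + l)<..}" using al unfolding J(1) greaterThan_iff by linarith
    qed
    ultimately have "(\<Sum>n\<in>F. ?u n) \<le> 2 / ((Im z)\<^sup>2 * 2 ^ fib m) *
       (?u a + ?u (Suc a) +
        ?u (Suc (a + l)) + ?u (Suc (Suc (a + l))))"
      using F(1) by (intro solution_decay[OF Imz _ l1]) auto
    also have "2 / ((Im z)\<^sup>2 * 2 ^ fib m) = ?\<eta>" using T by (simp add: z_def e_def power_divide)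
    also have "?u a + ?u (Suc a) +
        ?u (Suc (a + l)) + ?u (Suc (Suc (a + l)))
       = (\<Sum>n\<in>W. ?u n)"
      using l1 by (simp add: W_def add.assoc)
    finally show ?thesis by (simp only: z_def laplace_ft[OF e])
  qed
  have "(\<Sum>n\<in>F. causal.energy (?h n)) \<le> ?\<eta> * (\<Sum>n\<in>W. causal.energy (?h n))"
    by (rule plancherel_sum_le[OF causal_damped[OF e] F(1) _ _ main]) (auto simp: W_def)
  then have "(\<Sum>n\<in>F. mean_prob lam \<theta> (s * int n) T) \<le> ?\<eta> * (\<Sum>n\<in>W. mean_prob lam \<theta> (s * int n) T)"
    by (simp only: e_def energy_damped[OF T])
  also have "(\<Sum>n\<in>W. mean_prob lam \<theta> (s * int n) T) = (\<Sum>n\<in>(\<lambda>n. s * int n) ` W. mean_prob lam \<theta> n T)"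
    using s by (subst sum.reindex) (auto simp: inj_on_def)
  finally have "(\<Sum>n\<in>F. mean_prob lam \<theta> (s * int n) T) \<le> ?\<eta> * (\<Sum>n\<in>(\<lambda>n. s * int n) ` W. mean_prob lam \<theta> n T)" .
  also have "\<dots> \<le> ?\<eta> * (T / 2)"
    by (intro mult_left_mono mean_prob_sum_le[OF T]) (simp_all add: W_def)
  also have "\<dots> = T ^ 3 / 2 ^ fib m" by (simp add: power2_eq_square power3_eq_cube)
  finally show ?thesis .
qed

lemma time_average_upper:
  fixes lam :: real
  assumes lam: "lam \<ge> 80" and T: "T > 0" and k: "k \<ge> 2"
    and big: "(lam / 2) ^ (k div 2 - 1) > 3 * real (fib (k + 1)) * T"
    and N: "N \<ge> 2 * real (fib (k + m + 1)) + 1"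
  shows "time_average (outside_prob (fib_hamiltonian lam \<theta>) N) T \<le> 4 * T\<^sup>2 / 2 ^ fib m"
proof -
  have half: "(\<Sum>n\<in>F. mean_prob lam \<theta> n T) \<le> T ^ 3 / 2 ^ fib m"
    if F: "finite F" and s: "s \<in> {1, -1}" and Fs: "\<And>n. n \<in> F \<Longrightarrow> real_of_int (s * n) \<ge> N" for F and s :: int
  proof -
    let ?G = "(\<lambda>n. nat (s * n)) ` F"
    have pos: "s * n > 2 * int (fib (k + m + 1))" if "n \<in> F" for n
      using Fs[OF that] N by linarith
    have ss: "s * (s * n) = n" for n using s by auto
    have inv: "s * int (nat (s * n)) = n" if "n \<in> F" for n
    proof -
      have "0 \<le> s * n" using pos[OF that] by linarith
      then have "int (nat (s * n)) = s * n" by (rule nat_0_le)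
      then show ?thesis by (simp only: ss)
    qed
    have "inj_on (\<lambda>n. nat (s * n)) F"
      by (rule inj_on_inverseI[where g = "\<lambda>j. s * int j"]) (rule inv)
    then have "(\<Sum>n\<in>?G. mean_prob lam \<theta> (s * int n) T) =
        (\<Sum>n\<in>F. mean_prob lam \<theta> (s * int (nat (s * n))) T)"
      by (rule sum.reindex[unfolded o_def])
    also have "\<dots> = (\<Sum>n\<in>F. mean_prob lam \<theta> n T)"
      by (intro sum.cong) (simp_all only: inv)
    finally have "(\<Sum>n\<in>?G. mean_prob lam \<theta> (s * int n) T) = (\<Sum>n\<in>F. mean_prob lam \<theta> n T)" .
    moreover have "(\<Sum>n\<in>?G. mean_prob lam \<theta> (s * int n) T) \<le> T ^ 3 / 2 ^ fib m"
    proof (rule mean_prob_half_line[OF lam T k big s])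
      show "?G \<subseteq> {2 * fib (k + m + 1)<..}"
      proof
        fix x assume "x \<in> ?G"
        then obtain n where "n \<in> F" "x = nat (s * n)" by blast
        then show "x \<in> {2 * fib (k + m + 1)<..}" using pos[of n] unfolding greaterThan_iff by linarith
      qed
    qed (use F in simp)
    ultimately show ?thesis by simp
  qed
  have "time_average (outside_prob (fib_hamiltonian lam \<theta>) N) T \<le> 4 * (T ^ 3 / 2 ^ fib m) / T"
  proof (rule time_average_le[OF T])
    show "(\<Sum>n\<in>F. mean_prob lam \<theta> n T) \<le> T ^ 3 / 2 ^ fib m" if "finite F" "F \<subseteq> {n. real_of_int n \<ge> N}" for F
      by (rule half[of F 1]) (use that in auto)
    show "(\<Sum>n\<in>F. mean_prob lam \<theta> n T) \<le> T ^ 3 / 2 ^ fib m" if "finite F" "F \<subseteq> {n. real_of_int n \<le> - N}" for F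
      by (rule half[of F "-1"]) (use that in fastforce)+
  qed
  also have "\<dots> = 4 * T\<^sup>2 / 2 ^ fib m" using T by (simp add: power2_eq_square power3_eq_cube)
  finally show ?thesis .
qed

section \<open>Exponents\<close>

lemma fib_golden_bounds: "golden ^ n \<le> golden\<^sup>2 * real (fib n) \<or> n = 0" "real (fib n) \<le> golden ^ n"
proof -
  have sq: "golden * golden = golden + 1" using golden_square by (simp add: power2_eq_square)
  have g: "golden > 1" by (rule golden_gt_1)
  have "golden ^ Suc n \<le> golden\<^sup>2 * real (fib (Suc n)) \<and> golden ^ Suc (Suc n) \<le> golden\<^sup>2 * real (fib (Suc (Suc n)))" for n
  proof (induction n)
    case 0
    have "golden * 1 \<le> golden * golden" using g by (intro mult_left_mono) auto
    then show ?case by (simp add: power2_eq_square)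
  next
    case (Suc n)
    have "golden ^ Suc (Suc (Suc n)) = golden ^ Suc n * (golden * golden)" by simp
    also have "\<dots> = golden ^ Suc (Suc n) + golden ^ Suc n" unfolding sq by (simp add: algebra_simps)
    also have "\<dots> \<le> golden\<^sup>2 * real (fib (Suc (Suc n))) + golden\<^sup>2 * real (fib (Suc n))"
      using Suc by (intro add_mono) auto
    finally show ?case using Suc by (simp add: algebra_simps)
  qed
  then show "golden ^ n \<le> golden\<^sup>2 * real (fib n) \<or> n = 0" by (cases n) auto
  have "real (fib n) \<le> golden ^ n \<and> real (fib (Suc n)) \<le> golden ^ Suc n"
  proof (induction n)
    case 0
    then show ?case using g by simp
  next
    case (Suc n)
    have "golden ^ Suc (Suc n) = golden ^ n * (golden * golden)" by simp
    also have "\<dots> = golden ^ Suc n + golden ^ n" unfolding sq by (simp add: algebra_simps)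
    finally show ?case using Suc by simp
  qed
  then show "real (fib n) \<le> golden ^ n" by blast
qed

lemma fib_ge_exp:
  assumes "n \<ge> 1"
  shows "exp ((real n - 2) * ln golden) \<le> real (fib n)"
proof -
  have g: "golden > 0" using golden_gt_1 by simp
  have "exp ((real n - 2) * ln golden) = golden ^ n / golden\<^sup>2"
    using g by (simp add: left_diff_distrib exp_diff exp_of_nat_mult exp_of_nat_mult[of 2, simplified])
  also have "\<dots> \<le> real (fib n)"
    using fib_golden_bounds(1)[of n] assms g by (simp add: field_simps)
  finally show ?thesis .
qed

lemma fib_le_exp: "real (fib n) \<le> exp (real n * ln golden)"
  using fib_golden_bounds(2)[of n] golden_gt_1 by (simp add: exp_of_nat_mult)

lemma ln_golden_pos: "ln golden > 0"
  using golden_gt_1 by simp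

section \<open>Bounds for the two exponents\<close>

lemma S_plus_le_S_minus: "S_plus H \<alpha> \<le> S_minus H \<alpha>"
  unfolding S_plus_def S_minus_def by (simp add: Liminf_le_Limsup)

lemma alpha_u_minus_le_plus: "alpha_u_minus H \<le> alpha_u_plus H"
  unfolding alpha_u_minus_def alpha_u_plus_def
  using S_plus_le_S_minus by (intro Sup_subset_mono) (blast intro: le_less_trans)

text \<open>For time \<open>T\<close> take \<open>j\<close> close to ln T / q. The distance reached
  is about golden^(2j), a power of \<open>T\<close> with exponent \<open>2 * g / q\<close>, and the
  probability there is at least a fixed negative power of \<open>T\<close>.\<close>

lemma alpha_u_minus_lower:
  fixes lam :: real
  assumes lam: "lam \<ge> 80"
  shows "ereal (2 * ln golden / ln (17 * (lam + 13))) \<le> alpha_u_minus (fib_hamiltonian lam \<theta>)"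
proof -
  define H where "H = fib_hamiltonian lam \<theta>"
  define q where "q = ln (17 * (lam + 13))"
  define g where "g = ln golden"
  have q: "q > 0" using lam by (simp add: q_def)
  have g: "g > 0" unfolding g_def by (rule ln_golden_pos)
  define A where "A = ln (8 * site_const lam * (2 * lam + 13))"
  define B where "B = ln (lam + 14)"
  have cp: "8 * site_const lam * (2 * lam + 13) > 0" using lam by (simp add: site_const_def)
  have B0: "B \<ge> 0" using lam by (simp add: B_def)
  have key: "S_minus H \<alpha> < \<infinity>" if \<alpha>: "\<alpha> < 2 * g / q" for \<alpha>
  proof -
    \<comment> \<open>The subtraction accounts for the exponent \<open>Suc (Suc j)\<close> in the
      hypothesis on \<open>T\<close>.\<close>
    define j where "j T = nat \<lfloor>ln (T / 2) / q\<rfloor> - 2" for T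
    have ev1: "\<forall>\<^sub>F T in at_top. ln (T / 2) / q \<ge> 3" using q by real_asymp
    have ev2: "\<forall>\<^sub>F T in at_top. \<alpha> * ln T \<le> (2 * (ln (T / 2) / q - 3) - 1) * g"
    proof -
      have "\<forall>\<^sub>F T in at_top. 0 \<le> (2 * g / q - \<alpha>) * ln T - (2 * ln 2 / q + 7) * g"
        using \<alpha> by real_asymp
      then show ?thesis using eventually_gt_at_top[of 0]
      proof eventually_elim
        case (elim T)
        have ln: "ln (T / 2) = ln T - ln 2" using elim by (simp add: ln_div)
        have "(2 * (ln (T / 2) / q - 3) - 1) * g = 2 * g / q * ln T - (2 * ln 2 / q + 7) * g"
          unfolding ln by (simp add: algebra_simps diff_divide_distrib)
        then show ?case using elim by (simp add: left_diff_distrib)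
      qed
    qed
    \<comment> \<open>Twice the exponent of 1 / y in \<open>T\<close>: 1 from the factor
      \<open>T\<close>, at most \<open>\<bar>A\<bar>\<close> from the constants as soon as
      \<open>ln T \<ge> 1\<close>, and \<open>10 * B / q\<close> from the growth of transfer
      matrices.\<close>
    define C where "C = 2 + 2 * \<bar>A\<bar> + 20 * B / q"
    have "\<forall>\<^sub>F T in at_top. ereal (- C) \<le> log_ratio H \<alpha> T"
      using ev1 ev2 eventually_ge_at_top[of "exp 1"] eventually_ge_at_top[of "4::real"]
    proof eventually_elim
      case (elim T)
      have T: "T > 0" using elim by simp
      have lnT: "ln T \<ge> 1" using elim(3) by (simp add: ln_ge_iff T)
      define i where "i = j T"
      have i1: "real (i + 2) \<le> ln (T / 2) / q" and i2: "real i \<ge> ln (T / 2) / q - 3"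
      proof -
        have "nat \<lfloor>ln (T / 2) / q\<rfloor> \<ge> 2" using elim(1) by linarith
        then have "real (i + 2) = of_int \<lfloor>ln (T / 2) / q\<rfloor>" using elim(1) by (simp add: i_def j_def)
        then show "real (i + 2) \<le> ln (T / 2) / q" "real i \<ge> ln (T / 2) / q - 3" by linarith+
      qed
      have "real (i + 2) * q \<le> ln (T / 2)" using i1 q by (simp add: field_simps)
      then have "exp (real (i + 2) * q) \<le> T / 2" using T by (metis exp_le_cancel_iff exp_ln half_gt_zero)
      moreover have "exp (real (i + 2) * q) = (17 * (lam + 13)) ^ (i + 2)"
        unfolding exp_of_nat_mult q_def using lam by simp
      ultimately have Q: "2 / T * (17 * (lam + 13)) ^ Suc (Suc i) \<le> 1"
        using T by (simp add: field_simps)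
      have "T powr \<alpha> = exp (\<alpha> * ln T)" using T by (simp add: powr_def)
      also have "\<dots> \<le> exp ((real (2 * i + 1) - 2) * g)"
      proof -
        have "(2 * (ln (T / 2) / q - 3) - 1) * g \<le> (real (2 * i + 1) - 2) * g"
          using i2 g by (intro mult_right_mono) auto
        then show ?thesis using elim(2) by simp
      qed
      also have "\<dots> \<le> real (fib (2 * i + 1))" unfolding g_def by (rule fib_ge_exp) simp
      finally have N: "T powr \<alpha> - 1 \<le> real (fib (2 * i + 1))" by simp
      define x where "x = time_average (outside_prob H (T powr \<alpha> - 1)) T"
      define y where "y = 2 / (T * (8 * (lam + 14) ^ (10 * i) * site_const lam * (2 * lam + 13)))"
      have xy: "y\<^sup>2 \<le> x" unfolding x_def y_def H_def by (rule time_average_lower[OF lam T Q N])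
      have y: "y > 0" using T lam by (simp add: y_def site_const_def)
      have xp: "x > 0" using xy y by (metis less_le_trans zero_less_power)
      have lny: "ln y = ln 2 - ln T - A - 10 * real i * B"
      proof -
        have y_eq: "y = 2 / (T * ((8 * site_const lam * (2 * lam + 13)) * (lam + 14) ^ (10 * i)))" by (simp only: y_def mult_ac)
        have gen: "ln (2 / (T * (P * R ^ (10 * i)))) = ln 2 - ln T - ln P - 10 * real i * ln R"
          if "P > 0" "R > 0" for P R :: real
          using T that by (simp add: ln_div ln_mult ln_realpow)
        show ?thesis unfolding y_eq A_def B_def by (rule gen[OF cp]) (use lam in simp)
      qed
      have "10 * real i * B \<le> 10 * (ln T / q) * B"
      proof -
        have "real i \<le> ln (T / 2) / q" using i1 by simp
        also have "\<dots> \<le> ln T / q" using q T by (intro divide_right_mono) auto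
        finally show ?thesis using B0 by (intro mult_right_mono mult_left_mono) auto
      qed
      moreover have "ln 2 \<ge> (0::real)" by simp
      moreover have "A \<le> \<bar>A\<bar> * ln T" using lnT mult_left_mono[of 1 "ln T" "\<bar>A\<bar>"] by simp
      moreover have "- 2 * t - 2 * r * t - 20 * v * B \<le> 2 * (c - t - A - p)"
        if "p \<le> 10 * v * B" "0 \<le> c" "A \<le> r * t" for t r v c p :: real
        using that by (simp add: algebra_simps)
      ultimately have "2 * ln y \<ge> - 2 * ln T - 2 * \<bar>A\<bar> * ln T - 20 * (ln T / q) * B"
        unfolding lny by blast
      also have "- 2 * ln T - 2 * \<bar>A\<bar> * ln T - 20 * (ln T / q) * B = - C * ln T"
        by (simp add: C_def algebra_simps)
      finally have "- C * ln T \<le> ln (y\<^sup>2)" using y by (simp add: ln_realpow)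
      also have "\<dots> \<le> ln x" using xy y xp by simp
      finally have "- C \<le> ln x / ln T" using lnT by (simp add: field_simps)
      then show "ereal (- C) \<le> log_ratio H \<alpha> T"
        using xp lnT unfolding log_ratio_def x_def[symmetric] ext_ln_def by simp
    qed
    then have "ereal (- C) \<le> Liminf at_top (log_ratio H \<alpha>)" by (rule Liminf_bounded)
    then have "- Liminf at_top (log_ratio H \<alpha>) \<le> - ereal (- C)" by (simp only: ereal_minus_le_minus)
    then show ?thesis unfolding S_minus_def by (rule le_less_trans) simp
  qed
  show ?thesis
  proof (rule dense_le)
    fix y assume y: "y < ereal (2 * ln golden / ln (17 * (lam + 13)))"
    show "y \<le> alpha_u_minus (fib_hamiltonian lam \<theta>)"
    proof (cases "y \<le> 0")
      case True
      have "0 < 2 * g / q" using g q by simp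
      then have "ereal 0 \<in> {ereal \<alpha> |\<alpha>. \<alpha> \<ge> 0 \<and> S_minus (fib_hamiltonian lam \<theta>) \<alpha> < \<infinity>}"
        using key[of 0] by (auto simp: H_def)
      then have "ereal 0 \<le> alpha_u_minus (fib_hamiltonian lam \<theta>)"
        unfolding alpha_u_minus_def by (rule Sup_upper)
      then show ?thesis using True by (metis order_trans zero_ereal_def)
    next
      case False
      then obtain \<alpha> where \<alpha>: "y = ereal \<alpha>" "\<alpha> > 0" using y by (cases y) auto
      then have "\<alpha> < 2 * g / q" using y by (simp add: g_def q_def)
      then have "y \<in> {ereal \<alpha> |\<alpha>. \<alpha> \<ge> 0 \<and> S_minus (fib_hamiltonian lam \<theta>) \<alpha> < \<infinity>}"
        using key[of \<alpha>] \<alpha> by (auto simp: H_def intro!: exI[of _ \<alpha>])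
      then show ?thesis unfolding alpha_u_minus_def by (rule Sup_upper)
    qed
  qed
qed

text \<open>With \<open>k\<close> near \<open>\<beta> * ln T\<close> the orbit has escaped if
  \<open>\<beta> * \<rho> > 1\<close>, and \<open>m\<close> near \<open>\<gamma> * ln T\<close>
  further levels stay within distance T^\<alpha>. There \<open>fib m\<close> is of the order of a
  positive power of \<open>T\<close>, so \<open>2 ^ fib m\<close> beats every power of
  \<open>T\<close> and the exponent is infinite.\<close>

lemma alpha_u_plus_upper:
  fixes lam :: real
  assumes lam: "lam \<ge> 80"
  shows "alpha_u_plus (fib_hamiltonian lam \<theta>) \<le> ereal (ln golden / (ln (lam / 2) / 2 - ln golden))"
proof -
  define H where "H = fib_hamiltonian lam \<theta>"
  define g where "g = ln golden"
  define \<mu> where "\<mu> = ln (lam / 2)"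
  \<comment> \<open>Per level, the derivative gains \<mu> / 2 in the logarithm, while the degree of
    the trace costs \<open>g\<close>.\<close>
  define \<rho> where "\<rho> = \<mu> / 2 - g"
  have g: "g > 0" unfolding g_def by (rule ln_golden_pos)
  have mu0: "\<mu> > 0" using lam by (simp add: \<mu>_def)
  have \<rho>: "\<rho> > 0"
  proof -
    have "sqrt 5 \<le> 3" by (simp add: real_le_lsqrt)
    then have "golden \<le> 2" by (simp add: golden_def)
    then have "golden\<^sup>2 \<le> 2\<^sup>2" using golden_gt_1 by (intro power_mono) auto
    then have "golden\<^sup>2 < lam / 2" using lam by simp
    then have "ln (golden\<^sup>2) < ln (lam / 2)" using golden_gt_1 lam by (subst ln_less_cancel_iff) auto
    then show ?thesis using golden_gt_1 by (simp add: \<rho>_def \<mu>_def g_def ln_realpow)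
  qed
  have key: "S_plus H \<alpha> = \<infinity>" if \<alpha>: "\<alpha> > g / \<rho>" for \<alpha>
  proof -
    have "1 / \<rho> < \<alpha> / g" using \<alpha> \<rho> g by (simp add: field_simps)
    then obtain \<beta> where \<beta>: "1 / \<rho> < \<beta>" "\<beta> < \<alpha> / g" using dense by blast
    \<comment> \<open>Half of the room left between \<beta> and \<alpha> / g.\<close>
    define \<gamma> where "\<gamma> = (\<alpha> / g - \<beta>) / 2"
    have \<gamma>: "\<gamma> > 0" "(\<beta> + \<gamma>) * g < \<alpha>" using \<beta> g by (auto simp: \<gamma>_def field_simps)
    have \<beta>0: "\<beta> > 0" "\<beta> * \<rho> > 1" using \<beta>(1) \<rho> by (auto simp: field_simps intro: less_trans[of 0 "1 / \<rho>"])
    have \<alpha>0: "\<alpha> > 0" using \<alpha> g \<rho> by (meson divide_pos_pos less_trans)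
    define k where "k T = nat \<lceil>\<beta> * ln T\<rceil>" for T
    define m where "m T = nat \<lceil>\<gamma> * ln T\<rceil>" for T
    have bound: "\<forall>\<^sub>F T in at_top. log_ratio H \<alpha> T \<le> ereal (- M)" if M: "M > 0" for M
    proof -
      have ev1: "\<forall>\<^sub>F T in at_top. \<beta> * ln T \<ge> 4" using \<beta>0 by real_asymp
      have ev2: "\<forall>\<^sub>F T in at_top. \<gamma> * ln T \<ge> 1" using \<gamma> by real_asymp
      \<comment> \<open>The constants come from the factor 3, the index \<open>k + 1\<close> and the
        rounding in \<open>k div 2 - 1\<close>.\<close>
      have ev3: "\<forall>\<^sub>F T in at_top. \<beta> * ln T * \<rho> > ln T + (ln 3 + g + 3 / 2 * \<mu>)"
      proof -
        have "\<forall>\<^sub>F T in at_top. (\<beta> * \<rho> - 1) * ln T - (ln 3 + g + 3 / 2 * \<mu>) > 0" using \<beta>0 by real_asymp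
        then show ?thesis by eventually_elim (simp add: algebra_simps)
      qed
      \<comment> \<open>The 3 covers the two ceilings and the index shift in
        \<open>fib (k + m + 1)\<close>.\<close>
      have ev4: "\<forall>\<^sub>F T in at_top. 2 * exp (((\<beta> + \<gamma>) * ln T + 3) * g) + 2 \<le> exp (\<alpha> * ln T)"
      proof -
        have "\<forall>\<^sub>F T in at_top. 2 * exp (3 * g) * exp (((\<beta> + \<gamma>) * g) * ln T) + 2 \<le> exp (\<alpha> * ln T)"
        proof -
          define \<delta> where "\<delta> = (\<beta> + \<gamma>) * g"
          have "0 < \<delta>" "\<delta> < \<alpha>" using \<gamma> \<beta>0 g by (auto simp: \<delta>_def)
          then have "\<forall>\<^sub>F T in at_top. 2 * exp (3 * g) * exp (\<delta> * ln T) + 2 \<le> exp (\<alpha> * ln T)" by real_asymp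
          then show ?thesis by (simp add: \<delta>_def)
        qed
        then show ?thesis by eventually_elim (simp add: algebra_simps exp_add[symmetric])
      qed
      have ev5: "\<forall>\<^sub>F T in at_top. ln 4 + 2 * ln T - exp ((\<gamma> * ln T - 2) * g) * ln 2 \<le> - M * ln T"
      proof -
        define \<delta> where "\<delta> = \<gamma> * g"
        define c where "c = exp (- 2 * g) * ln 2"
        have "\<delta> > 0" "c > 0" using \<gamma> g by (auto simp: \<delta>_def c_def)
        then have "\<forall>\<^sub>F T in at_top. ln 4 + 2 * ln T - exp (\<delta> * ln T) * c \<le> - M * ln T" by real_asymp
        then show ?thesis
          by eventually_elim (simp add: \<delta>_def c_def algebra_simps exp_add[symmetric] exp_diff exp_minus field_simps)
      qed
      show ?thesis
        using ev1 ev2 ev3 ev4 ev5 eventually_ge_at_top[of "exp 1"]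
      proof eventually_elim
        case (elim T)
        have T: "T > 0" using elim(6) by (meson exp_gt_zero less_le_trans)
        have lnT: "ln T \<ge> 1" using elim(6) by (simp add: ln_ge_iff T)
        define k' where "k' = k T"
        define m' where "m' = m T"
        have kb: "\<beta> * ln T \<le> real k'" "real k' \<le> \<beta> * ln T + 1"
          using elim(1) by (auto simp: k'_def k_def intro: real_nat_ceiling_ge)
        have mb: "\<gamma> * ln T \<le> real m'" "real m' \<le> \<gamma> * ln T + 1"
          using elim(2) by (auto simp: m'_def m_def intro: real_nat_ceiling_ge)
        have k2: "k' \<ge> 4" using kb(1) elim(1) by linarith
        have big: "(lam / 2) ^ (k' div 2 - 1) > 3 * real (fib (k' + 1)) * T"
        proof -
          have "real (k' div 2 - 1) \<ge> real k' / 2 - 3 / 2" using k2 by linarith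
          then have "(real k' / 2 - 3 / 2) * \<mu> \<le> real (k' div 2 - 1) * \<mu>" using mu0 by (intro mult_right_mono) auto
          moreover have "\<beta> * ln T * \<rho> \<le> real k' * \<rho>" using kb \<rho> by (intro mult_right_mono) auto
          then have "real k' * (\<mu> / 2) - real k' * g > ln T + (ln 3 + g + 3 / 2 * \<mu>)"
            using elim(3) by (simp add: \<rho>_def algebra_simps)
          ultimately have "ln 3 + real (k' + 1) * g + ln T < real (k' div 2 - 1) * \<mu>" by (simp add: algebra_simps)
          then have "exp (ln 3 + real (k' + 1) * g + ln T) < exp (real (k' div 2 - 1) * \<mu>)" by simp
          then have "3 * exp (real (k' + 1) * g) * T < exp (real (k' div 2 - 1) * \<mu>)" using T by (simp add: exp_add)
          moreover have "3 * real (fib (k' + 1)) * T \<le> 3 * exp (real (k' + 1) * g) * T"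
            using T fib_le_exp[of "k' + 1"] unfolding g_def by (intro mult_right_mono mult_left_mono) auto
          moreover have "exp (real (k' div 2 - 1) * \<mu>) = (lam / 2) ^ (k' div 2 - 1)"
            unfolding exp_of_nat_mult \<mu>_def using lam by simp
          ultimately show ?thesis by linarith
        qed
        have N: "T powr \<alpha> - 1 \<ge> 2 * real (fib (k' + m' + 1)) + 1"
        proof -
          have "real (fib (k' + m' + 1)) \<le> exp (real (k' + m' + 1) * g)" unfolding g_def by (rule fib_le_exp)
          also have "\<dots> \<le> exp (((\<beta> + \<gamma>) * ln T + 3) * g)"
          proof -
            have "real (k' + m' + 1) \<le> (\<beta> + \<gamma>) * ln T + 3" using kb mb by (simp add: algebra_simps)
            then have "real (k' + m' + 1) * g \<le> ((\<beta> + \<gamma>) * ln T + 3) * g" using g by (intro mult_right_mono) auto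
            then show ?thesis by simp
          qed
          finally show ?thesis using elim(4) T by (simp add: powr_def)
        qed
        define x where "x = time_average (outside_prob H (T powr \<alpha> - 1)) T"
        have x: "x \<le> 4 * T\<^sup>2 / 2 ^ fib m'"
          unfolding x_def H_def by (rule time_average_upper[OF lam T _ big N]) (use k2 in simp)
        have "m' \<ge> 1" using mb(1) elim(2) by linarith
        then have "exp ((real m' - 2) * g) \<le> real (fib m')" unfolding g_def by (rule fib_ge_exp)
        moreover have "exp ((\<gamma> * ln T - 2) * g) \<le> exp ((real m' - 2) * g)" using mb g by (simp add: mult_right_mono)
        ultimately have "exp ((\<gamma> * ln T - 2) * g) \<le> real (fib m')" by (rule order_trans[rotated])
        then have "exp ((\<gamma> * ln T - 2) * g) * ln 2 \<le> real (fib m') * ln 2"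
          by (intro mult_right_mono) auto
        moreover have "ln (4 * T\<^sup>2 / 2 ^ fib m') = ln 4 + 2 * ln T - real (fib m') * ln 2"
          using T by (simp add: ln_div ln_mult ln_realpow)
        ultimately have lnle: "ln (4 * T\<^sup>2 / 2 ^ fib m') \<le> - M * ln T" using elim(5) by linarith
        show "log_ratio H \<alpha> T \<le> ereal (- M)"
        proof (cases "x > 0")
          case True
          then have "ln x \<le> ln (4 * T\<^sup>2 / 2 ^ fib m')" using x by simp
          then have "ln x / ln T \<le> - M" using lnle lnT by (simp add: field_simps)
          then show ?thesis using True lnT unfolding log_ratio_def x_def[symmetric] ext_ln_def by simp
        next
          \<comment> \<open>Here \<open>ext_ln\<close> has the value -\<infinity>, so the estimate
            is immediate.\<close>
          case False
          then show ?thesis using lnT unfolding log_ratio_def x_def[symmetric] ext_ln_def by simp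
        qed
      qed
    qed
    have le: "Limsup at_top (log_ratio H \<alpha>) \<le> ereal (- M)" if "M > 0" for M
      by (rule Limsup_bounded[OF bound[OF that]])
    have "Limsup at_top (log_ratio H \<alpha>) = -\<infinity>"
    proof (rule ereal_bot)
      fix B :: real
      show "Limsup at_top (log_ratio H \<alpha>) \<le> ereal B"
        using le[of "\<bar>B\<bar> + 1"] by (rule order_trans) auto
    qed
    then show ?thesis by (simp add: S_plus_def)
  qed
  show ?thesis
    unfolding alpha_u_plus_def
  proof (rule Sup_least)
    fix y assume "y \<in> {ereal \<alpha> |\<alpha>. \<alpha> \<ge> 0 \<and> S_plus (fib_hamiltonian lam \<theta>) \<alpha> < \<infinity>}"
    then obtain \<alpha> where "y = ereal \<alpha>" "S_plus H \<alpha> < \<infinity>" by (auto simp: H_def)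
    then show "y \<le> ereal (ln golden / (ln (lam / 2) / 2 - ln golden))"
      using key[of \<alpha>] by (auto simp: g_def \<rho>_def \<mu>_def not_less[symmetric])
  qed
qed

theorem corollary2:
  fixes \<theta> :: real
  assumes "0 \<le> \<theta>" and "\<theta> < 1"
  shows "((\<lambda>lam::real. alpha_u_plus (fib_hamiltonian lam \<theta>) * ereal (ln lam))
            \<longlongrightarrow> ereal (2 * ln golden)) at_top
       \<and> ((\<lambda>lam::real. alpha_u_minus (fib_hamiltonian lam \<theta>) * ereal (ln lam))
            \<longlongrightarrow> ereal (2 * ln golden)) at_top"
proof -
  \<comment> \<open>Both denominators are a constant multiple of ln lam up to bounded terms, so the
    two products have the same limit.\<close>
  let ?lo = "\<lambda>lam. 2 * ln golden / ln (17 * (lam + 13)) * ln lam"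
  let ?hi = "\<lambda>lam. ln golden / (ln (lam / 2) / 2 - ln golden) * ln lam"
  have lo: "((\<lambda>lam. ereal (?lo lam)) \<longlongrightarrow> ereal (2 * ln golden)) at_top"
    unfolding lim_ereal
  proof -
    define g where "g = ln golden"
    have "((\<lambda>lam. 2 * g / ln (17 * (lam + 13)) * ln lam) \<longlongrightarrow> 2 * g) at_top" by real_asymp
    then show "(?lo \<longlongrightarrow> 2 * ln golden) at_top" by (simp add: g_def)
  qed
  have hi: "((\<lambda>lam. ereal (?hi lam)) \<longlongrightarrow> ereal (2 * ln golden)) at_top"
    unfolding lim_ereal
  proof -
    define g where "g = ln golden"
    have "((\<lambda>lam. g / (ln (lam / 2) / 2 - g) * ln lam) \<longlongrightarrow> 2 * g) at_top" by real_asymp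
    then show "(?hi \<longlongrightarrow> 2 * ln golden) at_top" by (simp add: g_def)
  qed
  have bounds: "ereal (?lo lam) \<le> alpha_u_minus (fib_hamiltonian lam \<theta>) * ereal (ln lam)"
    "alpha_u_minus (fib_hamiltonian lam \<theta>) * ereal (ln lam) \<le> alpha_u_plus (fib_hamiltonian lam \<theta>) * ereal (ln lam)"
    "alpha_u_plus (fib_hamiltonian lam \<theta>) * ereal (ln lam) \<le> ereal (?hi lam)" if "lam \<ge> 80" for lam
  proof -
    have ln: "0 \<le> ereal (ln lam)" using that by simp
    show "ereal (?lo lam) \<le> alpha_u_minus (fib_hamiltonian lam \<theta>) * ereal (ln lam)"
      using ereal_mult_right_mono[OF alpha_u_minus_lower[OF that] ln] by simp
    show "alpha_u_minus (fib_hamiltonian lam \<theta>) * ereal (ln lam) \<le> alpha_u_plus (fib_hamiltonian lam \<theta>) * ereal (ln lam)"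
      by (rule ereal_mult_right_mono[OF alpha_u_minus_le_plus ln])
    show "alpha_u_plus (fib_hamiltonian lam \<theta>) * ereal (ln lam) \<le> ereal (?hi lam)"
      using ereal_mult_right_mono[OF alpha_u_plus_upper[OF that] ln] by simp
  qed
  have ev: "\<forall>\<^sub>F lam in at_top. (80::real) \<le> lam" by (rule eventually_ge_at_top)
  show ?thesis
  proof
    show "((\<lambda>lam::real. alpha_u_plus (fib_hamiltonian lam \<theta>) * ereal (ln lam)) \<longlongrightarrow> ereal (2 * ln golden)) at_top"
      by (rule tendsto_sandwich[OF _ _ lo hi]; rule eventually_mono[OF ev]) (use bounds in \<open>blast intro: order_trans\<close>)+
    show "((\<lambda>lam::real. alpha_u_minus (fib_hamiltonian lam \<theta>) * ereal (ln lam)) \<longlongrightarrow> ereal (2 * ln golden)) at_top"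
      by (rule tendsto_sandwich[OF _ _ lo hi]; rule eventually_mono[OF ev]) (use bounds in \<open>blast intro: order_trans\<close>)+
  qed
qed

end
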